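(* Let $\mathbf{A}$ be a polycategory. The system of $\Sigma\Pi_{\mathbf{A}}$-terms under the cut-elimination rewrites $\Rightarrow$ is confluent modulo the permuting conversions $\leftrightarrow$. That is, whenever two terms $t$ and $t'$ are connected by a finite chain of steps, each of which is a cut-elimination rewrite (in either direction) or a permuting conversion, there are terms $s,s'$ such that $t$ reduces to $s$ and $t'$ reduces to $s'$ by finitely many (possibly zero) cut-elimination rewrites, and $s$ and $s'$ are related by finitely many permuting conversions alone.
   Context: Logic and terms. Let $\mathbf{A}$ be a symmetric polycategory. Formulas of $\Sigma\Pi_{\mathbf{A}}$ are the objects of $\mathbf{A}$ (atoms) and, for every finite (possibly empty) set $I$ and formulas $X_i$ ($i\in I$), the sum $\sum_{i\in I}a_i{:}X_i$ and the product $\prod_{i\in I}a_i{:}X_i$ (the $a_i$ are distinct names of the components). A sequent $\Gamma\vdash\Delta$ consists of two finite unordered families of formulas, every occurrence being labelled by a distinct channel name (Greek letter). Terms (derivations) are formed as follows. - Axioms: every polymorphism $f:\Gamma\to\Delta$ of $\mathbf{A}$ between atoms; in particular the identity $1_A$ derives $\alpha{:}A\vdash\beta{:}A$ for an atom $A$. - Cotuple: from $f_i$ deriving $\Gamma,\alpha{:}X_i\vdash\Delta$ ($i\in I$), $\alpha\{a_i\mapsto f_i\}_{i\in I}$ derives $\Gamma,\alpha{:}\sum_i a_i{:}X_i\vdash\Delta$. - Tuple: from $f_i$ deriving $\Gamma\vdash\alpha{:}X_i,\Delta$ ($i\in I$), $\alpha(a_i\mapsto f_i)_{i\in I}$ derives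 $\Gamma\vdash\alpha{:}\prod_i a_i{:}X_i,\Delta$. - Projection: from $f$ deriving $\Gamma,\alpha{:}X_k\vdash\Delta$, $\overleftarrow{\alpha}[a_k](f)$ derives $\Gamma,\alpha{:}\prod_i a_i{:}X_i\vdash\Delta$. - Injection: from $f$ deriving $\Gamma\vdash\alpha{:}X_k,\Delta$, $\overrightarrow{\alpha}[a_k](f)$ derives $\Gamma\vdash\alpha{:}\sum_i a_i{:}X_i,\Delta$. - Cut: from $f$ deriving $\Gamma\vdash\Delta,\gamma{:}Z$ and $g$ deriving $\gamma{:}Z,\Gamma'\vdash\Delta'$ ($\gamma$ the only common channel name), $f;_\gamma g$ derives $\Gamma,\Gamma'\vdash\Delta,\Delta'$. Nullary cotuples and tuples (empty $I$) are typed by their full sequent. All steps below may be applied to subterms and preserve the sequent. The cut-elimination rewrites $\Rightarrow$ are the following (different Greek letters denote distinct channels; the first two, involving an identity $1$, are up to renaming of the channel): - $f;_\gamma 1\Rightarrow f$; and $1;_\gamma f\Rightarrow f$; - $\alpha\{a_i\mapsto f_i\}_i;_\gamma g\Rightarrow\alpha\{a_i\mapsto f_i;_\gamma g\}_i$; and $f;_\gamma\beta(b_i\mapsto g_i)_i\Rightarrow\beta(b_i\mapsto f;_\gamma g_i)_i$; - $\overrightarrow{\alpha}[a_k](f);_\gamma g\Rightarrow\overrightarrow{\alpha}[a_k](f;_\gamma g)$; and $f;_\gamma\overleftarrow{\beta}[b_k](g)\Rightarrow\overleftarrow{\beta}[b_k](f;_\gamma g)$; - $\overleftarrow{\alpha}[a_k](f);_\gamma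 g\Rightarrow\overleftarrow{\alpha}[a_k](f;_\gamma g)$; and $f;_\gamma\overrightarrow{\beta}[b_k](g)\Rightarrow\overrightarrow{\beta}[b_k](f;_\gamma g)$; - $\alpha(a_i\mapsto f_i)_i;_\gamma g\Rightarrow\alpha(a_i\mapsto f_i;_\gamma g)_i$; and $f;_\gamma\beta\{b_i\mapsto g_i\}_i\Rightarrow\beta\{b_i\mapsto f;_\gamma g_i\}_i$; - $\overrightarrow{\gamma}[a_k](f);_\gamma\gamma\{a_i\mapsto g_i\}_i\Rightarrow f;_\gamma g_k$; and $\gamma(a_i\mapsto f_i)_i;_\gamma\overleftarrow{\gamma}[a_k](g)\Rightarrow f_k;_\gamma g$. The permuting conversions $\leftrightarrow$ are the following equations (two-way, $\alpha\neq\beta$; index sets of cotuples/tuples may be empty): - $\alpha\{a_i\mapsto\beta\{b_j\mapsto f_{ij}\}_j\}_i\leftrightarrow\beta\{b_j\mapsto\alpha\{a_i\mapsto f_{ij}\}_i\}_j$; - $\alpha(a_i\mapsto\beta(b_j\mapsto f_{ij})_j)_i\leftrightarrow\beta(b_j\mapsto\alpha(a_i\mapsto f_{ij})_i)_j$; - $\alpha\{a_i\mapsto\overrightarrow{\beta}[b_k](f_i)\}_i\leftrightarrow\overrightarrow{\beta}[b_k](\alpha\{a_i\mapsto f_i\}_i)$; - $\overleftarrow{\alpha}[a_k](\beta(b_i\mapsto g_i)_i)\leftrightarrow\beta(b_i\mapsto\overleftarrow{\alpha}[a_k](g_i))_i$; - $\alpha\{a_i\mapsto\overleftarrow{\beta}[b_k](f_i)\}_i\leftrightarrow\overleftarrow{\beta}[b_k](\alpha\{a_i\mapsto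 f_i\}_i)$; - $\overrightarrow{\alpha}[a_k](\beta(b_i\mapsto g_i)_i)\leftrightarrow\beta(b_i\mapsto\overrightarrow{\alpha}[a_k](g_i))_i$; - $\alpha\{a_i\mapsto\beta(b_j\mapsto f_{ij})_j\}_i\leftrightarrow\beta(b_j\mapsto\alpha\{a_i\mapsto f_{ij}\}_i)_j$; - $\overrightarrow{\alpha}[a_k](\overrightarrow{\beta}[b_l](f))\leftrightarrow\overrightarrow{\beta}[b_l](\overrightarrow{\alpha}[a_k](f))$; - $\overleftarrow{\alpha}[a_k](\overleftarrow{\beta}[b_l](f))\leftrightarrow\overleftarrow{\beta}[b_l](\overleftarrow{\alpha}[a_k](f))$; - $\overrightarrow{\alpha}[a_k](\overleftarrow{\beta}[b_l](f))\leftrightarrow\overleftarrow{\beta}[b_l](\overrightarrow{\alpha}[a_k](f))$. *)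

theory Defs
  imports "HOL-Library.Finite_Map" "HOL-Combinatorics.Transposition"
begin

type_synonym channel = nat

text \<open>A finite family labelled by channels (or by component names) is a finite map; this makes
  the labels of a family distinct and the family unordered. \<open>family I f\<close> is
  \<open>(f i)\<close> for \<open>i \<in> I\<close>, and \<open>relabel \<pi> \<Gamma>\<close> renames the label \<open>c\<close> to \<open>\<pi> c\<close>.\<close>

context
  includes fset.lifting and fmap.lifting
begin

lift_definition family :: "'i fset \<Rightarrow> ('i \<Rightarrow> 'x) \<Rightarrow> ('i, 'x) fmap"
  is "\<lambda>I f i. if i \<in> I then Some (f i) else None"
  by (simp add: dom_def)

end

definition relabel :: "(channel \<Rightarrow> channel) \<Rightarrow> (channel, 'x) fmap \<Rightarrow> (channel, 'x) fmap" where
  "relabel \<pi> \<Gamma> = family (\<pi> |`| fmdom \<Gamma>) (\<lambda>c. the (fmlookup \<Gamma> (inv \<pi> c)))"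


section \<open>Symmetric polycategories\<close>

text \<open>Symmetric polycategories are presented in coordinate-free form: the inputs and outputs of a
  polymorphism are finite families of objects labelled by channels, all channels of a polymorphism
  being distinct. The action of the symmetric groups becomes the relabelling
  action \<open>ren\<close> of bijections of channels, and \<open>pcut A \<gamma> f g\<close> plugs the output \<open>\<gamma>\<close> of \<open>f\<close> into
  the input \<open>\<gamma>\<close> of \<open>g\<close>.\<close>

record ('o, 'm) polycat =
  obj :: "'o set"
  poly :: "'m set"
  src :: "'m \<Rightarrow> (channel, 'o) fmap"
  tgt :: "'m \<Rightarrow> (channel, 'o) fmap"
  idn :: "channel \<Rightarrow> channel \<Rightarrow> 'o \<Rightarrow> 'm"
  pcut :: "channel \<Rightarrow> 'm \<Rightarrow> 'm \<Rightarrow> 'm"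
  ren :: "(channel \<Rightarrow> channel) \<Rightarrow> 'm \<Rightarrow> 'm"

definition pchans :: "('o, 'm) polycat \<Rightarrow> 'm \<Rightarrow> channel fset" where
  "pchans A f = fmdom (src A f) |\<union>| fmdom (tgt A f)"

definition composable :: "('o, 'm) polycat \<Rightarrow> channel \<Rightarrow> 'm \<Rightarrow> 'm \<Rightarrow> bool" where
  "composable A \<gamma> f g \<longleftrightarrow> f \<in> poly A \<and> g \<in> poly A \<and> pchans A f |\<inter>| pchans A g = {|\<gamma>|} \<and>
     (\<exists>a. fmlookup (tgt A f) \<gamma> = Some a \<and> fmlookup (src A g) \<gamma> = Some a)"

locale symmetric_polycategory =
  fixes A :: "('o, 'm) polycat"
  assumes poly_sequent:
      "f \<in> poly A \<Longrightarrow> fmdom (src A f) |\<inter>| fmdom (tgt A f) = {||} \<and>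
         fmran' (src A f) \<union> fmran' (tgt A f) \<subseteq> obj A"
    and ren_poly:
      "\<lbrakk>f \<in> poly A; bij \<pi>\<rbrakk> \<Longrightarrow> ren A \<pi> f \<in> poly A \<and>
         src A (ren A \<pi> f) = relabel \<pi> (src A f) \<and> tgt A (ren A \<pi> f) = relabel \<pi> (tgt A f)"
    and ren_id: "f \<in> poly A \<Longrightarrow> ren A id f = f"
    and ren_comp:
      "\<lbrakk>f \<in> poly A; bij \<pi>; bij \<rho>\<rbrakk> \<Longrightarrow> ren A (\<pi> \<circ> \<rho>) f = ren A \<pi> (ren A \<rho> f)"
    and ren_cong:
      "\<lbrakk>f \<in> poly A; bij \<pi>; bij \<rho>; \<And>c. c |\<in>| pchans A f \<Longrightarrow> \<pi> c = \<rho> c\<rbrakk> \<Longrightarrow> ren A \<pi> f = ren A \<rho> f"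
    and idn_poly:
      "\<lbrakk>a \<in> obj A; \<alpha> \<noteq> \<beta>\<rbrakk> \<Longrightarrow> idn A \<alpha> \<beta> a \<in> poly A \<and>
         src A (idn A \<alpha> \<beta> a) = fmupd \<alpha> a fmempty \<and> tgt A (idn A \<alpha> \<beta> a) = fmupd \<beta> a fmempty"
    and ren_idn:
      "\<lbrakk>a \<in> obj A; \<alpha> \<noteq> \<beta>; bij \<pi>\<rbrakk> \<Longrightarrow> ren A \<pi> (idn A \<alpha> \<beta> a) = idn A (\<pi> \<alpha>) (\<pi> \<beta>) a"
    and pcut_poly:
      "composable A \<gamma> f g \<Longrightarrow> pcut A \<gamma> f g \<in> poly A \<and>
         src A (pcut A \<gamma> f g) = src A f ++\<^sub>f fmdrop \<gamma> (src A g) \<and>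
         tgt A (pcut A \<gamma> f g) = fmdrop \<gamma> (tgt A f) ++\<^sub>f tgt A g"
    and ren_pcut:
      "\<lbrakk>composable A \<gamma> f g; bij \<pi>\<rbrakk> \<Longrightarrow>
         ren A \<pi> (pcut A \<gamma> f g) = pcut A (\<pi> \<gamma>) (ren A \<pi> f) (ren A \<pi> g)"
    and pcut_idn_right:
      "\<lbrakk>a \<in> obj A; \<gamma> \<noteq> \<beta>; composable A \<gamma> f (idn A \<gamma> \<beta> a)\<rbrakk> \<Longrightarrow>
         pcut A \<gamma> f (idn A \<gamma> \<beta> a) = ren A (transpose \<gamma> \<beta>) f"
    and pcut_idn_left:
      "\<lbrakk>a \<in> obj A; \<alpha> \<noteq> \<gamma>; composable A \<gamma> (idn A \<alpha> \<gamma> a) g\<rbrakk> \<Longrightarrow>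
         pcut A \<gamma> (idn A \<alpha> \<gamma> a) g = ren A (transpose \<gamma> \<alpha>) g"
    and pcut_assoc:
      "\<lbrakk>composable A \<gamma> f g; composable A \<delta> g h; pchans A f |\<inter>| pchans A h = {||}\<rbrakk> \<Longrightarrow>
         pcut A \<delta> (pcut A \<gamma> f g) h = pcut A \<gamma> f (pcut A \<delta> g h)"
    and pcut_exchange_outputs:
      "\<lbrakk>composable A \<gamma> f g; composable A \<delta> f h; pchans A g |\<inter>| pchans A h = {||}\<rbrakk> \<Longrightarrow>
         pcut A \<delta> (pcut A \<gamma> f g) h = pcut A \<gamma> (pcut A \<delta> f h) g"
    and pcut_exchange_inputs:
      "\<lbrakk>composable A \<gamma> f h; composable A \<delta> g h; pchans A f |\<inter>| pchans A g = {||}\<rbrakk> \<Longrightarrow>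
         pcut A \<gamma> f (pcut A \<delta> g h) = pcut A \<delta> g (pcut A \<gamma> f h)"


section \<open>Formulas, terms and derivability\<close>

text \<open>The index set of a sum or product is the domain of the finite map, that is, the set of its
  component names.\<close>

datatype (objects: 'o, 'n) form =
    Atom 'o
  | Sum "('n, ('o, 'n) form) fmap"
  | Prod "('n, ('o, 'n) form) fmap"

type_synonym ('o, 'n) cxt = "(channel, ('o, 'n) form) fmap"

text \<open>Terms stand for derivations, so they carry enough type information to determine their
  sequent: in \<open>Cotuple \<alpha> \<Gamma> \<Delta> F\<close> and \<open>Tuple \<alpha> \<Gamma> \<Delta> F\<close> the families \<open>\<Gamma>\<close> and \<open>\<Delta>\<close> are the side
  formulas of the conclusion (this information is redundant unless \<open>F\<close> is empty), and in \<open>Proj \<alpha> X k t\<close>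
  and \<open>Inj \<alpha> X k t\<close> the family \<open>X\<close> consists of the components of the product or sum at \<open>\<alpha>\<close>.\<close>

datatype ('o, 'm, 'n) trm =
    Ax 'm
  | Cotuple channel "('o, 'n) cxt" "('o, 'n) cxt" "('n, ('o, 'm, 'n) trm) fmap"
  | Tuple channel "('o, 'n) cxt" "('o, 'n) cxt" "('n, ('o, 'm, 'n) trm) fmap"
  | Proj channel "('n, ('o, 'n) form) fmap" 'n "('o, 'm, 'n) trm"
  | Inj channel "('n, ('o, 'n) form) fmap" 'n "('o, 'm, 'n) trm"
  | Cut channel "('o, 'm, 'n) trm" "('o, 'm, 'n) trm"

definition sequent :: "('o, 'm) polycat \<Rightarrow> ('o, 'n) cxt \<Rightarrow> ('o, 'n) cxt \<Rightarrow> bool" where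
  "sequent A \<Gamma> \<Delta> \<longleftrightarrow> fmdom \<Gamma> |\<inter>| fmdom \<Delta> = {||} \<and>
     (\<forall>X \<in> fmran' \<Gamma> \<union> fmran' \<Delta>. objects X \<subseteq> obj A)"

inductive derives ::
    "('o, 'm) polycat \<Rightarrow> ('o, 'm, 'n) trm \<Rightarrow> ('o, 'n) cxt \<Rightarrow> ('o, 'n) cxt \<Rightarrow> bool"
  for A where
  ax: "f \<in> poly A \<Longrightarrow> derives A (Ax f) (fmmap Atom (src A f)) (fmmap Atom (tgt A f))"
| cotuple:
    "\<lbrakk>\<alpha> |\<notin>| fmdom \<Gamma>; sequent A (fmupd \<alpha> (Sum X) \<Gamma>) \<Delta>; fmdom F = fmdom X;
      \<forall>i t Z. fmlookup F i = Some t \<longrightarrow> fmlookup X i = Some Z \<longrightarrow> derives A t (fmupd \<alpha> Z \<Gamma>) \<Delta>\<rbrakk>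
     \<Longrightarrow> derives A (Cotuple \<alpha> \<Gamma> \<Delta> F) (fmupd \<alpha> (Sum X) \<Gamma>) \<Delta>"
| tuple:
    "\<lbrakk>\<alpha> |\<notin>| fmdom \<Delta>; sequent A \<Gamma> (fmupd \<alpha> (Prod X) \<Delta>); fmdom F = fmdom X;
      \<forall>i t Z. fmlookup F i = Some t \<longrightarrow> fmlookup X i = Some Z \<longrightarrow> derives A t \<Gamma> (fmupd \<alpha> Z \<Delta>)\<rbrakk>
     \<Longrightarrow> derives A (Tuple \<alpha> \<Gamma> \<Delta> F) \<Gamma> (fmupd \<alpha> (Prod X) \<Delta>)"
| proj:
    "\<lbrakk>\<alpha> |\<notin>| fmdom \<Gamma>; sequent A (fmupd \<alpha> (Prod X) \<Gamma>) \<Delta>; fmlookup X k = Some Z;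
      derives A t (fmupd \<alpha> Z \<Gamma>) \<Delta>\<rbrakk>
     \<Longrightarrow> derives A (Proj \<alpha> X k t) (fmupd \<alpha> (Prod X) \<Gamma>) \<Delta>"
| inj:
    "\<lbrakk>\<alpha> |\<notin>| fmdom \<Delta>; sequent A \<Gamma> (fmupd \<alpha> (Sum X) \<Delta>); fmlookup X k = Some Z;
      derives A t \<Gamma> (fmupd \<alpha> Z \<Delta>)\<rbrakk>
     \<Longrightarrow> derives A (Inj \<alpha> X k t) \<Gamma> (fmupd \<alpha> (Sum X) \<Delta>)"
| cut:
    "\<lbrakk>derives A t \<Gamma> (fmupd \<gamma> Z \<Delta>); derives A u (fmupd \<gamma> Z \<Gamma>') \<Delta>';
      \<gamma> |\<notin>| fmdom \<Gamma> |\<union>| fmdom \<Delta> |\<union>| fmdom \<Gamma>' |\<union>| fmdom \<Delta>';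
      (fmdom \<Gamma> |\<union>| fmdom \<Delta>) |\<inter>| (fmdom \<Gamma>' |\<union>| fmdom \<Delta>') = {||}\<rbrakk>
     \<Longrightarrow> derives A (Cut \<gamma> t u) (\<Gamma> ++\<^sub>f \<Gamma>') (\<Delta> ++\<^sub>f \<Delta>')"

definition derivations :: "('o, 'm) polycat \<Rightarrow> ('o, 'm, 'n) trm set" where
  "derivations A = {t. \<exists>\<Gamma> \<Delta>. derives A t \<Gamma> \<Delta>}"

primrec ren_trm ::
    "('o, 'm) polycat \<Rightarrow> (channel \<Rightarrow> channel) \<Rightarrow> ('o, 'm, 'n) trm \<Rightarrow> ('o, 'm, 'n) trm" where
  "ren_trm A \<pi> (Ax f) = Ax (ren A \<pi> f)"
| "ren_trm A \<pi> (Cotuple \<alpha> \<Gamma> \<Delta> F) =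
     Cotuple (\<pi> \<alpha>) (relabel \<pi> \<Gamma>) (relabel \<pi> \<Delta>) (fmmap (ren_trm A \<pi>) F)"
| "ren_trm A \<pi> (Tuple \<alpha> \<Gamma> \<Delta> F) =
     Tuple (\<pi> \<alpha>) (relabel \<pi> \<Gamma>) (relabel \<pi> \<Delta>) (fmmap (ren_trm A \<pi>) F)"
| "ren_trm A \<pi> (Proj \<alpha> X k t) = Proj (\<pi> \<alpha>) X k (ren_trm A \<pi> t)"
| "ren_trm A \<pi> (Inj \<alpha> X k t) = Inj (\<pi> \<alpha>) X k (ren_trm A \<pi> t)"
| "ren_trm A \<pi> (Cut \<gamma> t u) = Cut (\<pi> \<gamma>) (ren_trm A \<pi> t) (ren_trm A \<pi> u)"


section \<open>Rules at the root of a term\<close>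

text \<open>The side formulas recorded in a newly created cotuple or tuple are left open (primed) in the
  rules below. Steps are only taken between terms deriving the same sequent, which determines them.

  Renaming the output \<open>\<gamma>\<close> of \<open>f\<close> to \<open>\<beta>\<close> by a transposition avoids capture, as \<open>\<beta>\<close> is not a
  channel of the sequent of \<open>f\<close>; it may rename bound channels, but terms are taken up to
  renaming of these below.\<close>

inductive cut_rule :: "('o, 'm) polycat \<Rightarrow> ('o, 'm, 'n) trm \<Rightarrow> ('o, 'm, 'n) trm \<Rightarrow> bool"
  for A where
  id_right:
    "\<lbrakk>a \<in> obj A; \<gamma> \<noteq> \<beta>\<rbrakk> \<Longrightarrow>
     cut_rule A (Cut \<gamma> f (Ax (idn A \<gamma> \<beta> a))) (ren_trm A (transpose \<gamma> \<beta>) f)"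
| id_left:
    "\<lbrakk>a \<in> obj A; \<alpha> \<noteq> \<gamma>\<rbrakk> \<Longrightarrow>
     cut_rule A (Cut \<gamma> (Ax (idn A \<alpha> \<gamma> a)) f) (ren_trm A (transpose \<gamma> \<alpha>) f)"
| cotuple_cut:
    "\<alpha> \<noteq> \<gamma> \<Longrightarrow>
     cut_rule A (Cut \<gamma> (Cotuple \<alpha> \<Gamma> \<Delta> (family I f)) g)
                (Cotuple \<alpha> \<Gamma>' \<Delta>' (family I (\<lambda>i. Cut \<gamma> (f i) g)))"
| cut_tuple:
    "\<beta> \<noteq> \<gamma> \<Longrightarrow>
     cut_rule A (Cut \<gamma> f (Tuple \<beta> \<Gamma> \<Delta> (family I g)))
                (Tuple \<beta> \<Gamma>' \<Delta>' (family I (\<lambda>i. Cut \<gamma> f (g i))))"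
| inj_cut:
    "\<alpha> \<noteq> \<gamma> \<Longrightarrow> cut_rule A (Cut \<gamma> (Inj \<alpha> X k f) g) (Inj \<alpha> X k (Cut \<gamma> f g))"
| cut_proj:
    "\<beta> \<noteq> \<gamma> \<Longrightarrow> cut_rule A (Cut \<gamma> f (Proj \<beta> X k g)) (Proj \<beta> X k (Cut \<gamma> f g))"
| proj_cut:
    "\<alpha> \<noteq> \<gamma> \<Longrightarrow> cut_rule A (Cut \<gamma> (Proj \<alpha> X k f) g) (Proj \<alpha> X k (Cut \<gamma> f g))"
| cut_inj:
    "\<beta> \<noteq> \<gamma> \<Longrightarrow> cut_rule A (Cut \<gamma> f (Inj \<beta> X k g)) (Inj \<beta> X k (Cut \<gamma> f g))"
| tuple_cut:
    "\<alpha> \<noteq> \<gamma> \<Longrightarrow>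
     cut_rule A (Cut \<gamma> (Tuple \<alpha> \<Gamma> \<Delta> (family I f)) g)
                (Tuple \<alpha> \<Gamma>' \<Delta>' (family I (\<lambda>i. Cut \<gamma> (f i) g)))"
| cut_cotuple:
    "\<beta> \<noteq> \<gamma> \<Longrightarrow>
     cut_rule A (Cut \<gamma> f (Cotuple \<beta> \<Gamma> \<Delta> (family I g)))
                (Cotuple \<beta> \<Gamma>' \<Delta>' (family I (\<lambda>i. Cut \<gamma> f (g i))))"
| inj_cotuple:
    "k |\<in>| I \<Longrightarrow>
     cut_rule A (Cut \<gamma> (Inj \<gamma> X k f) (Cotuple \<gamma> \<Gamma> \<Delta> (family I g))) (Cut \<gamma> f (g k))"
| tuple_proj:
    "k |\<in>| I \<Longrightarrow>
     cut_rule A (Cut \<gamma> (Tuple \<gamma> \<Gamma> \<Delta> (family I f)) (Proj \<gamma> X k g)) (Cut \<gamma> (f k) g)"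

inductive conv_rule :: "('o, 'm, 'n) trm \<Rightarrow> ('o, 'm, 'n) trm \<Rightarrow> bool" where
  cotuple_cotuple:
    "\<alpha> \<noteq> \<beta> \<Longrightarrow>
     conv_rule (Cotuple \<alpha> \<Gamma> \<Delta> (family I (\<lambda>i. Cotuple \<beta> (\<Gamma>1 i) (\<Delta>1 i) (family J (f i)))))
               (Cotuple \<beta> \<Gamma>' \<Delta>' (family J (\<lambda>j. Cotuple \<alpha> (\<Gamma>2 j) (\<Delta>2 j) (family I (\<lambda>i. f i j)))))"
| tuple_tuple:
    "\<alpha> \<noteq> \<beta> \<Longrightarrow>
     conv_rule (Tuple \<alpha> \<Gamma> \<Delta> (family I (\<lambda>i. Tuple \<beta> (\<Gamma>1 i) (\<Delta>1 i) (family J (f i)))))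
               (Tuple \<beta> \<Gamma>' \<Delta>' (family J (\<lambda>j. Tuple \<alpha> (\<Gamma>2 j) (\<Delta>2 j) (family I (\<lambda>i. f i j)))))"
| cotuple_inj:
    "\<alpha> \<noteq> \<beta> \<Longrightarrow>
     conv_rule (Cotuple \<alpha> \<Gamma> \<Delta> (family I (\<lambda>i. Inj \<beta> X k (f i))))
               (Inj \<beta> X k (Cotuple \<alpha> \<Gamma>' \<Delta>' (family I f)))"
| proj_tuple:
    "\<alpha> \<noteq> \<beta> \<Longrightarrow>
     conv_rule (Proj \<alpha> X k (Tuple \<beta> \<Gamma> \<Delta> (family I g)))
               (Tuple \<beta> \<Gamma>' \<Delta>' (family I (\<lambda>i. Proj \<alpha> X k (g i))))"
| cotuple_proj:
    "\<alpha> \<noteq> \<beta> \<Longrightarrow>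
     conv_rule (Cotuple \<alpha> \<Gamma> \<Delta> (family I (\<lambda>i. Proj \<beta> X k (f i))))
               (Proj \<beta> X k (Cotuple \<alpha> \<Gamma>' \<Delta>' (family I f)))"
| inj_tuple:
    "\<alpha> \<noteq> \<beta> \<Longrightarrow>
     conv_rule (Inj \<alpha> X k (Tuple \<beta> \<Gamma> \<Delta> (family I g)))
               (Tuple \<beta> \<Gamma>' \<Delta>' (family I (\<lambda>i. Inj \<alpha> X k (g i))))"
| cotuple_tuple:
    "\<alpha> \<noteq> \<beta> \<Longrightarrow>
     conv_rule (Cotuple \<alpha> \<Gamma> \<Delta> (family I (\<lambda>i. Tuple \<beta> (\<Gamma>1 i) (\<Delta>1 i) (family J (f i)))))
               (Tuple \<beta> \<Gamma>' \<Delta>' (family J (\<lambda>j. Cotuple \<alpha> (\<Gamma>2 j) (\<Delta>2 j) (family I (\<lambda>i. f i j)))))"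
| inj_inj:
    "\<alpha> \<noteq> \<beta> \<Longrightarrow> conv_rule (Inj \<alpha> X k (Inj \<beta> Y l f)) (Inj \<beta> Y l (Inj \<alpha> X k f))"
| proj_proj:
    "\<alpha> \<noteq> \<beta> \<Longrightarrow> conv_rule (Proj \<alpha> X k (Proj \<beta> Y l f)) (Proj \<beta> Y l (Proj \<alpha> X k f))"
| inj_proj:
    "\<alpha> \<noteq> \<beta> \<Longrightarrow> conv_rule (Inj \<alpha> X k (Proj \<beta> Y l f)) (Proj \<beta> Y l (Inj \<alpha> X k f))"

text \<open>Renaming of the channel bound by a cut; \<open>\<delta>\<close> must not occur in the sequents of the two
  subterms.\<close>

inductive alpha_rule :: "('o, 'm) polycat \<Rightarrow> ('o, 'm, 'n) trm \<Rightarrow> ('o, 'm, 'n) trm \<Rightarrow> bool"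
  for A where
  "\<lbrakk>derives A t \<Gamma> \<Delta>; derives A u \<Gamma>' \<Delta>';
    \<delta> |\<notin>| fmdom \<Gamma> |\<union>| fmdom \<Delta> |\<union>| fmdom \<Gamma>' |\<union>| fmdom \<Delta>'\<rbrakk>
   \<Longrightarrow> alpha_rule A (Cut \<gamma> t u)
         (Cut \<delta> (ren_trm A (transpose \<gamma> \<delta>) t) (ren_trm A (transpose \<gamma> \<delta>) u))"


section \<open>Steps between terms up to renaming of bound channels\<close>

inductive in_context ::
    "(('o, 'm, 'n) trm \<Rightarrow> ('o, 'm, 'n) trm \<Rightarrow> bool) \<Rightarrow> ('o, 'm, 'n) trm \<Rightarrow> ('o, 'm, 'n) trm \<Rightarrow> bool"
  for R where
  root: "R t s \<Longrightarrow> in_context R t s"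
| in_cotuple:
    "\<lbrakk>fmlookup F i = Some t; in_context R t s\<rbrakk> \<Longrightarrow>
     in_context R (Cotuple \<alpha> \<Gamma> \<Delta> F) (Cotuple \<alpha> \<Gamma> \<Delta> (fmupd i s F))"
| in_tuple:
    "\<lbrakk>fmlookup F i = Some t; in_context R t s\<rbrakk> \<Longrightarrow>
     in_context R (Tuple \<alpha> \<Gamma> \<Delta> F) (Tuple \<alpha> \<Gamma> \<Delta> (fmupd i s F))"
| in_proj: "in_context R t s \<Longrightarrow> in_context R (Proj \<alpha> X k t) (Proj \<alpha> X k s)"
| in_inj: "in_context R t s \<Longrightarrow> in_context R (Inj \<alpha> X k t) (Inj \<alpha> X k s)"
| in_cut_left: "in_context R t s \<Longrightarrow> in_context R (Cut \<gamma> t u) (Cut \<gamma> s u)"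
| in_cut_right: "in_context R t s \<Longrightarrow> in_context R (Cut \<gamma> u t) (Cut \<gamma> u s)"

definition steps ::
    "('o, 'm) polycat \<Rightarrow> (('o, 'm, 'n) trm \<Rightarrow> ('o, 'm, 'n) trm \<Rightarrow> bool) \<Rightarrow> ('o, 'm, 'n) trm rel" where
  "steps A R = {(t, s). t \<in> derivations A \<and> s \<in> derivations A \<and>
     in_context (\<lambda>t s. R t s \<and> (\<exists>\<Gamma> \<Delta>. derives A t \<Gamma> \<Delta> \<and> derives A s \<Gamma> \<Delta>)) t s}"

definition alpha_equiv :: "('o, 'm) polycat \<Rightarrow> ('o, 'm, 'n) trm rel" where
  "alpha_equiv A =
     Restr ((steps A (alpha_rule A) \<union> (steps A (alpha_rule A))\<inverse>)\<^sup>*) (derivations A)"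

definition terms :: "('o, 'm) polycat \<Rightarrow> ('o, 'm, 'n) trm set set" where
  "terms A = derivations A // alpha_equiv A"

definition on_terms ::
    "('o, 'm) polycat \<Rightarrow> ('o, 'm, 'n) trm rel \<Rightarrow> ('o, 'm, 'n) trm set rel" where
  "on_terms A R = {(T, S). T \<in> terms A \<and> S \<in> terms A \<and> (\<exists>t \<in> T. \<exists>s \<in> S. (t, s) \<in> R)}"

definition cut_red :: "('o, 'm) polycat \<Rightarrow> ('o, 'm, 'n) trm set rel" where
  "cut_red A = on_terms A (steps A (cut_rule A))"

definition perm_conv :: "('o, 'm) polycat \<Rightarrow> ('o, 'm, 'n) trm set rel" where
  "perm_conv A = on_terms A (steps A (\<lambda>t s. conv_rule t s \<or> conv_rule s t))"

end

(* Every term reduces to a normal form in which the only cuts left are trees of axioms, and this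
  normal form is computed by structural recursion: to cut two normal forms, push the cut into the
  left one as long as its root is not the cut channel, then into the right one, and cancel when
  both roots are the cut channel; on leaves, identities are absorbed. The cut thus defined on normal
  forms is invariant under permuting conversions and renaming of bound channels in both arguments,
  and commutes with every rule in the right argument up to conversion. Hence all cut-elimination
  steps and permuting conversions preserve the normal form up to conversion, so the normal forms of
  two connected terms are reducts of them related by conversions alone. No termination or local
  confluence argument for the rewrites is needed. *)

theory Submission
  imports Defs
begin

section \<open>Sequents as signed contexts\<close>

text \<open>The main obstacle is the nullary cotuple or tuple. An exchange with an empty family
  creates or erases a whole layer: \<open>Node \<alpha>\<close> without children is convertible to a
  \<open>Node \<beta>\<close> all of whose children are \<open>Node \<alpha>\<close> without
  children, for any other \<beta> at which the sequent allows a branching. So conversion does not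
  preserve size, and the term alone does not show which conversions are legal. Hence the relations
  on normal forms are indexed by a sequent and inductions run along typing. Normal forms themselves
  can then drop all type information: cutting them never computes side formulas, which are put back
  only when a term is read off. A second obstacle is bias. Unfolding the left argument first makes
  the cut a function, but an asymmetric one, while the rewrites are symmetric. The bias is repaired
  in one lemma, \<open>cut_nt_node_right\<close>, after which a sign on the cut channel makes the
  arguments interchangeable. Binders occur only in leaves, since the root of a node is a channel of
  its sequent; renaming of bound channels therefore concerns trees of axioms only. These are never
  composed in the polycategory, as no rewrite does so.\<close>

lemma fmlookup_family [simp]: "fmlookup (family I f) i = (if i |\<in>| I then Some (f i) else None)"
  by (simp add: family.rep_eq)

lemma fmdom_family [simp]: "fmdom (family I f) = I"
  by (rule fset_eqI) (simp add: fmlookup_dom_iff)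

lemma fmmap_family [simp]: "fmmap h (family I f) = family I (\<lambda>i. h (f i))"
  by (rule fmap_ext) simp

lemma family_eq_iff: "family I f = family J g \<longleftrightarrow> I = J \<and> (\<forall>i. i |\<in>| I \<longrightarrow> f i = g i)"
proof
  assume eq: "family I f = family J g"
  then have "I = J" by (metis fmdom_family)
  moreover have "f i = g i" if "i |\<in>| I" for i
    using arg_cong [OF eq, of "\<lambda>F. fmlookup F i"] that \<open>I = J\<close> by simp
  ultimately show "I = J \<and> (\<forall>i. i |\<in>| I \<longrightarrow> f i = g i)" by blast
qed (auto intro!: fmap_ext)

lemma family_of_fmap: "F = family (fmdom F) (\<lambda>i. the (fmlookup F i))"
  by (rule fmap_ext) (auto simp: fmlookup_dom_iff)

lemma fmlookup_relabel:
  assumes "bij \<pi>"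
  shows "fmlookup (relabel \<pi> \<Gamma>) c = fmlookup \<Gamma> (inv \<pi> c)"
proof -
  have "c |\<in>| \<pi> |`| fmdom \<Gamma> \<longleftrightarrow> inv \<pi> c |\<in>| fmdom \<Gamma>"
    using assms by (metis bij_inv_eq_iff fimageE fimageI)
  then show ?thesis by (auto simp: relabel_def fmlookup_dom_iff)
qed


text \<open>A sequent is encoded by one map from channels to signed formulas, with sign \<open>True\<close> for outputs.
  Cotuples and tuples on the one hand, projections and injections on the other, become instances of
  a single branching construct.\<close>

type_synonym ('o, 'n) sform = "bool \<times> ('o, 'n) form"
type_synonym ('o, 'n) sctx = "channel \<Rightarrow> ('o, 'n) sform option"

fun comps :: "('o, 'n) form \<Rightarrow> ('n, ('o, 'n) form) fmap" where
  "comps (Atom a) = fmempty"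
| "comps (Sum X) = X"
| "comps (Prod X) = X"

text \<open>Passing to a component keeps the side of the sequent. The value is arbitrary when
  \<open>i\<close> is not a component; premises of rules only use members of a set accepted by
  \<open>branch\<close>, which are components by \<open>branch_subset\<close>.\<close>

definition sub :: "('o, 'n) sform \<Rightarrow> 'n \<Rightarrow> ('o, 'n) sform" where
  "sub v i = (fst v, the (fmlookup (comps (snd v)) i))"

text \<open>A rule at a signed formula has one premise for each member of \<open>I\<close>. Sign and
  connective decide between all components (cotuple, tuple) and one chosen component (projection,
  injection); atoms admit no rule.\<close>

fun branch :: "('o, 'n) sform \<Rightarrow> 'n fset \<Rightarrow> bool" where
  "branch (s, Atom a) I \<longleftrightarrow> False"
| "branch (s, Sum X) I \<longleftrightarrow> (if s then \<exists>k. k |\<in>| fmdom X \<and> I = {|k|} else I = fmdom X)"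
| "branch (s, Prod X) I \<longleftrightarrow> (if s then I = fmdom X else \<exists>k. k |\<in>| fmdom X \<and> I = {|k|})"

lemma branch_cases [consumes 1, case_names cotuple tuple proj inj]:
  assumes "branch v I"
  obtains X where "v = (False, Sum X)" "I = fmdom X"
    | X where "v = (True, Prod X)" "I = fmdom X"
    | X k where "v = (False, Prod X)" "k |\<in>| fmdom X" "I = {|k|}"
    | X k where "v = (True, Sum X)" "k |\<in>| fmdom X" "I = {|k|}"
proof (cases v)
  case (Pair s Z)
  then show thesis using assms that by (cases Z; cases s) auto
qed

lemma branch_subset: "branch v I \<Longrightarrow> i |\<in>| I \<Longrightarrow> i |\<in>| fmdom (comps (snd v))"
  by (cases rule: branch_cases) auto

text \<open>Meaningful only for a finite domain, because of \<open>Abs_fset\<close>; finiteness is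
  part of \<open>ok\<close>.\<close>

definition part :: "bool \<Rightarrow> ('o, 'n) sctx \<Rightarrow> ('o, 'n) cxt" where
  "part s C = family (Abs_fset {c. \<exists>X. C c = Some (s, X)}) (\<lambda>c. snd (the (C c)))"

text \<open>Precedence of the inputs is harmless, since the two sides of a \<open>sequent\<close>
  are disjoint.\<close>

definition ctx :: "('o, 'n) cxt \<Rightarrow> ('o, 'n) cxt \<Rightarrow> ('o, 'n) sctx" where
  "ctx \<Gamma> \<Delta> c = (case fmlookup \<Gamma> c of Some X \<Rightarrow> Some (False, X)
     | None \<Rightarrow> map_option (Pair True) (fmlookup \<Delta> c))"

lemma fmlookup_part:
  assumes "finite (dom C)"
  shows "fmlookup (part s C) c =
    (case C c of None \<Rightarrow> None | Some (s', X) \<Rightarrow> if s' = s then Some X else None)"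
proof -
  have "finite {c. \<exists>X. C c = Some (s, X)}"
    by (rule finite_subset [OF _ assms]) auto
  then show ?thesis
    by (auto simp: part_def Abs_fset_inverse split: option.splits)
qed

lemma ctx_part: "finite (dom C) \<Longrightarrow> ctx (part False C) (part True C) = C"
  by (rule ext) (auto simp: ctx_def fmlookup_part split: option.splits)

lemma dom_ctx: "dom (ctx \<Gamma> \<Delta>) = fset (fmdom \<Gamma> |\<union>| fmdom \<Delta>)"
  by (auto simp: ctx_def dom_def fmlookup_dom_iff split: option.splits)

lemma finite_dom_ctx [simp]: "finite (dom (ctx \<Gamma> \<Delta>))"
  by (simp add: dom_ctx)

lemma part_ctx_False: "part False (ctx \<Gamma> \<Delta>) = \<Gamma>"
  by (rule fmap_ext) (auto simp: fmlookup_part, auto simp: ctx_def split: option.splits)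

lemma fmdom_disjointD: "fmdom \<Gamma> |\<inter>| fmdom \<Delta> = {||} \<Longrightarrow> fmlookup \<Gamma> c = Some X \<Longrightarrow> fmlookup \<Delta> c = None"
  by (metis fempty_iff finterI fmdomI fmdom_notD)

lemma part_ctx_True: "fmdom \<Gamma> |\<inter>| fmdom \<Delta> = {||} \<Longrightarrow> part True (ctx \<Gamma> \<Delta>) = \<Delta>"
  by (rule fmap_ext) (auto simp: fmlookup_part,
      auto simp: ctx_def fmdom_disjointD split: option.splits)

definition ok :: "('o, 'm) polycat \<Rightarrow> ('o, 'n) sctx \<Rightarrow> bool" where
  "ok A C \<longleftrightarrow> finite (dom C) \<and> (\<forall>c s X. C c = Some (s, X) \<longrightarrow> objects X \<subseteq> obj A)"

lemma sequent_iff_ok: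
  "sequent A \<Gamma> \<Delta> \<longleftrightarrow> fmdom \<Gamma> |\<inter>| fmdom \<Delta> = {||} \<and> ok A (ctx \<Gamma> \<Delta>)"
proof (cases "fmdom \<Gamma> |\<inter>| fmdom \<Delta> = {||}")
  case True
  have "(\<forall>X \<in> fmran' \<Gamma> \<union> fmran' \<Delta>. objects X \<subseteq> obj A) \<longleftrightarrow>
    (\<forall>c X. fmlookup \<Gamma> c = Some X \<longrightarrow> objects X \<subseteq> obj A) \<and>
    (\<forall>c X. fmlookup \<Delta> c = Some X \<longrightarrow> objects X \<subseteq> obj A)"
    unfolding Ball_def Un_iff fmlookup_ran'_iff by blast
  also have "\<dots> \<longleftrightarrow> (\<forall>c s X. ctx \<Gamma> \<Delta> c = Some (s, X) \<longrightarrow> objects X \<subseteq> obj A)"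
  proof -
    have "fmlookup \<Gamma> c = Some X \<longleftrightarrow> ctx \<Gamma> \<Delta> c = Some (False, X)" for c X
      by (auto simp: ctx_def split: option.splits)
    moreover have "fmlookup \<Delta> c = Some X \<longleftrightarrow> ctx \<Gamma> \<Delta> c = Some (True, X)" for c X
      using fmdom_disjointD [OF True, of c] by (auto simp: ctx_def split: option.splits)
    ultimately show ?thesis by (metis (full_types))
  qed
  finally show ?thesis using True by (simp add: sequent_def ok_def)
qed (simp add: sequent_def)

text \<open>The parameter \<open>s\<close> is the sign of \<gamma> in the first context. Cuts in
  terms have \<open>s = True\<close>; the mirrored sign serves to swap the two halves of a
  cut.\<close>

definition cuttable :: "bool \<Rightarrow> channel \<Rightarrow> ('o, 'n) sctx \<Rightarrow> ('o, 'n) sctx \<Rightarrow> bool" where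
  "cuttable s \<gamma> C D \<longleftrightarrow> (\<exists>Z. C \<gamma> = Some (s, Z) \<and> D \<gamma> = Some (\<not> s, Z)) \<and> dom C \<inter> dom D = {\<gamma>}"

definition join :: "channel \<Rightarrow> ('o, 'n) sctx \<Rightarrow> ('o, 'n) sctx \<Rightarrow> ('o, 'n) sctx" where
  "join \<gamma> C D = (C ++ D)(\<gamma> := None)"

lemma join_commute: "dom C \<inter> dom D = {\<gamma>} \<Longrightarrow> join \<gamma> C D = join \<gamma> D C"
  by (rule ext) (auto simp: join_def map_add_def split: option.splits)

lemma cuttable_commute: "cuttable s \<gamma> C D \<Longrightarrow> cuttable (\<not> s) \<gamma> D C"
  by (auto simp: cuttable_def)

lemma cuttable_join_commute: "cuttable s \<gamma> C D \<Longrightarrow> join \<gamma> C D = join \<gamma> D C"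
  by (auto simp: cuttable_def intro: join_commute)

lemma cuttable_notin: "cuttable s \<gamma> C D \<Longrightarrow> C \<alpha> = Some v \<Longrightarrow> \<alpha> \<noteq> \<gamma> \<Longrightarrow> D \<alpha> = None"
  by (auto simp: cuttable_def)

lemma cuttable_upd: "cuttable s \<gamma> C D \<Longrightarrow> C \<alpha> = Some v \<Longrightarrow> \<alpha> \<noteq> \<gamma> \<Longrightarrow> cuttable s \<gamma> (C(\<alpha> \<mapsto> w)) D"
  by (auto simp: cuttable_def)

lemma cuttable_upd_right: "cuttable s \<gamma> C D \<Longrightarrow> D \<alpha> = Some v \<Longrightarrow> \<alpha> \<noteq> \<gamma> \<Longrightarrow> cuttable s \<gamma> C (D(\<alpha> \<mapsto> w))"
  by (auto simp: cuttable_def)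

lemma cuttable_sub: "cuttable s \<gamma> C D \<Longrightarrow> C \<gamma> = Some v \<Longrightarrow> D \<gamma> = Some w \<Longrightarrow>
    cuttable s \<gamma> (C(\<gamma> \<mapsto> sub v i)) (D(\<gamma> \<mapsto> sub w i))"
  by (auto simp: cuttable_def sub_def)

lemma join_upd:
  "cuttable s \<gamma> C D \<Longrightarrow> C \<alpha> = Some v \<Longrightarrow> \<alpha> \<noteq> \<gamma> \<Longrightarrow> join \<gamma> (C(\<alpha> \<mapsto> w)) D = (join \<gamma> C D)(\<alpha> \<mapsto> w)"
  using cuttable_notin [of s \<gamma> C D \<alpha> v]
  by (auto simp: join_def fun_eq_iff map_add_def split: option.splits)

lemma join_upd_right:
  "cuttable s \<gamma> C D \<Longrightarrow> D \<alpha> = Some v \<Longrightarrow> \<alpha> \<noteq> \<gamma> \<Longrightarrow> join \<gamma> C (D(\<alpha> \<mapsto> w)) = (join \<gamma> C D)(\<alpha> \<mapsto> w)"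
  by (auto simp: join_def fun_eq_iff map_add_def split: option.splits)

lemma join_sub: "join \<gamma> (C(\<gamma> \<mapsto> v)) (D(\<gamma> \<mapsto> w)) = join \<gamma> C D"
  by (auto simp: join_def fun_eq_iff map_add_def split: option.splits)

lemma join_left: "cuttable s \<gamma> C D \<Longrightarrow> C \<alpha> = Some v \<Longrightarrow> \<alpha> \<noteq> \<gamma> \<Longrightarrow> join \<gamma> C D \<alpha> = Some v"
  using cuttable_notin [of s \<gamma> C D \<alpha> v] by (auto simp: join_def map_add_def split: option.splits)

lemma join_right: "D \<alpha> = Some v \<Longrightarrow> \<alpha> \<noteq> \<gamma> \<Longrightarrow> join \<gamma> C D \<alpha> = Some v"
  by (auto simp: join_def map_add_def split: option.splits)

lemma dom_join: "dom (join \<gamma> C D) = (dom C \<union> dom D) - {\<gamma>}"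
  by (auto simp: join_def)

lemma ok_join: "ok A C \<Longrightarrow> ok A D \<Longrightarrow> ok A (join \<gamma> C D)"
  unfolding ok_def dom_join
  by (auto simp: join_def map_add_Some_iff split: if_splits)

text \<open>The sequent determines the constructor and its type annotations. For a projection or
  injection the family has a single member, whose key is the selected component
  \<open>k\<close>.\<close>

definition mk_node :: "('o, 'n) sctx \<Rightarrow> channel \<Rightarrow> ('n, ('o, 'm, 'n) trm) fmap \<Rightarrow> ('o, 'm, 'n) trm" where
  "mk_node C \<alpha> F = (let C' = C(\<alpha> := None); X = comps (snd (the (C \<alpha>))); k = (THE k. k |\<in>| fmdom F) in
     case the (C \<alpha>) of
       (s, Sum _) \<Rightarrow> if s then Inj \<alpha> X k (the (fmlookup F k)) else Cotuple \<alpha> (part False C') (part True C') F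
     | (s, _) \<Rightarrow> if s then Tuple \<alpha> (part False C') (part True C') F else Proj \<alpha> X k (the (fmlookup F k)))"

lemma mk_node_simps:
  "C \<alpha> = Some (False, Sum X) \<Longrightarrow>
    mk_node C \<alpha> F = Cotuple \<alpha> (part False (C(\<alpha> := None))) (part True (C(\<alpha> := None))) F"
  "C \<alpha> = Some (True, Prod X) \<Longrightarrow>
    mk_node C \<alpha> F = Tuple \<alpha> (part False (C(\<alpha> := None))) (part True (C(\<alpha> := None))) F"
  "C \<alpha> = Some (False, Prod X) \<Longrightarrow> mk_node C \<alpha> (family {|k|} f) = Proj \<alpha> X k (f k)"
  "C \<alpha> = Some (True, Sum X) \<Longrightarrow> mk_node C \<alpha> (family {|k|} f) = Inj \<alpha> X k (f k)"
  by (auto simp: mk_node_def Let_def)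

section \<open>Derivability over signed contexts\<close>

definition actx :: "('o, 'm) polycat \<Rightarrow> 'm \<Rightarrow> ('o, 'n) sctx" where
  "actx A f = ctx (fmmap Atom (src A f)) (fmmap Atom (tgt A f))"

text \<open>The same derivations as in \<open>derives\<close>, with the four logical rules merged so
  that an induction has three cases. The two systems are translated into each other by
  \<open>derives_der\<close> and \<open>der_derives\<close>.\<close>

inductive der :: "('o, 'm) polycat \<Rightarrow> ('o, 'n) sctx \<Rightarrow> ('o, 'm, 'n) trm \<Rightarrow> bool" for A where
  der_ax: "f \<in> poly A \<Longrightarrow> der A (actx A f) (Ax f)"
| der_mk_node: "\<lbrakk>ok A C; C \<alpha> = Some v; branch v I; \<And>i. i |\<in>| I \<Longrightarrow> der A (C(\<alpha> \<mapsto> sub v i)) (f i)\<rbrakk>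
    \<Longrightarrow> der A C (mk_node C \<alpha> (family I f))"
| der_cut: "\<lbrakk>cuttable True \<gamma> C D; der A C t; der A D u\<rbrakk> \<Longrightarrow> der A (join \<gamma> C D) (Cut \<gamma> t u)"

lemma part_del:
  assumes "finite (dom C)" "C \<alpha> = Some (s, X)"
  shows "\<alpha> |\<notin>| fmdom (part s' (C(\<alpha> := None)))"
    and "fmupd \<alpha> Y (part s (C(\<alpha> := None))) = part s (C(\<alpha> \<mapsto> (s, Y)))"
    and "s' \<noteq> s \<Longrightarrow> part s' (C(\<alpha> := None)) = part s' C"
    and "s' \<noteq> s \<Longrightarrow> part s' (C(\<alpha> \<mapsto> (s, Y))) = part s' C"
  using assms
  by (auto simp: fmlookup_dom_iff fmlookup_part intro!: fmap_ext split: option.splits if_splits)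

lemma part_disjoint: "finite (dom C) \<Longrightarrow> fmdom (part False C) |\<inter>| fmdom (part True C) = {||}"
  by (auto simp: fmlookup_dom_iff fmlookup_part split: option.splits if_splits)


lemma finite_dom_ok: "ok A C \<Longrightarrow> finite (dom C)"
  by (simp add: ok_def)

lemma ctx_upd_left: "ctx (fmupd \<alpha> X \<Gamma>) \<Delta> = (ctx \<Gamma> \<Delta>)(\<alpha> \<mapsto> (False, X))"
  by (rule ext) (simp add: ctx_def)

lemma ctx_upd_right: "\<alpha> |\<notin>| fmdom \<Gamma> \<Longrightarrow> ctx \<Gamma> (fmupd \<alpha> X \<Delta>) = (ctx \<Gamma> \<Delta>)(\<alpha> \<mapsto> (True, X))"
  by (rule ext) (auto simp: ctx_def fmdom_notD split: option.splits)

lemma ctx_notin: "\<alpha> |\<notin>| fmdom \<Gamma> \<Longrightarrow> \<alpha> |\<notin>| fmdom \<Delta> \<Longrightarrow> (ctx \<Gamma> \<Delta>)(\<alpha> := None) = ctx \<Gamma> \<Delta>"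
  by (auto simp: ctx_def fmdom_notD)

lemma ctx_add:
  assumes "(fmdom \<Gamma> |\<union>| fmdom \<Delta>) |\<inter>| (fmdom \<Gamma>' |\<union>| fmdom \<Delta>') = {||}"
  shows "ctx (\<Gamma> ++\<^sub>f \<Gamma>') (\<Delta> ++\<^sub>f \<Delta>') = ctx \<Gamma> \<Delta> ++ ctx \<Gamma>' \<Delta>'"
proof
  fix c
  have "c |\<notin>| fmdom \<Gamma> |\<union>| fmdom \<Delta> \<or> c |\<notin>| fmdom \<Gamma>' |\<union>| fmdom \<Delta>'"
    using assms by (metis fempty_iff finterI)
  then show "ctx (\<Gamma> ++\<^sub>f \<Gamma>') (\<Delta> ++\<^sub>f \<Delta>') c = (ctx \<Gamma> \<Delta> ++ ctx \<Gamma>' \<Delta>') c"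
    by (auto simp: ctx_def map_add_def fmlookup_dom_iff split: option.splits)
qed

lemma derives_der:
  assumes "symmetric_polycategory A"
  shows "derives A t \<Gamma> \<Delta> \<Longrightarrow> der A (ctx \<Gamma> \<Delta>) t"
proof (induction rule: derives.induct)
  case (ax f)
  then show ?case using der_ax by (metis actx_def)
next
  case (cotuple \<alpha> \<Gamma> X \<Delta> F)
  let ?C = "ctx (fmupd \<alpha> (Sum X) \<Gamma>) \<Delta>"
  have dis: "fmdom (fmupd \<alpha> (Sum X) \<Gamma>) |\<inter>| fmdom \<Delta> = {||}" and ok: "ok A ?C"
    using cotuple.hyps(2) by (auto simp: sequent_iff_ok)
  have nin: "\<alpha> |\<notin>| fmdom \<Delta>" and dis': "fmdom \<Gamma> |\<inter>| fmdom \<Delta> = {||}" using dis by auto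
  have C\<alpha>: "?C \<alpha> = Some (False, Sum X)" by (simp add: ctx_upd_left)
  have "der A ?C (mk_node ?C \<alpha> (family (fmdom F) (\<lambda>i. the (fmlookup F i))))"
  proof (rule der_mk_node [OF ok C\<alpha>])
    fix i assume "i |\<in>| fmdom F"
    then obtain t Z where "fmlookup F i = Some t" "fmlookup X i = Some Z"
      using cotuple.hyps(3) by (metis fmlookup_dom_iff)
    moreover from this have "?C(\<alpha> \<mapsto> sub (False, Sum X) i) = ctx (fmupd \<alpha> Z \<Gamma>) \<Delta>"
      by (simp add: sub_def ctx_upd_left)
    ultimately show "der A (?C(\<alpha> \<mapsto> sub (False, Sum X) i)) (the (fmlookup F i))"
      using cotuple.IH by (metis option.sel)
  qed (simp add: cotuple.hyps)
  moreover have "mk_node ?C \<alpha> F = Cotuple \<alpha> \<Gamma> \<Delta> F"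
    using nin cotuple.hyps(1) dis' mk_node_simps(1) [of ?C, OF C\<alpha>]
    by (simp add: ctx_upd_left ctx_notin part_ctx_False part_ctx_True)
  ultimately show ?case using family_of_fmap [of F] by simp
next
  case (tuple \<alpha> \<Delta> \<Gamma> X F)
  let ?C = "ctx \<Gamma> (fmupd \<alpha> (Prod X) \<Delta>)"
  have dis: "fmdom \<Gamma> |\<inter>| fmdom (fmupd \<alpha> (Prod X) \<Delta>) = {||}" and ok: "ok A ?C"
    using tuple.hyps(2) by (auto simp: sequent_iff_ok)
  have nin: "\<alpha> |\<notin>| fmdom \<Gamma>" and dis': "fmdom \<Gamma> |\<inter>| fmdom \<Delta> = {||}" using dis by auto
  have C\<alpha>: "?C \<alpha> = Some (True, Prod X)" using nin by (simp add: ctx_upd_right)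
  have "der A ?C (mk_node ?C \<alpha> (family (fmdom F) (\<lambda>i. the (fmlookup F i))))"
  proof (rule der_mk_node [OF ok C\<alpha>])
    fix i assume "i |\<in>| fmdom F"
    then obtain t Z where "fmlookup F i = Some t" "fmlookup X i = Some Z"
      using tuple.hyps(3) by (metis fmlookup_dom_iff)
    moreover from this have "?C(\<alpha> \<mapsto> sub (True, Prod X) i) = ctx \<Gamma> (fmupd \<alpha> Z \<Delta>)"
      using nin by (simp add: sub_def ctx_upd_right)
    ultimately show "der A (?C(\<alpha> \<mapsto> sub (True, Prod X) i)) (the (fmlookup F i))"
      using tuple.IH by (metis option.sel)
  qed (simp add: tuple.hyps)
  moreover have "mk_node ?C \<alpha> F = Tuple \<alpha> \<Gamma> \<Delta> F"
    using nin tuple.hyps(1) dis' mk_node_simps(2) [of ?C, OF C\<alpha>]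
    by (simp add: ctx_upd_right ctx_notin part_ctx_False part_ctx_True)
  ultimately show ?case using family_of_fmap [of F] by simp
next
  case (proj \<alpha> \<Gamma> X \<Delta> k Z t)
  let ?C = "ctx (fmupd \<alpha> (Prod X) \<Gamma>) \<Delta>"
  have ok: "ok A ?C" using proj.hyps(2) by (auto simp: sequent_iff_ok)
  have C\<alpha>: "?C \<alpha> = Some (False, Prod X)" by (simp add: ctx_upd_left)
  have "der A ?C (mk_node ?C \<alpha> (family {|k|} (\<lambda>_. t)))"
  proof (rule der_mk_node [OF ok C\<alpha>])
    show "branch (False, Prod X) {|k|}" using proj.hyps(3) by (auto intro: fmdomI)
    have "ctx (fmupd \<alpha> Z \<Gamma>) \<Delta> = ?C(\<alpha> \<mapsto> sub (False, Prod X) k)"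
      using proj.hyps(3) by (simp add: sub_def ctx_upd_left)
    then show "der A (?C(\<alpha> \<mapsto> sub (False, Prod X) i)) t" if "i |\<in>| {|k|}" for i
      using that proj.IH by (metis fsingletonE)
  qed
  then show ?case by (simp add: mk_node_simps(3) [of ?C, OF C\<alpha>])
next
  case (inj \<alpha> \<Delta> \<Gamma> X k Z t)
  let ?C = "ctx \<Gamma> (fmupd \<alpha> (Sum X) \<Delta>)"
  have dis: "fmdom \<Gamma> |\<inter>| fmdom (fmupd \<alpha> (Sum X) \<Delta>) = {||}" and ok: "ok A ?C"
    using inj.hyps(2) by (auto simp: sequent_iff_ok)
  have nin: "\<alpha> |\<notin>| fmdom \<Gamma>" using dis by auto
  have C\<alpha>: "?C \<alpha> = Some (True, Sum X)" using nin by (simp add: ctx_upd_right)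
  have "der A ?C (mk_node ?C \<alpha> (family {|k|} (\<lambda>_. t)))"
  proof (rule der_mk_node [OF ok C\<alpha>])
    show "branch (True, Sum X) {|k|}" using inj.hyps(3) by (auto intro: fmdomI)
    have "ctx \<Gamma> (fmupd \<alpha> Z \<Delta>) = ?C(\<alpha> \<mapsto> sub (True, Sum X) k)"
      using inj.hyps(3) nin by (simp add: sub_def ctx_upd_right)
    then show "der A (?C(\<alpha> \<mapsto> sub (True, Sum X) i)) t" if "i |\<in>| {|k|}" for i
      using that inj.IH by (metis fsingletonE)
  qed
  then show ?case by (simp add: mk_node_simps(4) [of ?C, OF C\<alpha>])
next
  case (cut t \<Gamma> \<gamma> Z \<Delta> u \<Gamma>' \<Delta>')
  let ?C = "ctx \<Gamma> (fmupd \<gamma> Z \<Delta>)" and ?D = "ctx (fmupd \<gamma> Z \<Gamma>') \<Delta>'"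
  have "cuttable True \<gamma> ?C ?D"
    using cut.hyps(3,4)
    by (auto simp: cuttable_def ctx_upd_left ctx_upd_right dom_ctx dest: fset_eq_iff [THEN iffD1])
  moreover have "join \<gamma> ?C ?D = ctx (\<Gamma> ++\<^sub>f \<Gamma>') (\<Delta> ++\<^sub>f \<Delta>')"
  proof -
    have "join \<gamma> ?C ?D = (ctx \<Gamma> \<Delta> ++ ctx \<Gamma>' \<Delta>')(\<gamma> := None)"
      using cut.hyps(3) by (simp add: join_sub ctx_upd_left ctx_upd_right) (simp add: join_def)
    also have "\<dots> = ctx (\<Gamma> ++\<^sub>f \<Gamma>') (\<Delta> ++\<^sub>f \<Delta>')"
      using cut.hyps(3) by (simp add: ctx_add [OF cut.hyps(4), symmetric] ctx_notin)
    finally show ?thesis .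
  qed
  ultimately show ?case using der_cut cut.IH by metis
qed

lemma ok_actx:
  assumes "symmetric_polycategory A" "f \<in> poly A"
  shows "ok A (actx A f)"
proof -
  have "fmran' (src A f) \<union> fmran' (tgt A f) \<subseteq> obj A"
    using symmetric_polycategory.poly_sequent [OF assms] by blast
  then show ?thesis
    by (fastforce simp: ok_def actx_def ctx_def fmlookup_ran'_iff subset_iff split: option.splits)
qed

lemma der_ok:
  assumes "symmetric_polycategory A"
  shows "der A C t \<Longrightarrow> ok A C"
  by (induction rule: der.induct) (auto simp: ok_actx [OF assms] ok_join)

lemma part_join:
  assumes "cuttable True \<gamma> C D" "finite (dom C)" "finite (dom D)"
  shows "part s (join \<gamma> C D) = part s (C(\<gamma> := None)) ++\<^sub>f part s (D(\<gamma> := None))"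
proof (rule fmap_ext)
  fix c
  have "finite (dom (join \<gamma> C D))" using assms by (simp add: dom_join)
  moreover have "C c = None \<or> D c = None \<or> c = \<gamma>" using assms by (auto simp: cuttable_def)
  ultimately show "fmlookup (part s (join \<gamma> C D)) c =
      fmlookup (part s (C(\<gamma> := None)) ++\<^sub>f part s (D(\<gamma> := None))) c"
    using assms(2,3)
    by (auto simp: fmlookup_part fmlookup_dom_iff join_def map_add_def split: option.splits if_splits)
qed

lemma Abs_fset_disjoint:
  "finite S \<Longrightarrow> finite T \<Longrightarrow> S \<inter> T = {} \<Longrightarrow> Abs_fset S |\<inter>| Abs_fset T = {||}"
  by (auto simp: Abs_fset_inverse)

lemma der_derives:
  assumes A: "symmetric_polycategory A"
  shows "der A C t \<Longrightarrow> derives A t (part False C) (part True C)"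
proof (induction rule: der.induct)
  case (der_ax f)
  have "fmdom (src A f) |\<inter>| fmdom (tgt A f) = {||}"
    using symmetric_polycategory.poly_sequent [OF A der_ax] by blast
  then show ?case
    using derives.ax [OF der_ax] by (simp add: actx_def part_ctx_False part_ctx_True)
next
  case (der_mk_node C \<alpha> v I f)
  note fin = finite_dom_ok [OF der_mk_node.hyps(1)]
  have seq: "sequent A (part False C) (part True C)"
    using der_mk_node.hyps(1) fin by (simp add: sequent_iff_ok ctx_part part_disjoint)
  have C\<alpha>: "C \<alpha> = Some v" by (rule der_mk_node.hyps(2))
  have upd: "fmupd \<alpha> (snd v) (part (fst v) (C(\<alpha> := None))) = part (fst v) C"
    using part_del(2) [OF fin, of \<alpha> "fst v" "snd v"] C\<alpha> by (simp add: fun_upd_idem)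
  from der_mk_node.hyps(3) show ?case
  proof (cases rule: branch_cases)
    case (cotuple X)
    note p = part_del(1) [OF fin C\<alpha> [unfolded cotuple], of False] part_del(2) [OF fin C\<alpha> [unfolded cotuple]] part_del(3,4) [OF fin C\<alpha> [unfolded cotuple], where s' = True]
    have "derives A (f i) (fmupd \<alpha> Z (part False (C(\<alpha> := None)))) (part True C)"
      if "fmlookup X i = Some Z" for i Z
      using der_mk_node.IH [of i] that fmdomI [OF that] cotuple p(2) [of Z] p(4) [of Z] by (simp add: sub_def del: fun_upd_apply)
    then have "derives A (Cotuple \<alpha> (part False (C(\<alpha> := None))) (part True C) (family I f))
        (fmupd \<alpha> (Sum X) (part False (C(\<alpha> := None)))) (part True C)"
      using p(1) seq upd cotuple by (intro derives.cotuple) (auto split: if_splits intro: fmdomI)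
    then show ?thesis using upd p cotuple by (simp add: mk_node_simps C\<alpha>)
  next
    case (tuple X)
    note p = part_del(1) [OF fin C\<alpha> [unfolded tuple], of True] part_del(2) [OF fin C\<alpha> [unfolded tuple]] part_del(3,4) [OF fin C\<alpha> [unfolded tuple], where s' = False]
    have "derives A (f i) (part False C) (fmupd \<alpha> Z (part True (C(\<alpha> := None))))"
      if "fmlookup X i = Some Z" for i Z
      using der_mk_node.IH [of i] that fmdomI [OF that] tuple p(2) [of Z] p(4) [of Z] by (simp add: sub_def del: fun_upd_apply)
    then have "derives A (Tuple \<alpha> (part False C) (part True (C(\<alpha> := None))) (family I f))
        (part False C) (fmupd \<alpha> (Prod X) (part True (C(\<alpha> := None))))"
      using p(1) seq upd tuple by (intro derives.tuple) (auto split: if_splits intro: fmdomI)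
    then show ?thesis using upd p tuple by (simp add: mk_node_simps C\<alpha>)
  next
    case (proj X k)
    note p = part_del(1) [OF fin C\<alpha> [unfolded proj], of False] part_del(2) [OF fin C\<alpha> [unfolded proj]] part_del(3,4) [OF fin C\<alpha> [unfolded proj], where s' = True]
    obtain Z where Z: "fmlookup X k = Some Z" using proj(2) by (auto simp: fmlookup_dom_iff)
    have "derives A (f k) (fmupd \<alpha> Z (part False (C(\<alpha> := None)))) (part True C)"
      using der_mk_node.IH [of k] proj Z p(2) [of Z] p(4) [of Z] by (simp add: sub_def del: fun_upd_apply)
    then have "derives A (Proj \<alpha> X k (f k))
        (fmupd \<alpha> (Prod X) (part False (C(\<alpha> := None)))) (part True C)"
      using p(1) seq upd proj Z by (intro derives.proj) auto
    then show ?thesis using upd p proj by (simp add: mk_node_simps C\<alpha>)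
  next
    case (inj X k)
    note p = part_del(1) [OF fin C\<alpha> [unfolded inj], of True] part_del(2) [OF fin C\<alpha> [unfolded inj]] part_del(3,4) [OF fin C\<alpha> [unfolded inj], where s' = False]
    obtain Z where Z: "fmlookup X k = Some Z" using inj(2) by (auto simp: fmlookup_dom_iff)
    have "derives A (f k) (part False C) (fmupd \<alpha> Z (part True (C(\<alpha> := None))))"
      using der_mk_node.IH [of k] inj Z p(2) [of Z] p(4) [of Z] by (simp add: sub_def del: fun_upd_apply)
    then have "derives A (Inj \<alpha> X k (f k))
        (part False C) (fmupd \<alpha> (Sum X) (part True (C(\<alpha> := None))))"
      using p(1) seq upd inj Z by (intro derives.inj) auto
    then show ?thesis using upd p inj by (simp add: mk_node_simps C\<alpha>)
  qed
next
  case (der_cut \<gamma> C D t u)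
  have fin: "finite (dom C)" "finite (dom D)"
    using der_cut.hyps der_ok [OF A] finite_dom_ok by blast+
  obtain Z where Z: "C \<gamma> = Some (True, Z)" "D \<gamma> = Some (False, Z)" "dom C \<inter> dom D = {\<gamma>}"
    using der_cut.hyps(1) by (auto simp: cuttable_def)
  have upd: "fmupd \<gamma> Z (part True (C(\<gamma> := None))) = part True C"
    "fmupd \<gamma> Z (part False (D(\<gamma> := None))) = part False D"
    using part_del(2) [OF fin(1) Z(1), of Z] part_del(2) [OF fin(2) Z(2), of Z] Z
    by (simp_all add: fun_upd_idem)
  let ?C = "C(\<gamma> := None)" and ?D = "D(\<gamma> := None)"
  have t: "derives A t (part False ?C) (fmupd \<gamma> Z (part True ?C))"
    using der_cut.IH(1) upd(1) part_del(3) [OF fin(1) Z(1), of False] by simp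
  have u: "derives A u (fmupd \<gamma> Z (part False ?D)) (part True ?D)"
    using der_cut.IH(2) upd(2) part_del(3) [OF fin(2) Z(2), of True] by simp
  have dom: "fmdom (part False E) |\<union>| fmdom (part True E) = Abs_fset (dom E)" if "finite (dom E)" for E
    using that by (auto simp: fmlookup_dom_iff fmlookup_part Abs_fset_inverse split: option.splits if_splits)
  show ?case
    unfolding part_join [OF der_cut.hyps(1) fin]
  proof (rule derives.cut [OF t u])
    show "\<gamma> |\<notin>| fmdom (part False ?C) |\<union>| fmdom (part True ?C) |\<union>| fmdom (part False ?D) |\<union>| fmdom (part True ?D)"
      using part_del(1) [OF fin(1) Z(1)] part_del(1) [OF fin(2) Z(2)] by auto
    show "(fmdom (part False ?C) |\<union>| fmdom (part True ?C)) |\<inter>|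
        (fmdom (part False ?D) |\<union>| fmdom (part True ?D)) = {||}"
    proof -
      have "finite (dom ?C)" "finite (dom ?D)" using fin by simp_all
      moreover have "dom ?C \<inter> dom ?D = {}" using Z(3) by (simp only: dom_fun_upd if_True refl) blast
      ultimately show ?thesis by (simp only: dom Abs_fset_disjoint)
    qed
  qed
qed

section \<open>What a term reveals about its sequent\<close>

lemma mk_node_neq:
  assumes "C \<alpha> = Some v" "branch v I"
  shows "mk_node C \<alpha> (family I f) \<noteq> Ax g" "mk_node C \<alpha> (family I f) \<noteq> Cut \<gamma> t u"
  using assms(2,1) by (cases rule: branch_cases; simp add: mk_node_simps)+

text \<open>The last conclusion reflects what the annotations store: a projection or injection
  records the formula at \<alpha>, a cotuple or tuple the side formulas and, through its family, the
  component names. The other half of the sequent has to come from the premises.\<close>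

lemma mk_node_inj:
  assumes "C \<alpha> = Some v" "branch v I" "D \<beta> = Some w" "branch w J"
    and "finite (dom C)" "finite (dom D)"
    and eq: "mk_node C \<alpha> (family I f) = mk_node D \<beta> (family J g)"
  shows "\<beta> = \<alpha>" "J = I" "\<And>i. i |\<in>| I \<Longrightarrow> f i = g i" "fst w = fst v"
    and "(\<exists>i. i |\<in>| I) \<and> snd v = snd w \<or> C(\<alpha> := None) = D(\<alpha> := None) \<and>
      fmdom (comps (snd v)) = I \<and> fmdom (comps (snd w)) = I \<and>
      (comps (snd v) = comps (snd w) \<longrightarrow> snd v = snd w)"
proof -
  have "C(\<alpha> := None) = D(\<beta> := None)"
    if "part False (C(\<alpha> := None)) = part False (D(\<beta> := None))"
      "part True (C(\<alpha> := None)) = part True (D(\<beta> := None))"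
    using that assms(5,6) ctx_part by (metis dom_fun_upd finite_Diff)
  then have "\<beta> = \<alpha> \<and> J = I \<and> (\<forall>i. i |\<in>| I \<longrightarrow> f i = g i) \<and> fst w = fst v \<and>
    ((\<exists>i. i |\<in>| I) \<and> snd v = snd w \<or> C(\<alpha> := None) = D(\<alpha> := None) \<and>
      fmdom (comps (snd v)) = I \<and> fmdom (comps (snd w)) = I \<and>
      (comps (snd v) = comps (snd w) \<longrightarrow> snd v = snd w))"
    using assms(1,3) eq
    by (cases rule: branch_cases [OF assms(2)]; cases rule: branch_cases [OF assms(4)])
      (simp_all add: mk_node_simps family_eq_iff)
  then show "\<beta> = \<alpha>" "J = I" "\<And>i. i |\<in>| I \<Longrightarrow> f i = g i" "fst w = fst v"
    "(\<exists>i. i |\<in>| I) \<and> snd v = snd w \<or> C(\<alpha> := None) = D(\<alpha> := None) \<and>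
      fmdom (comps (snd v)) = I \<and> fmdom (comps (snd w)) = I \<and>
      (comps (snd v) = comps (snd w) \<longrightarrow> snd v = snd w)"
    by blast+
qed

text \<open>As \<open>mk_node\<close> is a function and not a constructor, inverting a derivation
  leaves an equation between terms; it is kept as a hypothesis, to be resolved by
  \<open>mk_node_neq\<close> and \<open>mk_node_inj\<close>.\<close>

lemma der_cases:
  assumes "der A D t"
  obtains (ax) f where "t = Ax f" "D = actx A f" "f \<in> poly A"
    | (node) \<alpha> v I f where "t = mk_node D \<alpha> (family I f)" "ok A D" "D \<alpha> = Some v" "branch v I"
        "\<And>i. i |\<in>| I \<Longrightarrow> der A (D(\<alpha> \<mapsto> sub v i)) (f i)"
    | (cut) \<gamma> C E u w where "t = Cut \<gamma> u w" "D = join \<gamma> C E" "cuttable True \<gamma> C E" "der A C u" "der A E w"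
  using assms by (rule der.cases) blast+

lemma der_AxD: "der A D (Ax f) \<Longrightarrow> D = actx A f \<and> f \<in> poly A"
proof (erule der_cases)
  fix \<alpha> v I g
  assume "Ax f = mk_node D \<alpha> (family I g)" "D \<alpha> = Some v" "branch v I"
  then show ?thesis using mk_node_neq(1) [of D \<alpha> v I g f] by simp
qed simp_all

lemma der_CutD:
  "der A D (Cut \<gamma> t u) \<Longrightarrow> \<exists>C E. D = join \<gamma> C E \<and> cuttable True \<gamma> C E \<and> der A C t \<and> der A E u"
proof (erule der_cases)
  fix \<alpha> v I g
  assume "Cut \<gamma> t u = mk_node D \<alpha> (family I g)" "D \<alpha> = Some v" "branch v I"
  then show ?thesis using mk_node_neq(2) [of D \<alpha> v I g \<gamma> t u] by simp
qed auto

lemma der_mkD: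
  assumes "der A D (mk_node C \<alpha> (family I f))" "C \<alpha> = Some v" "branch v I"
  shows "\<exists>\<beta> w J g. mk_node C \<alpha> (family I f) = mk_node D \<beta> (family J g) \<and> ok A D \<and> D \<beta> = Some w \<and>
    branch w J \<and> (\<forall>i. i |\<in>| J \<longrightarrow> der A (D(\<beta> \<mapsto> sub w i)) (g i))"
  using assms(1)
proof (cases rule: der_cases)
  case (ax g)
  then show ?thesis using mk_node_neq(1) [of C \<alpha> v I f g] assms(2,3) by simp
next
  case (node \<beta> w J g)
  then show ?thesis by blast
next
  case (cut \<gamma> E E' t u)
  then show ?thesis using mk_node_neq(2) [of C \<alpha> v I f \<gamma> t u] assms(2,3) by simp
qed

text \<open>Annotations and premises together determine the whole sequent. This is what allows
  chaining steps that only assert the existence of a common sequent.\<close>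

lemma der_unique:
  assumes A: "symmetric_polycategory A"
  shows "der A C t \<Longrightarrow> der A D t \<Longrightarrow> C = D"
proof (induction arbitrary: D rule: der.induct)
  case (der_ax f)
  then show ?case using der_AxD [of A D f] by simp
next
  case (der_mk_node C \<alpha> v I f)
  from der_mk_node.prems obtain \<beta> w J g
    where D: "mk_node C \<alpha> (family I f) = mk_node D \<beta> (family J g)" "ok A D" "D \<beta> = Some w" "branch w J"
      "\<And>i. i |\<in>| J \<Longrightarrow> der A (D(\<beta> \<mapsto> sub w i)) (g i)"
    using der_mkD [of A D C \<alpha> I f v] der_mk_node.hyps(2,3) by blast
  have fin: "finite (dom C)" "finite (dom D)" using der_mk_node.hyps(1) D(2) by (simp_all add: ok_def)
  note inj = mk_node_inj [of C \<alpha> v I D \<beta> w J f g, OF der_mk_node.hyps(2,3) D(3,4) fin D(1)]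
  have eq: "C(\<alpha> \<mapsto> sub v i) = D(\<alpha> \<mapsto> sub w i)" if "i |\<in>| I" for i
  proof (rule der_mk_node.IH [OF that])
    show "der A (D(\<alpha> \<mapsto> sub w i)) (f i)"
      using D(5) [of i] that unfolding inj(1,2) inj(3) [OF that] by blast
  qed
  \<comment> \<open>Any premise shows the context away from \<alpha>. A nullary cotuple or tuple has
    no premise, but stores its side formulas.\<close>
  have "C(\<alpha> := None) = D(\<alpha> := None)"
  proof (cases "\<exists>i. i |\<in>| I")
    case True
    then obtain i where "i |\<in>| I" ..
    from eq [OF this] have "(C(\<alpha> \<mapsto> sub v i))(\<alpha> := None) = (D(\<alpha> \<mapsto> sub w i))(\<alpha> := None)"
      by (rule arg_cong)
    then show ?thesis by (simp del: fun_upd_apply)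
  next
    case False
    then show ?thesis using inj(5) by blast
  qed
  \<comment> \<open>If the formulas differed, the rule would be a cotuple or tuple; its premises
    cover all components, so the component families agree pointwise.\<close>
  moreover have "snd v = snd w"
  proof (rule ccontr)
    assume neq: "snd v \<noteq> snd w"
    with inj(5) have dom: "fmdom (comps (snd v)) = I" "fmdom (comps (snd w)) = I"
      and ne: "comps (snd v) \<noteq> comps (snd w)" by auto
    have "fmlookup (comps (snd v)) i = fmlookup (comps (snd w)) i" for i
    proof (cases "i |\<in>| I")
      case True
      then have "sub v i = sub w i" using eq [OF True] by (metis fun_upd_same option.inject)
      then show ?thesis
        using True unfolding sub_def prod.inject
        by (metis dom fmdom_notI option.expand)
    next
      case False
      then show ?thesis using dom by (metis fmdom_notD)
    qed
    then show False using ne fmap_ext by blast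
  qed
  then have "v = w" using inj(4) by (simp add: prod_eq_iff)
  ultimately have "(C(\<alpha> := None))(\<alpha> \<mapsto> v) = (D(\<alpha> := None))(\<alpha> \<mapsto> w)" by simp
  then show ?case using der_mk_node.hyps(2) D(3) inj(1) by (simp add: fun_upd_idem)
next
  case (der_cut \<gamma> C E t u)
  obtain C' E' where "D = join \<gamma> C' E'" "der A C' t" "der A E' u"
    using der_CutD [OF der_cut.prems] by blast
  then show ?case using der_cut.IH(1) [of C'] der_cut.IH(2) [of E'] by simp
qed

section \<open>Renaming\<close>

text \<open>The formula at \<open>c\<close> moves to \<open>\<pi> c\<close>, so looking up a channel
  goes through the inverse.\<close>

definition act :: "(channel \<Rightarrow> channel) \<Rightarrow> ('o, 'n) sctx \<Rightarrow> ('o, 'n) sctx" where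
  "act \<pi> C = C \<circ> inv \<pi>"

lemma act_apply [simp]: "bij \<pi> \<Longrightarrow> act \<pi> C (\<pi> c) = C c"
  by (simp add: act_def bij_is_inj)

lemma act_ext: "bij \<pi> \<Longrightarrow> (\<And>c. act \<pi> C (\<pi> c) = D (\<pi> c)) \<Longrightarrow> act \<pi> C = D"
  by (rule ext) (metis bij_pointE)

lemma act_join: "bij \<pi> \<Longrightarrow> act \<pi> (join \<gamma> C D) = join (\<pi> \<gamma>) (act \<pi> C) (act \<pi> D)"
  by (rule act_ext) (auto simp: join_def map_add_def bij_is_inj inj_eq split: option.splits)

lemma dom_act: "bij \<pi> \<Longrightarrow> dom (act \<pi> C) = \<pi> ` dom C"
proof (intro set_eqI iffI)
  fix c assume "bij \<pi>" "c \<in> dom (act \<pi> C)"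
  then show "c \<in> \<pi> ` dom C"
    by (intro image_eqI [of _ _ "inv \<pi> c"]) (auto simp: act_def bij_is_surj surj_f_inv_f)
qed auto

lemma act_cuttable: "bij \<pi> \<Longrightarrow> cuttable s \<gamma> C D \<Longrightarrow> cuttable s (\<pi> \<gamma>) (act \<pi> C) (act \<pi> D)"
  by (auto simp: cuttable_def dom_act bij_is_inj image_Int [symmetric])

lemma act_cong:
  assumes "bij \<pi>" "bij \<rho>" "\<And>c. c \<in> dom C \<Longrightarrow> \<pi> c = \<rho> c"
  shows "act \<pi> C = act \<rho> C"
proof (rule act_ext [OF assms(1)])
  fix c
  show "act \<pi> C (\<pi> c) = act \<rho> C (\<pi> c)"
  proof (cases "C c")
    case None
    \<comment> \<open>If \<rho> sent some channel of \<open>C\<close> to \<open>\<pi> c\<close>,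
      then \<pi> would send it there as well, and by injectivity this channel would be
      \<open>c\<close>.\<close>
    have "C (inv \<rho> (\<pi> c)) = None"
    proof (rule ccontr)
      assume "C (inv \<rho> (\<pi> c)) \<noteq> None"
      then have "\<pi> (inv \<rho> (\<pi> c)) = \<rho> (inv \<rho> (\<pi> c))" by (intro assms(3)) auto
      also have "\<dots> = \<pi> c" using assms(2) by (simp add: bij_is_surj surj_f_inv_f)
      finally have "inv \<rho> (\<pi> c) = c" using assms(1) by (simp add: bij_is_inj inj_eq)
      with None \<open>C (inv \<rho> (\<pi> c)) \<noteq> None\<close> show False by simp
    qed
    then show ?thesis using None assms(1) by (simp add: act_def bij_is_inj)
  next
    case (Some v)
    then show ?thesis using assms by (metis act_apply domI)
  qed
qed

lemma act_id: "bij \<pi> \<Longrightarrow> (\<And>c. c \<in> dom C \<Longrightarrow> \<pi> c = c) \<Longrightarrow> act \<pi> C = C"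
  using act_cong [of \<pi> id C] by (simp add: act_def)

text \<open>Conjugation of a transposition. It moves a renaming past the transposition that absorbs
  an identity or renames a bound channel.\<close>

lemma transpose_comp_bij:
  "bij \<pi> \<Longrightarrow> \<pi> \<circ> transpose a b = transpose (\<pi> a) (\<pi> b) \<circ> \<pi>"
  by (rule ext) (auto simp: transpose_def bij_is_inj inj_eq)


section \<open>Untyped normal forms\<close>

text \<open>A node does not record which of the four rules it stands for, as this is determined by the
  sequent: projections and injections are nodes whose family has one member. All permuting
  conversions become exchanges of two consecutive nodes. Leaves are cuts of axioms.\<close>

datatype ('o, 'm, 'n) nt =
    Leaf "('o, 'm, 'n) trm"
  | Node channel "('n, ('o, 'm, 'n) nt) fmap"

text \<open>The size of a node is a sum over the graph of its finite map, and the child is one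
  summand. The measure for \<open>cut_nt\<close> rests on this.\<close>

lemma size_fmlookup:
  assumes "fmlookup F i = Some x"
  shows "size x < size (Node \<alpha> F)"
proof -
  have "(i, x) \<in> fset (fset_of_fmap F)"
    using assms by (simp add: fset_of_fmap.rep_eq set_of_map_def)
  then have "Suc (size x) \<le> (\<Sum>(j, y) \<in> fset (fset_of_fmap F). Suc (size y))"
    using member_le_sum [of "(i, x)" "fset (fset_of_fmap F)" "\<lambda>(j, y). Suc (size y)"] by simp
  then show ?thesis by (simp add: case_prod_unfold)
qed

lemma size_fmran': "x \<in> fmran' F \<Longrightarrow> size x < size (Node \<alpha> F)"
  by (metis fmlookup_ran'_iff size_fmlookup)

primrec ren_nt :: "('o, 'm) polycat \<Rightarrow> (channel \<Rightarrow> channel) \<Rightarrow> ('o, 'm, 'n) nt \<Rightarrow> ('o, 'm, 'n) nt" where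
  "ren_nt A \<pi> (Leaf a) = Leaf (ren_trm A \<pi> a)"
| "ren_nt A \<pi> (Node \<alpha> F) = Node (\<pi> \<alpha>) (fmmap (ren_nt A \<pi>) F)"

text \<open>Says that the cut on \<gamma> cannot be pushed further into this left argument. A leaf
  has no root to commute with, hence qualifies for every \<gamma>.\<close>

fun heads :: "channel \<Rightarrow> ('o, 'm, 'n) nt \<Rightarrow> bool" where
  "heads \<gamma> (Leaf a) \<longleftrightarrow> True"
| "heads \<gamma> (Node \<alpha> F) \<longleftrightarrow> \<alpha> = \<gamma>"

context symmetric_polycategory
begin

text \<open>Source and target of an identity reveal its two channels and its object; the definite
  descriptions in \<open>leaf_cut\<close> are therefore determined.\<close>

lemma idn_eq_iff:
  assumes "a \<in> obj A" "\<alpha> \<noteq> \<beta>" "b \<in> obj A" "\<gamma> \<noteq> \<delta>"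
  shows "idn A \<alpha> \<beta> a = idn A \<gamma> \<delta> b \<longleftrightarrow> \<alpha> = \<gamma> \<and> \<beta> = \<delta> \<and> a = b"
proof
  assume eq: "idn A \<alpha> \<beta> a = idn A \<gamma> \<delta> b"
  have "fmupd \<alpha> a fmempty = fmupd \<gamma> b fmempty" "fmupd \<beta> a fmempty = fmupd \<delta> b fmempty"
    using idn_poly [OF assms(1,2)] idn_poly [OF assms(3,4)] eq by simp_all
  then show "\<alpha> = \<gamma> \<and> \<beta> = \<delta> \<and> a = b"
    by (metis fmempty_lookup fmupd_lookup option.distinct(1) option.inject)
qed simp

definition is_idn :: "channel \<Rightarrow> channel \<Rightarrow> ('o, 'm, 'n) trm \<Rightarrow> bool" where
  "is_idn \<gamma> \<beta> b \<longleftrightarrow> \<gamma> \<noteq> \<beta> \<and> (\<exists>c \<in> obj A. b = Ax (idn A \<gamma> \<beta> c))"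

lemma is_idn_unique: "is_idn \<gamma> \<beta> b \<Longrightarrow> is_idn \<gamma>' \<beta>' b \<Longrightarrow> \<gamma>' = \<gamma> \<and> \<beta>' = \<beta>"
  by (auto simp: is_idn_def idn_eq_iff)

text \<open>When both leaves are identities the right one is absorbed. The choice is immaterial:
  absorbing the left one gives the same axiom, as the proof of \<open>cut_nt_idn_left\<close>
  shows.\<close>

definition leaf_cut :: "channel \<Rightarrow> ('o, 'm, 'n) trm \<Rightarrow> ('o, 'm, 'n) trm \<Rightarrow> ('o, 'm, 'n) trm" where
  "leaf_cut \<gamma> a b = (if \<exists>\<beta>. is_idn \<gamma> \<beta> b then ren_trm A (transpose \<gamma> (THE \<beta>. is_idn \<gamma> \<beta> b)) a
     else if \<exists>\<alpha>. is_idn \<alpha> \<gamma> a then ren_trm A (transpose \<gamma> (THE \<alpha>. is_idn \<alpha> \<gamma> a)) b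
     else Cut \<gamma> a b)"

lemma leaf_cut_right: "is_idn \<gamma> \<beta> b \<Longrightarrow> leaf_cut \<gamma> a b = ren_trm A (transpose \<gamma> \<beta>) a"
proof -
  assume id: "is_idn \<gamma> \<beta> b"
  then have "(THE \<beta>. is_idn \<gamma> \<beta> b) = \<beta>" using is_idn_unique by blast
  then show ?thesis using id by (auto simp: leaf_cut_def)
qed

lemma leaf_cut_left: "\<nexists>\<beta>. is_idn \<gamma> \<beta> b \<Longrightarrow> is_idn \<alpha> \<gamma> a \<Longrightarrow> leaf_cut \<gamma> a b = ren_trm A (transpose \<gamma> \<alpha>) b"
proof -
  assume "\<nexists>\<beta>. is_idn \<gamma> \<beta> b" and id: "is_idn \<alpha> \<gamma> a"
  moreover have "(THE \<alpha>. is_idn \<alpha> \<gamma> a) = \<alpha>" using id is_idn_unique [OF id] by blast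
  ultimately show ?thesis by (auto simp: leaf_cut_def)
qed

lemma leaf_cut_cut: "\<nexists>\<beta>. is_idn \<gamma> \<beta> b \<Longrightarrow> \<nexists>\<alpha>. is_idn \<alpha> \<gamma> a \<Longrightarrow> leaf_cut \<gamma> a b = Cut \<gamma> a b"
  by (simp add: leaf_cut_def)

lemma leaf_cut_cases:
  obtains (right) \<beta> where "is_idn \<gamma> \<beta> b" | (left) \<alpha> where "\<nexists>\<beta>. is_idn \<gamma> \<beta> b" "is_idn \<alpha> \<gamma> a"
    | (cut) "\<nexists>\<beta>. is_idn \<gamma> \<beta> b" "\<nexists>\<alpha>. is_idn \<alpha> \<gamma> a"
  by blast

text \<open>For typed arguments with root \<gamma> the two families share exactly one key, the
  selected component, which is found by \<open>THE k\<close>. The results \<open>n\<close> in the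
  remaining cases are reached only by untypable arguments and make the function total.\<close>

function cut_nt :: "channel \<Rightarrow> ('o, 'm, 'n) nt \<Rightarrow> ('o, 'm, 'n) nt \<Rightarrow> ('o, 'm, 'n) nt" where
  "cut_nt \<gamma> m n = (case m of
     Node \<alpha> F \<Rightarrow>
       if \<alpha> \<noteq> \<gamma> then Node \<alpha> (fmmap (\<lambda>f. cut_nt \<gamma> f n) F)
       else (case n of
         Node \<beta> G \<Rightarrow>
           if \<beta> \<noteq> \<gamma> then Node \<beta> (fmmap (\<lambda>g. cut_nt \<gamma> m g) G)
           else (let k = (THE k. k |\<in>| fmdom F |\<inter>| fmdom G) in
             case fmlookup F k of None \<Rightarrow> n | Some f \<Rightarrow>
             case fmlookup G k of None \<Rightarrow> n | Some g \<Rightarrow> cut_nt \<gamma> f g)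
       | Leaf b \<Rightarrow> n)
   | Leaf a \<Rightarrow> (case n of
         Node \<beta> G \<Rightarrow> Node \<beta> (fmmap (\<lambda>g. cut_nt \<gamma> m g) G)
       | Leaf b \<Rightarrow> Leaf (leaf_cut \<gamma> a b)))"
  by pat_completeness auto
termination
  by (relation "Wellfounded.measure (\<lambda>(\<gamma>, m, n). size m + size n)")
    (auto simp del: nt.size intro: size_fmran' size_fmlookup add_strict_mono)

declare cut_nt.simps [simp del]

lemma cut_nt_leaf: "cut_nt \<gamma> (Leaf a) (Leaf b) = Leaf (leaf_cut \<gamma> a b)"
  by (subst cut_nt.simps) simp

lemma cut_nt_left:
  "\<alpha> \<noteq> \<gamma> \<Longrightarrow> cut_nt \<gamma> (Node \<alpha> (family I f)) n = Node \<alpha> (family I (\<lambda>i. cut_nt \<gamma> (f i) n))"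
  by (subst cut_nt.simps) simp

lemma cut_nt_right:
  "heads \<gamma> m \<Longrightarrow> \<beta> \<noteq> \<gamma> \<Longrightarrow>
    cut_nt \<gamma> m (Node \<beta> (family J g)) = Node \<beta> (family J (\<lambda>j. cut_nt \<gamma> m (g j)))"
  by (subst cut_nt.simps) (cases m; simp)

lemma cut_nt_principal:
  assumes "I |\<inter>| J = {|k|}"
  shows "cut_nt \<gamma> (Node \<gamma> (family I f)) (Node \<gamma> (family J g)) = cut_nt \<gamma> (f k) (g k)"
proof -
  have "k |\<in>| I" "k |\<in>| J" using assms by auto
  moreover have "(THE k. k |\<in>| I \<and> k |\<in>| J) = k"
    using assms by (auto simp: fset_eq_iff)
  ultimately show ?thesis by (subst cut_nt.simps) (simp add: Let_def)
qed


section \<open>Typing and conversion of normal forms\<close>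

inductive leaf_wt :: "('o, 'n) sctx \<Rightarrow> ('o, 'm, 'n) trm \<Rightarrow> bool" where
  leaf_wt_ax: "f \<in> poly A \<Longrightarrow> leaf_wt (actx A f) (Ax f)"
| leaf_wt_cut: "\<lbrakk>cuttable True \<gamma> C D; leaf_wt C a; leaf_wt D b\<rbrakk> \<Longrightarrow> leaf_wt (join \<gamma> C D) (Cut \<gamma> a b)"

text \<open>Renaming of bound channels for trees of axioms, closed under cuts. The sequents of the
  subtrees are needed to state the freshness of \<delta>.\<close>

inductive leaf_eqv :: "('o, 'n) sctx \<Rightarrow> ('o, 'm, 'n) trm \<Rightarrow> ('o, 'm, 'n) trm \<Rightarrow> bool" where
  leaf_eqv_refl: "leaf_wt C a \<Longrightarrow> leaf_eqv C a a"
| leaf_eqv_sym: "leaf_eqv C a b \<Longrightarrow> leaf_eqv C b a"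
| leaf_eqv_trans: "leaf_eqv C a b \<Longrightarrow> leaf_eqv C b c \<Longrightarrow> leaf_eqv C a c"
| leaf_eqv_cut: "\<lbrakk>cuttable True \<gamma> C D; leaf_eqv C a a'; leaf_eqv D b b'\<rbrakk> \<Longrightarrow> leaf_eqv (join \<gamma> C D) (Cut \<gamma> a b) (Cut \<gamma> a' b')"
| leaf_eqv_alpha: "\<lbrakk>cuttable True \<gamma> C D; leaf_wt C a; leaf_wt D b; \<delta> \<notin> dom C \<union> dom D\<rbrakk> \<Longrightarrow> leaf_eqv (join \<gamma> C D) (Cut \<gamma> a b)
     (Cut \<delta> (ren_trm A (transpose \<gamma> \<delta>) a) (ren_trm A (transpose \<gamma> \<delta>) b))"

inductive wt :: "('o, 'n) sctx \<Rightarrow> ('o, 'm, 'n) nt \<Rightarrow> bool" where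
  wt_leaf: "leaf_wt C a \<Longrightarrow> wt C (Leaf a)"
| wt_node: "\<lbrakk>ok A C; C \<alpha> = Some v; branch v I; \<And>i. i |\<in>| I \<Longrightarrow> wt (C(\<alpha> \<mapsto> sub v i)) (f i)\<rbrakk>
    \<Longrightarrow> wt C (Node \<alpha> (family I f))"

text \<open>The ten permuting conversions are the ten unordered pairs of logical rules, and
  \<open>eqv_conv\<close> covers them all. With \<open>I\<close> empty the left side has no
  \<beta>-node, so the right to create one must come from the sequent \<open>C\<close>. Renaming
  enters through leaves alone.\<close>

inductive eqv :: "('o, 'n) sctx \<Rightarrow> ('o, 'm, 'n) nt \<Rightarrow> ('o, 'm, 'n) nt \<Rightarrow> bool" where
  eqv_refl: "wt C n \<Longrightarrow> eqv C n n"
| eqv_sym: "eqv C m n \<Longrightarrow> eqv C n m"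
| eqv_trans: "eqv C l m \<Longrightarrow> eqv C m n \<Longrightarrow> eqv C l n"
| eqv_leaf: "leaf_eqv C a b \<Longrightarrow> eqv C (Leaf a) (Leaf b)"
| eqv_node: "\<lbrakk>ok A C; C \<alpha> = Some v; branch v I; \<And>i. i |\<in>| I \<Longrightarrow> eqv (C(\<alpha> \<mapsto> sub v i)) (f i) (g i)\<rbrakk>
    \<Longrightarrow> eqv C (Node \<alpha> (family I f)) (Node \<alpha> (family I g))"
| eqv_conv: "\<lbrakk>ok A C; C \<alpha> = Some v; branch v I; C \<beta> = Some w; branch w J; \<alpha> \<noteq> \<beta>;
      \<And>i j. i |\<in>| I \<Longrightarrow> j |\<in>| J \<Longrightarrow> wt (C(\<alpha> \<mapsto> sub v i, \<beta> \<mapsto> sub w j)) (f i j)\<rbrakk>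
    \<Longrightarrow> eqv C (Node \<alpha> (family I (\<lambda>i. Node \<beta> (family J (f i)))))
             (Node \<beta> (family J (\<lambda>j. Node \<alpha> (family I (\<lambda>i. f i j)))))"

declare eqv_trans [trans]

lemma wt_cases:
  assumes "wt C n"
  obtains (leaf) a where "n = Leaf a" "leaf_wt C a"
    | (node) \<alpha> I f v where "n = Node \<alpha> (family I f)" "ok A C" "C \<alpha> = Some v" "branch v I"
        "\<And>i. i |\<in>| I \<Longrightarrow> wt (C(\<alpha> \<mapsto> sub v i)) (f i)"
  using assms by (rule wt.cases) blast+

lemma wt_NodeD:
  assumes "wt C (Node \<alpha> (family I f))"
  obtains v where "ok A C" "C \<alpha> = Some v" "branch v I" "\<And>i. i |\<in>| I \<Longrightarrow> wt (C(\<alpha> \<mapsto> sub v i)) (f i)"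
  using assms
proof (cases rule: wt_cases)
  case (node \<beta> J g v)
  then have "\<beta> = \<alpha>" "J = I" and fg: "\<And>i. i |\<in>| I \<Longrightarrow> g i = f i" by (simp_all add: family_eq_iff)
  moreover have "wt (C(\<alpha> \<mapsto> sub v i)) (f i)" if "i |\<in>| I" for i
    using node(5) [of i] that fg [OF that] calculation(1,2) by (simp del: fun_upd_apply)
  ultimately show thesis using that node(2-4) by blast
qed simp

lemma ok_sub: "ok A C \<Longrightarrow> C \<alpha> = Some v \<Longrightarrow> branch v I \<Longrightarrow> i |\<in>| I \<Longrightarrow> ok A (C(\<alpha> \<mapsto> sub v i))"
proof -
  assume *: "ok A C" "C \<alpha> = Some v" "branch v I" "i |\<in>| I"
  then obtain Z where Z: "fmlookup (comps (snd v)) i = Some Z"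
    using branch_subset by (metis fmlookup_dom_iff)
  then have "objects Z \<subseteq> objects (snd v)"
    by (cases "snd v") (auto intro: fmran'I)
  moreover have "objects (snd v) \<subseteq> obj A" using *(1,2) unfolding ok_def by (metis prod.collapse)
  ultimately show ?thesis using *(1) Z by (auto simp: ok_def sub_def)
qed

lemma leaf_wt_ok: "leaf_wt C a \<Longrightarrow> ok A C"
  by (induction rule: leaf_wt.induct) (auto simp: ok_join intro: ok_actx symmetric_polycategory_axioms)

lemma wt_ok: "wt C n \<Longrightarrow> ok A C"
  by (induction rule: wt.induct) (auto simp: leaf_wt_ok)

text \<open>Axioms live between atoms and a cut only removes channels. Consequently a leaf is never
  cut against a node whose root is the cut channel.\<close>

lemma leaf_wt_atom: "leaf_wt C a \<Longrightarrow> C c = Some v \<Longrightarrow> \<exists>x. snd v = Atom x"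
proof (induction arbitrary: c v rule: leaf_wt.induct)
  case (leaf_wt_ax f)
  then show ?case by (auto simp: actx_def ctx_def split: option.splits)
next
  case (leaf_wt_cut \<gamma> C D a b)
  then have "D c = Some v \<or> C c = Some v"
    by (auto simp: join_def map_add_Some_iff split: if_splits)
  then show ?case using leaf_wt_cut.IH by blast
qed

lemma leaf_wt_no_branch: "leaf_wt C a \<Longrightarrow> C c = Some (s, Z) \<Longrightarrow> \<not> branch (s', Z) I"
  using leaf_wt_atom [of C a c "(s, Z)"] by auto

lemma wt_exchange:
  assumes "ok A C" "C \<alpha> = Some v" "branch v I" "C \<beta> = Some w" "branch w J" "\<alpha> \<noteq> \<beta>"
    and "\<And>i j. i |\<in>| I \<Longrightarrow> j |\<in>| J \<Longrightarrow> wt (C(\<alpha> \<mapsto> sub v i, \<beta> \<mapsto> sub w j)) (f i j)"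
  shows "wt C (Node \<alpha> (family I (\<lambda>i. Node \<beta> (family J (f i)))))"
proof (rule wt_node [OF assms(1-3)])
  fix i assume i: "i |\<in>| I"
  have "(C(\<alpha> \<mapsto> sub v i)) \<beta> = Some w" using assms by simp
  then show "wt (C(\<alpha> \<mapsto> sub v i)) (Node \<beta> (family J (f i)))"
    by (rule wt_node [OF ok_sub [OF assms(1-3) i] _ assms(5) assms(7) [OF i]])
qed

lemma wt_exchange':
  assumes "ok A C" "C \<alpha> = Some v" "branch v I" "C \<beta> = Some w" "branch w J" "\<alpha> \<noteq> \<beta>"
    and "\<And>i j. i |\<in>| I \<Longrightarrow> j |\<in>| J \<Longrightarrow> wt (C(\<alpha> \<mapsto> sub v i, \<beta> \<mapsto> sub w j)) (f i j)"
  shows "wt C (Node \<beta> (family J (\<lambda>j. Node \<alpha> (family I (\<lambda>i. f i j)))))"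
  by (rule wt_exchange [OF assms(1,4,5,2,3)])
    (use assms(6,7) in \<open>auto simp: fun_upd_twist\<close>)

declare fun_upd_apply [simp del] fun_upd_same [simp] fun_upd_other [simp]

lemma actx_ren:
  assumes "f \<in> poly A" "bij \<pi>"
  shows "act \<pi> (actx A f) = actx A (ren A \<pi> f)"
proof (rule act_ext [OF assms(2)])
  fix c
  show "act \<pi> (actx A f) (\<pi> c) = actx A (ren A \<pi> f) (\<pi> c)"
    using ren_poly [OF assms] assms(2)
    by (simp add: actx_def ctx_def fmlookup_relabel bij_is_inj split: option.split)
qed

section \<open>Renaming and bound channels of leaves\<close>

lemma leaf_wt_ren: "leaf_wt C a \<Longrightarrow> bij \<pi> \<Longrightarrow> leaf_wt (act \<pi> C) (ren_trm A \<pi> a)"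
proof (induction rule: leaf_wt.induct)
  case (leaf_wt_ax f)
  then show ?case using leaf_wt.leaf_wt_ax [of "ren A \<pi> f"] ren_poly [of f \<pi>] by (simp add: actx_ren)
next
  case (leaf_wt_cut \<gamma> C D a b)
  then show ?case using leaf_wt.leaf_wt_cut [OF act_cuttable] by (simp add: act_join)
qed

lemma ren_trm_comp:
  "leaf_wt C a \<Longrightarrow> bij \<pi> \<Longrightarrow> bij \<rho> \<Longrightarrow> ren_trm A \<pi> (ren_trm A \<rho> a) = ren_trm A (\<pi> \<circ> \<rho>) a"
  by (induction rule: leaf_wt.induct) (simp_all add: ren_comp)

lemma dom_actx: "dom (actx A f) = fset (pchans A f)"
  by (simp add: actx_def dom_ctx pchans_def)

text \<open>The transposition moves only \<gamma>, which the join removes, and \<delta>, which lies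
  in neither context.\<close>

lemma act_alpha:
  assumes "cuttable s \<gamma> C D" "\<delta> \<notin> dom C \<union> dom D"
  shows "join \<delta> (act (transpose \<gamma> \<delta>) C) (act (transpose \<gamma> \<delta>) D) = join \<gamma> C D"
    and "cuttable s \<delta> (act (transpose \<gamma> \<delta>) C) (act (transpose \<gamma> \<delta>) D)"
proof -
  have "act (transpose \<gamma> \<delta>) (join \<gamma> C D) = join \<gamma> C D"
    using assms(2) by (intro act_id) (auto simp: dom_join transpose_def)
  then show "join \<delta> (act (transpose \<gamma> \<delta>) C) (act (transpose \<gamma> \<delta>) D) = join \<gamma> C D"
    using act_join [of "transpose \<gamma> \<delta>" \<gamma> C D] by simp
  show "cuttable s \<delta> (act (transpose \<gamma> \<delta>) C) (act (transpose \<gamma> \<delta>) D)"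
    using act_cuttable [of "transpose \<gamma> \<delta>", OF _ assms(1)] by simp
qed

lemma leaf_eqv_leaf_wt: "leaf_eqv C a b \<Longrightarrow> leaf_wt C a \<and> leaf_wt C b"
proof (induction rule: leaf_eqv.induct)
  case (leaf_eqv_alpha \<gamma> C D a b \<delta>)
  note al = act_alpha [OF leaf_eqv_alpha.hyps(1,4)]
  have "leaf_wt (join \<gamma> C D) (Cut \<delta> (ren_trm A (transpose \<gamma> \<delta>) a) (ren_trm A (transpose \<gamma> \<delta>) b))"
    using leaf_wt_cut [OF al(2) leaf_wt_ren leaf_wt_ren] leaf_eqv_alpha.hyps(2,3) al(1) by simp
  then show ?case using leaf_eqv_alpha leaf_wt_cut by blast
qed (auto intro: leaf_wt.intros)

lemma leaf_eqv_ren: "leaf_eqv C a b \<Longrightarrow> bij \<pi> \<Longrightarrow> leaf_eqv (act \<pi> C) (ren_trm A \<pi> a) (ren_trm A \<pi> b)"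
proof (induction rule: leaf_eqv.induct)
  case (leaf_eqv_refl C a)
  then show ?case by (blast intro: leaf_eqv.leaf_eqv_refl leaf_wt_ren)
next
  case (leaf_eqv_cut \<gamma> C D a a' b b')
  then show ?case using leaf_eqv.leaf_eqv_cut [OF act_cuttable] by (simp add: act_join)
next
  case (leaf_eqv_alpha \<gamma> C D a b \<delta>)
  have "\<pi> \<delta> \<notin> dom (act \<pi> C) \<union> dom (act \<pi> D)"
    using leaf_eqv_alpha.hyps(4) leaf_eqv_alpha.prems by (auto simp: dom_act bij_is_inj inj_eq)
  from leaf_eqv.leaf_eqv_alpha [OF act_cuttable [OF leaf_eqv_alpha.prems leaf_eqv_alpha.hyps(1)]
      leaf_wt_ren [OF leaf_eqv_alpha.hyps(2) leaf_eqv_alpha.prems] leaf_wt_ren [OF leaf_eqv_alpha.hyps(3) leaf_eqv_alpha.prems] this]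
  show ?case
    using leaf_eqv_alpha by (simp add: act_join ren_trm_comp transpose_comp_bij)
qed (blast intro: leaf_eqv_sym leaf_eqv_trans)+

text \<open>Renamings which agree on the channels of the sequent may still differ on bound channels.\<close>

lemma leaf_eqv_ren_cong:
  "leaf_wt C a \<Longrightarrow> bij \<pi> \<Longrightarrow> bij \<rho> \<Longrightarrow> (\<And>c. c \<in> dom C \<Longrightarrow> \<pi> c = \<rho> c) \<Longrightarrow>
    leaf_eqv (act \<pi> C) (ren_trm A \<pi> a) (ren_trm A \<rho> a)"
proof (induction arbitrary: \<pi> \<rho> rule: leaf_wt.induct)
  case (leaf_wt_ax f)
  then have "ren A \<pi> f = ren A \<rho> f" by (intro ren_cong) (auto simp: dom_actx)
  then show ?case using leaf_eqv_refl [OF leaf_wt_ren [OF leaf_wt.leaf_wt_ax [OF leaf_wt_ax(1)] leaf_wt_ax(2)]] by simp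
next
  case (leaf_wt_cut \<gamma> C D a b)
  note bij = leaf_wt_cut.prems(1,2) and agree = leaf_wt_cut.prems(3)
  have "finite (dom C \<union> dom D)"
    using leaf_wt_ok [OF leaf_wt_cut.hyps(2)] leaf_wt_ok [OF leaf_wt_cut.hyps(3)] by (simp add: ok_def)
  then have "finite (\<pi> ` (dom C \<union> dom D) \<union> \<rho> ` (dom C \<union> dom D))" by blast
  then obtain \<delta> where \<delta>: "\<delta> \<notin> \<pi> ` (dom C \<union> dom D) \<union> \<rho> ` (dom C \<union> dom D)"
    using ex_new_if_finite [OF infinite_UNIV_nat] by blast
  \<comment> \<open>The renamings may disagree at the bound channel \<gamma>. Sending it to a common
    fresh \<delta> on both sides restores agreement on all channels of the subtrees, so that the
    induction hypotheses apply.\<close>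
  define \<pi>' \<rho>' where "\<pi>' = transpose (\<pi> \<gamma>) \<delta> \<circ> \<pi>" and "\<rho>' = transpose (\<rho> \<gamma>) \<delta> \<circ> \<rho>"
  have bij': "bij \<pi>'" "bij \<rho>'" using bij by (simp_all add: \<pi>'_def \<rho>'_def bij_comp)
  have fresh: "\<delta> \<notin> dom (act \<pi> C) \<union> dom (act \<pi> D)" "\<delta> \<notin> dom (act \<rho> C) \<union> dom (act \<rho> D)"
    using \<delta> bij by (auto simp: dom_act)
  have step: "leaf_eqv (act \<sigma> (join \<gamma> C D)) (ren_trm A \<sigma> (Cut \<gamma> a b)) (Cut \<delta>
      (ren_trm A (transpose (\<sigma> \<gamma>) \<delta> \<circ> \<sigma>) a) (ren_trm A (transpose (\<sigma> \<gamma>) \<delta> \<circ> \<sigma>) b))"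
    if "bij \<sigma>" "\<delta> \<notin> dom (act \<sigma> C) \<union> dom (act \<sigma> D)" for \<sigma>
    using leaf_eqv_alpha [OF act_cuttable [OF that(1) leaf_wt_cut.hyps(1)] leaf_wt_ren [OF leaf_wt_cut.hyps(2) that(1)]
        leaf_wt_ren [OF leaf_wt_cut.hyps(3) that(1)] that(2)] that(1) leaf_wt_cut.hyps
    by (simp add: act_join ren_trm_comp)
  have "\<gamma> \<in> dom C \<union> dom D" using leaf_wt_cut.hyps(1) by (auto simp: cuttable_def)
  have agree': "\<pi>' c = \<rho>' c" if "c \<in> dom C \<union> dom D" for c
  proof (cases "c = \<gamma>")
    case False
    then have "\<pi> c = \<rho> c" using that by (intro agree) (auto simp: dom_join)
    moreover have "\<pi> c \<noteq> \<pi> \<gamma>" "\<rho> c \<noteq> \<rho> \<gamma>" using False bij by (auto simp: bij_is_inj inj_eq)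
    moreover have "\<pi> c \<noteq> \<delta>" "\<rho> c \<noteq> \<delta>" using \<delta> that by auto
    ultimately show ?thesis by (simp add: \<pi>'_def \<rho>'_def transpose_def)
  qed (simp add: \<pi>'_def \<rho>'_def)
  have "\<pi>' \<gamma> = \<delta>" by (simp add: \<pi>'_def)
  then have "leaf_eqv (act \<pi>' (join \<gamma> C D)) (Cut \<delta> (ren_trm A \<pi>' a) (ren_trm A \<pi>' b))
      (Cut \<delta> (ren_trm A \<rho>' a) (ren_trm A \<rho>' b))"
    using leaf_eqv_cut [OF act_cuttable [OF bij'(1) leaf_wt_cut.hyps(1)] leaf_wt_cut.IH(1) [OF bij'] leaf_wt_cut.IH(2) [OF bij']]
      agree' bij' by (simp add: act_join)
  moreover have "act \<pi>' (join \<gamma> C D) = act \<pi> (join \<gamma> C D)"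
    using \<delta> bij bij' by (intro act_cong) (auto simp: \<pi>'_def dom_join transpose_def bij_is_inj inj_eq)
  moreover have "act \<rho> (join \<gamma> C D) = act \<pi> (join \<gamma> C D)"
    using bij agree by (intro act_cong) auto
  ultimately show ?case
    using step [OF bij(1) fresh(1)] step [OF bij(2) fresh(2)]
    unfolding \<pi>'_def [symmetric] \<rho>'_def [symmetric] by (metis leaf_eqv_sym leaf_eqv_trans)
qed

lemma eqv_wt: "eqv C m n \<Longrightarrow> wt C m \<and> wt C n"
proof (induction rule: eqv.induct)
  case (eqv_leaf C a b)
  then show ?case using leaf_eqv_leaf_wt wt_leaf by blast
next
  case (eqv_conv C \<alpha> v I \<beta> w J f)
  then show ?case using wt_exchange [OF eqv_conv] wt_exchange' [OF eqv_conv] by blast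
qed (auto intro: wt_node)

text \<open>The same formula with opposite signs: one of the two sets consists of all components,
  the other of a single one, so they meet in that one.\<close>

lemma branch_principal:
  assumes "cuttable s \<gamma> C D" "C \<gamma> = Some v" "D \<gamma> = Some w" "branch v I" "branch w J"
  obtains k where "I |\<inter>| J = {|k|}" "k |\<in>| I" "k |\<in>| J"
proof -
  obtain Z where "v = (s, Z)" "w = (\<not> s, Z)" using assms(1-3) by (auto simp: cuttable_def)
  then show thesis using assms(4,5) that by (cases Z; cases s) auto
qed

text \<open>The cases follow the evaluation of \<open>cut_nt\<close>.\<close>

lemma cut_induct [consumes 3, case_names leaf left right principal]:
  assumes "wt C m" "wt D n" "cuttable True \<gamma> C D"
    and leaf: "\<And>C D a b. \<lbrakk>cuttable True \<gamma> C D; leaf_wt C a; leaf_wt D b\<rbrakk> \<Longrightarrow> P C D (Leaf a) (Leaf b)"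
    and left: "\<And>C D \<alpha> v I f n. \<lbrakk>cuttable True \<gamma> C D; ok A C; C \<alpha> = Some v; branch v I; \<alpha> \<noteq> \<gamma>; wt D n;
        \<And>i. i |\<in>| I \<Longrightarrow> wt (C(\<alpha> \<mapsto> sub v i)) (f i); \<And>i. i |\<in>| I \<Longrightarrow> P (C(\<alpha> \<mapsto> sub v i)) D (f i) n\<rbrakk>
      \<Longrightarrow> P C D (Node \<alpha> (family I f)) n"
    and right: "\<And>C D \<beta> w J g m. \<lbrakk>cuttable True \<gamma> C D; ok A D; D \<beta> = Some w; branch w J; \<beta> \<noteq> \<gamma>; wt C m; heads \<gamma> m;
        \<And>j. j |\<in>| J \<Longrightarrow> wt (D(\<beta> \<mapsto> sub w j)) (g j); \<And>j. j |\<in>| J \<Longrightarrow> P C (D(\<beta> \<mapsto> sub w j)) m (g j)\<rbrakk>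
      \<Longrightarrow> P C D m (Node \<beta> (family J g))"
    and principal: "\<And>C D v w I J f g k. \<lbrakk>cuttable True \<gamma> C D; ok A C; ok A D; C \<gamma> = Some v; D \<gamma> = Some w;
        branch v I; branch w J; I |\<inter>| J = {|k|}; k |\<in>| I; k |\<in>| J;
        \<And>i. i |\<in>| I \<Longrightarrow> wt (C(\<gamma> \<mapsto> sub v i)) (f i); \<And>j. j |\<in>| J \<Longrightarrow> wt (D(\<gamma> \<mapsto> sub w j)) (g j);
        P (C(\<gamma> \<mapsto> sub v k)) (D(\<gamma> \<mapsto> sub w k)) (f k) (g k)\<rbrakk>
      \<Longrightarrow> P C D (Node \<gamma> (family I f)) (Node \<gamma> (family J g))"
  shows "P C D m n"
  using assms(1-3)
proof (induction arbitrary: D n rule: wt.induct)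
  case (wt_leaf C a)
  from wt_leaf.prems wt_leaf.hyps show ?case
  proof (induction rule: wt.induct)
    case (wt_leaf D b)
    then show ?case using leaf by blast
  next
    case (wt_node D \<beta> w J g)
    have "\<beta> \<noteq> \<gamma>"
    proof
      assume "\<beta> = \<gamma>"
      with wt_node obtain Z where "w = (False, Z)" "C \<gamma> = Some (True, Z)" by (auto simp: cuttable_def)
      then show False using leaf_wt_no_branch [of C a \<gamma> True Z False J] wt_node by simp
    qed
    show ?case
      by (rule right [OF wt_node.prems(1) wt_node.hyps(1-3) \<open>\<beta> \<noteq> \<gamma>\<close> wt.wt_leaf [OF wt_node.prems(2)] _ wt_node.hyps(4)],
          simp, assumption)
        (rule wt_node.IH [OF _ cuttable_upd_right [OF wt_node.prems(1) wt_node.hyps(2) \<open>\<beta> \<noteq> \<gamma>\<close>] wt_node.prems(2)])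
  qed
next
  case (wt_node C \<alpha> v I f)
  show ?case
  proof (cases "\<alpha> = \<gamma>")
    case False
    show ?thesis
      by (rule left [OF wt_node.prems(2) wt_node.hyps(1-3) False wt_node.prems(1) wt_node.hyps(4)], assumption)
        (rule wt_node.IH [OF _ wt_node.prems(1) cuttable_upd [OF wt_node.prems(2) wt_node.hyps(2) False]])
  next
    case True
    have wtm: "wt C (Node \<gamma> (family I f))" using wt_node True wt.wt_node by blast
    \<comment> \<open>The inner induction unfolds \<open>n\<close> while \<open>m\<close> waits at
      \<gamma>. The principal case returns to the outer hypothesis with a smaller \<open>m\<close>,
      which is why \<open>D\<close> and \<open>n\<close> are generalised there.\<close>
    from wt_node.prems show ?thesis
      unfolding True
    proof (induction rule: wt.induct)
      case (wt_leaf D b)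
      then obtain Z where "v = (True, Z)" "D \<gamma> = Some (False, Z)"
        using wt_node.hyps(2) True by (auto simp: cuttable_def)
      then show ?case using leaf_wt_no_branch [of D b \<gamma> False Z True I] wt_node.hyps(3) wt_leaf by simp
    next
      case (wt_node D \<beta> w J g)
      note n = wt_node and m = \<open>ok A C\<close> \<open>C \<alpha> = Some v\<close> \<open>branch v I\<close>
      show ?case
      proof (cases "\<beta> = \<gamma>")
        case False
        show ?thesis
          by (rule right [OF n(6) n(1-3) False wtm _ n(4)], simp, assumption)
            (rule n(5) [OF _ cuttable_upd_right [OF n(6) n(2) False]])
      next
        case \<beta>: True
        obtain k where k: "I |\<inter>| J = {|k|}" "k |\<in>| I" "k |\<in>| J"
          using branch_principal [of True \<gamma> C D v w I J] n(2,3,6) m True \<beta> by auto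
        have "cuttable True \<gamma> (C(\<gamma> \<mapsto> sub v k)) (D(\<gamma> \<mapsto> sub w k))"
          using cuttable_sub [OF n(6)] m(2) n(2) True \<beta> by blast
        then show ?thesis
          unfolding \<beta>
          using principal [of C D v w I J k f g] n k m True \<beta> \<open>wt C (Node \<gamma> (family I f))\<close>
            \<open>\<And>i. i |\<in>| I \<Longrightarrow> wt (C(\<alpha> \<mapsto> sub v i)) (f i)\<close>
            \<open>\<And>i D n. i |\<in>| I \<Longrightarrow> wt D n \<Longrightarrow> cuttable True \<gamma> (C(\<alpha> \<mapsto> sub v i)) D \<Longrightarrow> P (C(\<alpha> \<mapsto> sub v i)) D (f i) n\<close>
          by (simp del: fun_upd_apply)
      qed
    qed
  qed
qed

section \<open>Cuts of leaves\<close>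

lemma leaf_wt_AxD: "leaf_wt C (Ax f) \<Longrightarrow> C = actx A f \<and> f \<in> poly A"
  by (erule leaf_wt.cases) simp_all

lemma actx_idn:
  assumes "c \<in> obj A" "\<alpha> \<noteq> \<beta>"
  shows "actx A (idn A \<alpha> \<beta> c) = [\<alpha> \<mapsto> (False, Atom c), \<beta> \<mapsto> (True, Atom c)]"
  using idn_poly [OF assms] assms(2)
  by (intro ext) (simp add: actx_def ctx_def fun_upd_apply)

lemma act_transpose: "act (transpose a b) C c = C (transpose a b c)"
  by (simp add: act_def inv_transpose_eq)

text \<open>Joining with the identity removes \<gamma> and puts its formula at \<beta>. As \<beta>
  is not in \<open>C\<close>, this is what the transposition does.\<close>

lemma join_idn_right:
  assumes "c \<in> obj A" "\<gamma> \<noteq> \<beta>" "cuttable True \<gamma> C (actx A (idn A \<gamma> \<beta> c))"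
  shows "join \<gamma> C (actx A (idn A \<gamma> \<beta> c)) = act (transpose \<gamma> \<beta>) C"
proof (rule ext)
  fix x
  have D: "C \<gamma> = Some (True, Atom c)" "dom C \<inter> {\<gamma>, \<beta>} = {\<gamma>}"
    using assms by (auto simp: cuttable_def actx_idn fun_upd_apply)
  then have "C \<beta> = None" using assms(2) by (metis Int_iff domIff insertCI singletonD)
  then show "join \<gamma> C (actx A (idn A \<gamma> \<beta> c)) x = act (transpose \<gamma> \<beta>) C x"
    using D assms(1,2) by (auto simp: join_def act_transpose actx_idn transpose_def fun_upd_apply map_add_def)
qed

lemma join_idn_left:
  assumes "c \<in> obj A" "\<alpha> \<noteq> \<gamma>" "cuttable True \<gamma> (actx A (idn A \<alpha> \<gamma> c)) D"
  shows "join \<gamma> (actx A (idn A \<alpha> \<gamma> c)) D = act (transpose \<gamma> \<alpha>) D"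
proof (rule ext)
  fix x
  have D: "D \<gamma> = Some (False, Atom c)" "{\<gamma>, \<alpha>} \<inter> dom D = {\<gamma>}"
    using assms by (auto simp: cuttable_def actx_idn fun_upd_apply)
  then have "D \<alpha> = None" using assms(2) by (metis Int_iff domIff insertCI singletonD)
  then show "join \<gamma> (actx A (idn A \<alpha> \<gamma> c)) D x = act (transpose \<gamma> \<alpha>) D x"
    using D assms(1,2)
    by (auto simp: join_def act_transpose actx_idn transpose_def fun_upd_apply map_add_def split: option.split)
qed

lemma leaf_wt_leaf_cut:
  assumes "cuttable True \<gamma> C D" "leaf_wt C a" "leaf_wt D b"
  shows "leaf_wt (join \<gamma> C D) (leaf_cut \<gamma> a b)"
proof (cases rule: leaf_cut_cases [where \<gamma> = \<gamma> and a = a and b = b])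
  case (right \<beta>)
  then obtain c where c: "c \<in> obj A" "\<gamma> \<noteq> \<beta>" "b = Ax (idn A \<gamma> \<beta> c)" by (auto simp: is_idn_def)
  then have "D = actx A (idn A \<gamma> \<beta> c)" using assms(3) leaf_wt_AxD by blast
  then have eq: "join \<gamma> C D = act (transpose \<gamma> \<beta>) C"
    using join_idn_right [OF c(1,2), of C] assms(1) by simp
  then show ?thesis
    using leaf_wt_ren [OF assms(2)] by (simp add: eq leaf_cut_right [OF right])
next
  case (left \<alpha>)
  then obtain c where c: "c \<in> obj A" "\<alpha> \<noteq> \<gamma>" "a = Ax (idn A \<alpha> \<gamma> c)" by (auto simp: is_idn_def)
  then have "C = actx A (idn A \<alpha> \<gamma> c)" using assms(2) leaf_wt_AxD by blast
  then have eq: "join \<gamma> C D = act (transpose \<gamma> \<alpha>) D"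
    using join_idn_left [OF c(1,2), of D] assms(1) by simp
  then show ?thesis
    using leaf_wt_ren [OF assms(3)] by (simp add: eq leaf_cut_left [OF left])
next
  case cut
  then show ?thesis using leaf_wt_cut [OF assms] by (simp add: leaf_cut_cut)
qed

text \<open>Absorption of an identity is literally one of the two identity rewrites, so evaluating a
  cut of leaves takes at most one step.\<close>

lemma cut_rule_leaf_cut: "leaf_cut \<gamma> a b = Cut \<gamma> a b \<or> cut_rule A (Cut \<gamma> a b) (leaf_cut \<gamma> a b)"
proof (cases rule: leaf_cut_cases [where \<gamma> = \<gamma> and a = a and b = b])
  case (right \<beta>)
  then show ?thesis by (auto simp: leaf_cut_right [OF right] is_idn_def intro: cut_rule.id_right)
next
  case (left \<alpha>)
  then show ?thesis by (auto simp: leaf_cut_left [OF left] is_idn_def intro: cut_rule.id_left)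
qed (simp add: leaf_cut_cut)

text \<open>Conversion of leaves changes nothing outside cuts, so an axiom is equivalent only to
  itself. The tests for identities in \<open>leaf_cut\<close> are thereby invariant.\<close>

lemma leaf_eqv_Ax: "leaf_eqv C a b \<Longrightarrow> a = Ax f \<longleftrightarrow> b = Ax f"
  by (induction rule: leaf_eqv.induct) simp_all

lemma leaf_eqv_is_idn: "leaf_eqv C a b \<Longrightarrow> is_idn \<gamma> \<beta> a \<longleftrightarrow> is_idn \<gamma> \<beta> b"
  using leaf_eqv_Ax unfolding is_idn_def by metis

lemma leaf_eqv_leaf_cut_left:
  assumes "cuttable True \<gamma> C D" "leaf_eqv C a a'" "leaf_wt D b"
  shows "leaf_eqv (join \<gamma> C D) (leaf_cut \<gamma> a b) (leaf_cut \<gamma> a' b)"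
proof (cases rule: leaf_cut_cases [where \<gamma> = \<gamma> and a = a and b = b])
  case (right \<beta>)
  then obtain c where c: "c \<in> obj A" "\<gamma> \<noteq> \<beta>" "b = Ax (idn A \<gamma> \<beta> c)" by (auto simp: is_idn_def)
  then have "D = actx A (idn A \<gamma> \<beta> c)" using assms(3) leaf_wt_AxD by blast
  then have eq: "join \<gamma> C D = act (transpose \<gamma> \<beta>) C"
    using join_idn_right [OF c(1,2), of C] assms(1) by simp
  then show ?thesis
    using leaf_eqv_ren [OF assms(2)] by (simp add: eq leaf_cut_right [OF right])
next
  case (left \<alpha>)
  then have "a' = a" using assms(2) leaf_eqv_Ax unfolding is_idn_def by metis
  then show ?thesis using leaf_wt_leaf_cut leaf_eqv_leaf_wt assms leaf_eqv_refl by blast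
next
  case cut
  then have "\<nexists>\<alpha>. is_idn \<alpha> \<gamma> a'" using leaf_eqv_is_idn [OF assms(2)] by blast
  then show ?thesis using cut assms by (simp add: leaf_cut_cut leaf_eqv_cut leaf_eqv_refl)
qed

lemma leaf_eqv_leaf_cut_right:
  assumes "cuttable True \<gamma> C D" "leaf_wt C a" "leaf_eqv D b b'"
  shows "leaf_eqv (join \<gamma> C D) (leaf_cut \<gamma> a b) (leaf_cut \<gamma> a b')"
proof (cases rule: leaf_cut_cases [where \<gamma> = \<gamma> and a = a and b = b])
  case (right \<beta>)
  then have "b' = b" using assms(3) leaf_eqv_Ax unfolding is_idn_def by metis
  then show ?thesis using leaf_wt_leaf_cut leaf_eqv_leaf_wt assms leaf_eqv_refl by blast
next
  case (left \<alpha>)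
  then obtain c where c: "c \<in> obj A" "\<alpha> \<noteq> \<gamma>" "a = Ax (idn A \<alpha> \<gamma> c)" by (auto simp: is_idn_def)
  then have "C = actx A (idn A \<alpha> \<gamma> c)" using assms(2) leaf_wt_AxD by blast
  then have eq: "join \<gamma> C D = act (transpose \<gamma> \<alpha>) D"
    using join_idn_left [OF c(1,2), of D] assms(1) by simp
  have "\<nexists>\<beta>. is_idn \<gamma> \<beta> b'" using left leaf_eqv_is_idn [OF assms(3)] by blast
  then show ?thesis
    using leaf_eqv_ren [OF assms(3)] left by (simp add: eq leaf_cut_left)
next
  case cut
  then have "\<nexists>\<beta>. is_idn \<gamma> \<beta> b'" using leaf_eqv_is_idn [OF assms(3)] by blast
  then show ?thesis using cut assms by (simp add: leaf_cut_cut leaf_eqv_cut leaf_eqv_refl)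
qed

lemma is_idn_ren:
  assumes "leaf_wt C a" "bij \<pi>"
  shows "is_idn (\<pi> \<gamma>) (\<pi> \<beta>) (ren_trm A \<pi> a) \<longleftrightarrow> is_idn \<gamma> \<beta> a"
proof
  assume "is_idn \<gamma> \<beta> a"
  then show "is_idn (\<pi> \<gamma>) (\<pi> \<beta>) (ren_trm A \<pi> a)"
    using assms(2) by (auto simp: is_idn_def ren_idn bij_is_inj inj_eq)
next
  assume "is_idn (\<pi> \<gamma>) (\<pi> \<beta>) (ren_trm A \<pi> a)"
  then obtain c where c: "\<gamma> \<noteq> \<beta>" "c \<in> obj A" "ren_trm A \<pi> a = Ax (idn A (\<pi> \<gamma>) (\<pi> \<beta>) c)"
    by (auto simp: is_idn_def)
  then obtain f where f: "a = Ax f" "ren A \<pi> f = idn A (\<pi> \<gamma>) (\<pi> \<beta>) c"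
    by (cases a) auto
  then have poly: "f \<in> poly A" using assms(1) leaf_wt_AxD by blast
  have "f = ren A (inv \<pi> \<circ> \<pi>) f"
    using ren_id [OF poly] assms(2) by (simp add: bij_is_inj)
  also have "\<dots> = ren A (inv \<pi>) (idn A (\<pi> \<gamma>) (\<pi> \<beta>) c)"
    using f(2) poly assms(2) by (simp add: ren_comp bij_imp_bij_inv)
  also have "\<dots> = idn A \<gamma> \<beta> c"
    using c assms(2) by (simp add: ren_idn bij_imp_bij_inv bij_is_inj inj_eq)
  finally show "is_idn \<gamma> \<beta> a" using f(1) c by (auto simp: is_idn_def)
qed

lemma leaf_cut_ren:
  assumes "leaf_wt C a" "leaf_wt D b" "bij \<pi>"
  shows "leaf_cut (\<pi> \<gamma>) (ren_trm A \<pi> a) (ren_trm A \<pi> b) = ren_trm A \<pi> (leaf_cut \<gamma> a b)"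
proof (cases rule: leaf_cut_cases [where \<gamma> = \<gamma> and a = a and b = b])
  case (right \<beta>)
  then have "is_idn (\<pi> \<gamma>) (\<pi> \<beta>) (ren_trm A \<pi> b)" using is_idn_ren [OF assms(2,3)] by blast
  then show ?thesis
    using ren_trm_comp [OF assms(1)] assms(3)
    by (simp add: leaf_cut_right [OF right] leaf_cut_right transpose_comp_bij)
next
  case (left \<alpha>)
  have "\<nexists>\<beta>. is_idn (\<pi> \<gamma>) \<beta> (ren_trm A \<pi> b)"
  proof
    assume "\<exists>\<beta>. is_idn (\<pi> \<gamma>) \<beta> (ren_trm A \<pi> b)"
    then obtain \<beta> where "is_idn (\<pi> \<gamma>) (\<pi> (inv \<pi> \<beta>)) (ren_trm A \<pi> b)"
      using assms(3) by (auto simp: bij_is_surj surj_f_inv_f)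
    then show False using is_idn_ren [OF assms(2,3)] left by blast
  qed
  moreover have "is_idn (\<pi> \<alpha>) (\<pi> \<gamma>) (ren_trm A \<pi> a)" using left is_idn_ren [OF assms(1,3)] by blast
  ultimately show ?thesis
    using ren_trm_comp [OF assms(2)] assms(3)
    by (simp add: leaf_cut_left [OF left] leaf_cut_left transpose_comp_bij)
next
  case cut
  have "\<nexists>\<beta>. is_idn (\<pi> \<gamma>) \<beta> (ren_trm A \<pi> b)"
  proof
    assume "\<exists>\<beta>. is_idn (\<pi> \<gamma>) \<beta> (ren_trm A \<pi> b)"
    then obtain \<beta> where "is_idn (\<pi> \<gamma>) (\<pi> (inv \<pi> \<beta>)) (ren_trm A \<pi> b)"
      using assms(3) by (auto simp: bij_is_surj surj_f_inv_f)
    then show False using is_idn_ren [OF assms(2,3)] cut by blast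
  qed
  moreover have "\<nexists>\<alpha>. is_idn \<alpha> (\<pi> \<gamma>) (ren_trm A \<pi> a)"
  proof
    assume "\<exists>\<alpha>. is_idn \<alpha> (\<pi> \<gamma>) (ren_trm A \<pi> a)"
    then obtain \<alpha> where "is_idn (\<pi> (inv \<pi> \<alpha>)) (\<pi> \<gamma>) (ren_trm A \<pi> a)"
      using assms(3) by (auto simp: bij_is_surj surj_f_inv_f)
    then show False using is_idn_ren [OF assms(1,3)] cut by blast
  qed
  ultimately show ?thesis using cut by (simp add: leaf_cut_cut)
qed

section \<open>Typing and renaming of cuts of normal forms\<close>

lemma wt_cut_nt: "wt C m \<Longrightarrow> wt D n \<Longrightarrow> cuttable True \<gamma> C D \<Longrightarrow> wt (join \<gamma> C D) (cut_nt \<gamma> m n)"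
proof (induction rule: cut_induct)
  case (leaf C D a b)
  then show ?case by (simp add: cut_nt_leaf leaf_wt_leaf_cut wt_leaf)
next
  case (left C D \<alpha> v I f n)
  have "wt ((join \<gamma> C D)(\<alpha> \<mapsto> sub v i)) (cut_nt \<gamma> (f i) n)" if "i |\<in>| I" for i
    using left(8) [OF that] join_upd [OF left(1,3,5)] by simp
  moreover have "join \<gamma> C D \<alpha> = Some v" by (rule join_left [OF left(1,3,5)])
  ultimately show ?case
    using wt_node [OF ok_join [OF left(2) wt_ok [OF left(6)]] _ left(4)] left(5)
    by (simp add: cut_nt_left)
next
  case (right C D \<beta> w J g m)
  have "wt ((join \<gamma> C D)(\<beta> \<mapsto> sub w j)) (cut_nt \<gamma> m (g j))" if "j |\<in>| J" for j
    using right(9) [OF that] join_upd_right [OF right(1,3,5)] by simp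
  moreover have "join \<gamma> C D \<beta> = Some w" by (rule join_right) (rule right(3,5))+
  ultimately show ?case
    using wt_node [OF ok_join [OF wt_ok [OF right(6)] right(2)] _ right(4)] right(5,7)
    by (simp add: cut_nt_right)
next
  case (principal C D v w I J f g k)
  then show ?case by (simp add: cut_nt_principal join_sub)
qed

text \<open>A bijective renaming preserves every test made by \<open>cut_nt\<close>: whether a root
  is the cut channel, and whether a leaf is an identity at it.\<close>

lemma cut_nt_ren:
  "wt C m \<Longrightarrow> wt D n \<Longrightarrow> cuttable True \<gamma> C D \<Longrightarrow> bij \<pi> \<Longrightarrow>
    cut_nt (\<pi> \<gamma>) (ren_nt A \<pi> m) (ren_nt A \<pi> n) = ren_nt A \<pi> (cut_nt \<gamma> m n)"
proof (induction rule: cut_induct)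
  case (leaf C D a b)
  then show ?case by (simp add: cut_nt_leaf leaf_cut_ren)
next
  case (left C D \<alpha> v I f n)
  then have "\<pi> \<alpha> \<noteq> \<pi> \<gamma>" by (simp add: bij_is_inj inj_eq)
  then show ?case using left by (simp add: cut_nt_left family_eq_iff)
next
  case (right C D \<beta> w J g m)
  then have "\<pi> \<beta> \<noteq> \<pi> \<gamma>" by (simp add: bij_is_inj inj_eq)
  moreover have "heads (\<pi> \<gamma>) (ren_nt A \<pi> m)" using right(7) by (cases m) auto
  ultimately show ?case using right by (simp add: cut_nt_right family_eq_iff)
next
  case (principal C D v w I J f g k)
  then show ?case by (simp add: cut_nt_principal)
qed

lemma ren_trm_id: "leaf_wt C a \<Longrightarrow> ren_trm A id a = a"
  by (induction rule: leaf_wt.induct) (simp_all add: ren_id [unfolded id_def] id_def)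

text \<open>Root channels of nodes belong to the sequent and stay fixed. What changes are bound
  channels in leaves, and \<open>leaf_eqv_ren_cong\<close> absorbs these.\<close>

lemma eqv_ren:
  "wt C n \<Longrightarrow> bij \<pi> \<Longrightarrow> (\<And>c. c \<in> dom C \<Longrightarrow> \<pi> c = c) \<Longrightarrow> eqv C n (ren_nt A \<pi> n)"
proof (induction rule: wt.induct)
  case (wt_leaf C a)
  then show ?case
    using leaf_eqv_ren_cong [OF wt_leaf(1), of id \<pi>] ren_trm_id [OF wt_leaf(1)] act_id [of id C]
    by (simp add: eqv_leaf)
next
  case (wt_node C \<alpha> v I f)
  have "\<pi> \<alpha> = \<alpha>" using wt_node.hyps(2) wt_node.prems(2) by blast
  moreover have "eqv (C(\<alpha> \<mapsto> sub v i)) (f i) (ren_nt A \<pi> (f i))" if "i |\<in>| I" for i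
    using wt_node.IH [OF that wt_node.prems(1)] wt_node.prems(2) wt_node.hyps(2)
    by (metis dom_fun_upd domI insert_absorb option.distinct(1))
  ultimately show ?case using eqv_node [OF wt_node.hyps(1-3)] by simp
qed

section \<open>Moving nodes out of a cut\<close>

lemma eqv_node_left:
  assumes "cuttable s \<gamma> C D" "ok A C" "ok A D" "C \<alpha> = Some v" "branch v I" "\<alpha> \<noteq> \<gamma>"
    and "\<And>i. i |\<in>| I \<Longrightarrow> eqv (join \<gamma> (C(\<alpha> \<mapsto> sub v i)) D) (p i) (q i)"
  shows "eqv (join \<gamma> C D) (Node \<alpha> (family I p)) (Node \<alpha> (family I q))"
proof (rule eqv_node)
  show "join \<gamma> C D \<alpha> = Some v" by (rule join_left [OF assms(1,4,6)])
  show "eqv ((join \<gamma> C D)(\<alpha> \<mapsto> sub v i)) (p i) (q i)" if "i |\<in>| I" for i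
    using assms(7) [OF that] by (simp add: join_upd [OF assms(1,4,6)])
qed (use assms in \<open>simp_all add: ok_join\<close>)

lemma eqv_node_right:
  assumes "cuttable s \<gamma> C D" "ok A C" "ok A D" "D \<beta> = Some w" "branch w J" "\<beta> \<noteq> \<gamma>"
    and "\<And>j. j |\<in>| J \<Longrightarrow> eqv (join \<gamma> C (D(\<beta> \<mapsto> sub w j))) (p j) (q j)"
  shows "eqv (join \<gamma> C D) (Node \<beta> (family J p)) (Node \<beta> (family J q))"
proof -
  have "join \<gamma> (D(\<beta> \<mapsto> sub w j)) C = join \<gamma> C (D(\<beta> \<mapsto> sub w j))" for j
    using cuttable_join_commute [OF cuttable_upd_right [OF assms(1,4,6)]] by simp
  then show ?thesis
    using eqv_node_left [of "\<not> s" \<gamma> D C \<beta> w J p q] cuttable_commute [OF assms(1)] assms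
      cuttable_join_commute [OF assms(1)]
    by simp
qed

text \<open>Exchange of a node coming from one half of a cut with a node from the other. The roots
  are distinct because the two contexts share only \<gamma>.\<close>

lemma eqv_conv_join:
  assumes "cuttable s \<gamma> C D" "ok A C" "ok A D" "C \<alpha> = Some v" "branch v I" "\<alpha> \<noteq> \<gamma>"
    and "D \<beta> = Some w" "branch w J" "\<beta> \<noteq> \<gamma>"
    and "\<And>i j. i |\<in>| I \<Longrightarrow> j |\<in>| J \<Longrightarrow> wt (join \<gamma> (C(\<alpha> \<mapsto> sub v i)) (D(\<beta> \<mapsto> sub w j))) (f i j)"
  shows "eqv (join \<gamma> C D) (Node \<alpha> (family I (\<lambda>i. Node \<beta> (family J (f i)))))
    (Node \<beta> (family J (\<lambda>j. Node \<alpha> (family I (\<lambda>i. f i j)))))"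
proof (rule eqv_conv)
  show "join \<gamma> C D \<alpha> = Some v" by (rule join_left [OF assms(1,4,6)])
  show "join \<gamma> C D \<beta> = Some w" by (rule join_right) (rule assms(7,9))+
  show "\<alpha> \<noteq> \<beta>" using cuttable_notin [OF assms(1,4,6)] assms(7) by auto
  show "wt ((join \<gamma> C D)(\<alpha> \<mapsto> sub v i, \<beta> \<mapsto> sub w j)) (f i j)" if "i |\<in>| I" "j |\<in>| J" for i j
    using assms(10) [OF that] join_upd_right [OF cuttable_upd [OF assms(1,4,6)] assms(7,9)]
      join_upd [OF assms(1,4,6)]
    by simp
qed (use assms in \<open>simp_all add: ok_join\<close>)

text \<open>Repairs the left bias of \<open>cut_nt\<close>. If the root of \<open>m\<close> is not
  \<gamma>, it is produced first, the induction hypothesis brings out \<beta> below it, and one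
  exchange puts \<beta> on top; otherwise the claim is a defining equation.\<close>

lemma cut_nt_node_right:
  "wt C m \<Longrightarrow> cuttable True \<gamma> C D \<Longrightarrow> ok A D \<Longrightarrow> D \<beta> = Some w \<Longrightarrow> branch w J \<Longrightarrow> \<beta> \<noteq> \<gamma> \<Longrightarrow>
    (\<And>j. j |\<in>| J \<Longrightarrow> wt (D(\<beta> \<mapsto> sub w j)) (g j)) \<Longrightarrow>
    eqv (join \<gamma> C D) (cut_nt \<gamma> m (Node \<beta> (family J g))) (Node \<beta> (family J (\<lambda>j. cut_nt \<gamma> m (g j))))"
proof (induction rule: wt.induct)
  case (wt_leaf C a)
  have "wt D (Node \<beta> (family J g))" by (rule wt_node) (use wt_leaf in auto)
  then have "wt (join \<gamma> C D) (cut_nt \<gamma> (Leaf a) (Node \<beta> (family J g)))"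
    using wt_cut_nt wt.wt_leaf wt_leaf by blast
  from eqv_refl [OF this] show ?case using wt_leaf.prems by (simp add: cut_nt_right)
next
  case (wt_node C \<alpha> v I f)
  note cuttable = wt_node.prems(1) and D = wt_node.prems(2-5) and g = wt_node.prems(6) and C = wt_node.hyps(1-3)
  have n: "wt D (Node \<beta> (family J g))" by (rule wt.wt_node [OF D(1-3) g])
  have m: "wt C (Node \<alpha> (family I f))" by (rule wt.wt_node [OF C wt_node.hyps(4)])
  show ?case
  proof (cases "\<alpha> = \<gamma>")
    case True
    then show ?thesis using eqv_refl [OF wt_cut_nt [OF m n cuttable]] D(4) by (simp add: cut_nt_right)
  next
    case False
    have "eqv (join \<gamma> C D) (Node \<alpha> (family I (\<lambda>i. cut_nt \<gamma> (f i) (Node \<beta> (family J g)))))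
        (Node \<alpha> (family I (\<lambda>i. Node \<beta> (family J (\<lambda>j. cut_nt \<gamma> (f i) (g j))))))"
      by (rule eqv_node_left [OF cuttable C(1) D(1) C(2,3) False])
        (rule wt_node.IH [OF _ cuttable_upd [OF cuttable C(2) False] D g])
    also have "eqv (join \<gamma> C D) \<dots>
        (Node \<beta> (family J (\<lambda>j. Node \<alpha> (family I (\<lambda>i. cut_nt \<gamma> (f i) (g j))))))"
      by (rule eqv_conv_join [OF cuttable C(1) D(1) C(2,3) False D(2-4)])
        (rule wt_cut_nt [OF wt_node.hyps(4) g cuttable_upd_right [OF cuttable_upd [OF cuttable C(2) False] D(2,4)]])
    finally show ?thesis using False by (simp add: cut_nt_left)
  qed
qed

text \<open>With the sign of the cut channel as a parameter, the two arguments of a cut become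
  interchangeable, so that congruence has to be shown for one of them only.\<close>

definition signed_cut :: "bool \<Rightarrow> channel \<Rightarrow> ('o, 'm, 'n) nt \<Rightarrow> ('o, 'm, 'n) nt \<Rightarrow> ('o, 'm, 'n) nt" where
  "signed_cut s \<gamma> m n = (if s then cut_nt \<gamma> m n else cut_nt \<gamma> n m)"

lemma signed_cut_commute: "signed_cut (\<not> s) \<gamma> n m = signed_cut s \<gamma> m n"
  by (simp add: signed_cut_def)

lemma wt_signed_cut:
  assumes "cuttable s \<gamma> C D" "wt C m" "wt D n"
  shows "wt (join \<gamma> C D) (signed_cut s \<gamma> m n)"
proof (cases s)
  case True
  then show ?thesis using wt_cut_nt [of C m D n \<gamma>] assms by (simp add: signed_cut_def)
next
  case False
  then show ?thesis
    using wt_cut_nt [of D n C m \<gamma>] assms cuttable_commute [OF assms(1)] cuttable_join_commute [OF assms(1)]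
    by (simp add: signed_cut_def)
qed

text \<open>For \<open>s = True\<close> this is a defining equation of \<open>cut_nt\<close>, for
  \<open>s = False\<close> it is \<open>cut_nt_node_right\<close>. With this lemma the arguments
  below need not distinguish the two halves of a cut.\<close>

lemma signed_cut_node:
  assumes "cuttable s \<gamma> C D" "wt D n" "ok A C" "C \<alpha> = Some v" "branch v I" "\<alpha> \<noteq> \<gamma>"
    and "\<And>i. i |\<in>| I \<Longrightarrow> wt (C(\<alpha> \<mapsto> sub v i)) (f i)"
  shows "eqv (join \<gamma> C D) (signed_cut s \<gamma> (Node \<alpha> (family I f)) n) (Node \<alpha> (family I (\<lambda>i. signed_cut s \<gamma> (f i) n)))"
proof (cases s)
  case True
  have "wt C (Node \<alpha> (family I f))" by (rule wt_node [OF assms(3-5,7)])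
  from eqv_refl [OF wt_signed_cut [OF assms(1) this assms(2)]] show ?thesis
    using True assms(6) by (simp add: signed_cut_def cut_nt_left)
next
  case False
  have "cuttable True \<gamma> D C" using cuttable_commute [OF assms(1)] False by simp
  from cut_nt_node_right [OF assms(2) this assms(3-7)]
  show ?thesis using cuttable_join_commute [OF assms(1)] False by (simp add: signed_cut_def)
qed

lemma signed_cut_node_right:
  assumes "cuttable s \<gamma> C D" "wt C m" "ok A D" "D \<beta> = Some w" "branch w J" "\<beta> \<noteq> \<gamma>"
    and "\<And>j. j |\<in>| J \<Longrightarrow> wt (D(\<beta> \<mapsto> sub w j)) (g j)"
  shows "eqv (join \<gamma> C D) (signed_cut s \<gamma> m (Node \<beta> (family J g))) (Node \<beta> (family J (\<lambda>j. signed_cut s \<gamma> m (g j))))"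
  using signed_cut_node [OF cuttable_commute [OF assms(1)] assms(2-7)]
  by (simp only: signed_cut_commute cuttable_join_commute [OF assms(1)])

lemma signed_cut_principal:
  "I |\<inter>| J = {|k|} \<Longrightarrow>
    signed_cut s \<gamma> (Node \<gamma> (family I f)) (Node \<gamma> (family J g)) = signed_cut s \<gamma> (f k) (g k)"
  by (simp add: signed_cut_def cut_nt_principal inf_commute)

lemma cuttable_no_branch:
  assumes "cuttable s \<gamma> C D" "C \<gamma> = Some v" "branch v I" "leaf_wt D b"
  shows False
proof -
  obtain Z where "v = (s, Z)" "D \<gamma> = Some (\<not> s, Z)" using assms(1,2) by (auto simp: cuttable_def)
  then show False using leaf_wt_no_branch [OF assms(4), of \<gamma> "\<not> s" Z s I] assms(3) by simp
qed

text \<open>The critical instance of a conversion: an exchange of \<beta> with the cut channel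
  itself. The \<gamma>-node has to wait for its partner, so the induction is on the other argument
  \<open>n\<close>.\<close>

lemma signed_cut_exchange:
  assumes "wt D n" "cuttable s \<gamma> C D" "ok A C" "C \<gamma> = Some v" "branch v I" "C \<beta> = Some w" "branch w J" "\<gamma> \<noteq> \<beta>"
    and "\<And>i j. i |\<in>| I \<Longrightarrow> j |\<in>| J \<Longrightarrow> wt (C(\<gamma> \<mapsto> sub v i, \<beta> \<mapsto> sub w j)) (f i j)"
  shows "eqv (join \<gamma> C D) (signed_cut s \<gamma> (Node \<gamma> (family I (\<lambda>i. Node \<beta> (family J (f i))))) n)
    (Node \<beta> (family J (\<lambda>j. signed_cut s \<gamma> (Node \<gamma> (family I (\<lambda>i. f i j))) n)))"
  using assms(1,2)
proof (induction rule: wt.induct)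
  case (wt_leaf D b)
  then show ?case using cuttable_no_branch [OF wt_leaf(2) assms(4,5)] by blast
next
  case (wt_node D \<delta> u K g)
  note C = assms(3-9) and D = wt_node.hyps(1-3) and g = wt_node.hyps(4) and cuttable = wt_node.prems
  let ?m = "Node \<gamma> (family I (\<lambda>i. Node \<beta> (family J (f i))))"
  let ?m' = "\<lambda>j. Node \<gamma> (family I (\<lambda>i. f i j))"
  have m: "wt C ?m" by (rule wt_exchange [OF C])
  have m': "wt (C(\<beta> \<mapsto> sub w j)) (?m' j)" if "j |\<in>| J" for j
  proof (rule wt.wt_node)
    show "ok A (C(\<beta> \<mapsto> sub w j))" by (rule ok_sub [OF C(1,4,5) that])
    show "(C(\<beta> \<mapsto> sub w j)) \<gamma> = Some v" using C(2,6) by simp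
    show "wt (C(\<beta> \<mapsto> sub w j, \<gamma> \<mapsto> sub v i)) (f i j)" if "i |\<in>| I" for i
      using C(7) [OF that \<open>j |\<in>| J\<close>] C(6) by (simp add: fun_upd_twist)
  qed (rule C(3))
  have n: "wt D (Node \<delta> (family K g))" by (rule wt.wt_node [OF D g])
  note \<beta> = not_sym [OF C(6)]
  show ?case
  proof (cases "\<delta> = \<gamma>")
    case False
    \<comment> \<open>Bring \<delta> out of \<open>n\<close>, use the induction hypothesis below it,
      exchange \<delta> with \<beta>, and put \<delta> back into the cut.\<close>
    have "eqv (join \<gamma> C D) (signed_cut s \<gamma> ?m (Node \<delta> (family K g))) (Node \<delta> (family K (\<lambda>k. signed_cut s \<gamma> ?m (g k))))"
      by (rule signed_cut_node_right [OF cuttable m D False g])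
    also have "eqv (join \<gamma> C D) \<dots> (Node \<delta> (family K (\<lambda>k. Node \<beta> (family J (\<lambda>j. signed_cut s \<gamma> (?m' j) (g k))))))"
      by (rule eqv_node_right [OF cuttable C(1) D False])
        (rule wt_node.IH [OF _ cuttable_upd_right [OF cuttable D(2) False]])
    also have "eqv (join \<gamma> C D) \<dots> (Node \<beta> (family J (\<lambda>j. Node \<delta> (family K (\<lambda>k. signed_cut s \<gamma> (?m' j) (g k))))))"
      by (rule eqv_sym, rule eqv_conv_join [OF cuttable C(1) D(1) C(4,5) \<beta> D(2,3) False])
        (rule wt_signed_cut [OF cuttable_upd_right [OF cuttable_upd [OF cuttable C(4) \<beta>] D(2) False] m' g])
    also have "eqv (join \<gamma> C D) \<dots> (Node \<beta> (family J (\<lambda>j. signed_cut s \<gamma> (?m' j) (Node \<delta> (family K g)))))"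
      by (rule eqv_node_left [OF cuttable C(1) D(1) C(4,5) \<beta>], rule eqv_sym)
        (rule signed_cut_node_right [OF cuttable_upd [OF cuttable C(4) \<beta>] m' D False g])
    finally show ?thesis .
  next
    case True
    note D' = D [unfolded True] and g' = g [unfolded True]
    \<comment> \<open>Both sides cancel at \<gamma>: on the left this uncovers the \<beta>-node of
      branch \<open>k\<close>, and the cut moves past it; on the right it happens below the
      \<beta>-node.\<close>
    obtain k where k: "I |\<inter>| K = {|k|}" "k |\<in>| I" "k |\<in>| K"
      by (rule branch_principal [OF cuttable C(2) D'(2) C(3) D'(3)])
    have "ok A (C(\<gamma> \<mapsto> sub v k))" by (rule ok_sub [OF C(1-3) k(2)])
    moreover have "(C(\<gamma> \<mapsto> sub v k)) \<beta> = Some w" using C(4,6) by simp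
    ultimately have "eqv (join \<gamma> (C(\<gamma> \<mapsto> sub v k)) (D(\<gamma> \<mapsto> sub u k)))
        (signed_cut s \<gamma> (Node \<beta> (family J (f k))) (g k)) (Node \<beta> (family J (\<lambda>j. signed_cut s \<gamma> (f k j) (g k))))"
      by (rule signed_cut_node [OF cuttable_sub [OF cuttable C(2) D'(2)] g' [OF k(3)] _ _ C(5) \<beta> C(7) [OF k(2)]])
    then show ?thesis unfolding True by (simp add: signed_cut_principal k(1) join_sub)
  qed
qed

lemma signed_cut_node2:
  assumes "wt D n" "cuttable s \<gamma> C D" "ok A C" "C \<alpha> = Some v" "branch v I" "C \<beta> = Some w" "branch w J"
    and "\<alpha> \<noteq> \<beta>" "\<alpha> \<noteq> \<gamma>" "\<beta> \<noteq> \<gamma>"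
    and "\<And>i j. i |\<in>| I \<Longrightarrow> j |\<in>| J \<Longrightarrow> wt (C(\<alpha> \<mapsto> sub v i, \<beta> \<mapsto> sub w j)) (f i j)"
  shows "eqv (join \<gamma> C D) (signed_cut s \<gamma> (Node \<alpha> (family I (\<lambda>i. Node \<beta> (family J (f i))))) n)
    (Node \<alpha> (family I (\<lambda>i. Node \<beta> (family J (\<lambda>j. signed_cut s \<gamma> (f i j) n)))))"
proof -
  note D = wt_ok [OF assms(1)]
  have ok: "ok A (C(\<alpha> \<mapsto> sub v i))" if "i |\<in>| I" for i by (rule ok_sub [OF assms(3-5) that])
  have \<beta>: "(C(\<alpha> \<mapsto> sub v i)) \<beta> = Some w" for i using assms(6,8) by simp
  have "wt (C(\<alpha> \<mapsto> sub v i)) (Node \<beta> (family J (f i)))" if "i |\<in>| I" for i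
    by (rule wt_node [OF ok [OF that] \<beta> assms(7) assms(11) [OF that]])
  then have "eqv (join \<gamma> C D) (signed_cut s \<gamma> (Node \<alpha> (family I (\<lambda>i. Node \<beta> (family J (f i))))) n)
    (Node \<alpha> (family I (\<lambda>i. signed_cut s \<gamma> (Node \<beta> (family J (f i))) n)))"
    by (rule signed_cut_node [OF assms(2,1,3-5,9)])
  also have "eqv (join \<gamma> C D) \<dots> (Node \<alpha> (family I (\<lambda>i. Node \<beta> (family J (\<lambda>j. signed_cut s \<gamma> (f i j) n)))))"
  proof (rule eqv_node_left [OF assms(2,3) D assms(4,5,9)])
    fix i assume i: "i |\<in>| I"
    show "eqv (join \<gamma> (C(\<alpha> \<mapsto> sub v i)) D) (signed_cut s \<gamma> (Node \<beta> (family J (f i))) n)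
        (Node \<beta> (family J (\<lambda>j. signed_cut s \<gamma> (f i j) n)))"
      by (rule signed_cut_node [OF cuttable_upd [OF assms(2,4,9)] assms(1) ok [OF i] \<beta> assms(7,10) assms(11) [OF i]])
  qed
  finally show ?thesis .
qed

lemma leaf_eqv_leaf_signed_cut:
  assumes "cuttable s \<gamma> C D" "leaf_eqv C a a'" "leaf_wt D b"
  shows "eqv (join \<gamma> C D) (signed_cut s \<gamma> (Leaf a) (Leaf b)) (signed_cut s \<gamma> (Leaf a') (Leaf b))"
proof (cases s)
  case True
  then show ?thesis using leaf_eqv_leaf_cut_left [of \<gamma> C D a a' b] assms by (simp add: signed_cut_def cut_nt_leaf eqv_leaf)
next
  case False
  then show ?thesis
    using leaf_eqv_leaf_cut_right [of \<gamma> D C b a a'] cuttable_commute [OF assms(1)] cuttable_join_commute [OF assms(1)] assms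
    by (simp add: signed_cut_def cut_nt_leaf eqv_leaf)
qed

text \<open>Induction on the conversion, with the other argument arbitrary. A root other than
  \<gamma> lets the cut pass by \<open>signed_cut_node\<close>; a leaf or a root \<gamma> requires
  unfolding \<open>n\<close> by an inner induction.\<close>

lemma eqv_signed_cut:
  "eqv C m m' \<Longrightarrow> cuttable s \<gamma> C D \<Longrightarrow> wt D n \<Longrightarrow> eqv (join \<gamma> C D) (signed_cut s \<gamma> m n) (signed_cut s \<gamma> m' n)"
proof (induction arbitrary: D n rule: eqv.induct)
  case (eqv_refl C m)
  then show ?case using eqv.eqv_refl wt_signed_cut by blast
next
  case (eqv_sym C m m')
  then show ?case using eqv.eqv_sym by blast
next
  case (eqv_trans C l m n)
  then show ?case using eqv.eqv_trans by blast
next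
  case (eqv_leaf C a a')
  note leaf_eqv = eqv_leaf.hyps
  then have leaf_wt: "leaf_wt C a" "leaf_wt C a'" using leaf_eqv_leaf_wt by blast+
  from eqv_leaf.prems(2,1) show ?case
  proof (induction rule: wt.induct)
    case (wt_leaf D b)
    then show ?case using leaf_eqv_leaf_signed_cut leaf_eqv by blast
  next
    case (wt_node D \<beta> w J g)
    note D = wt_node.hyps(1-3) and g = wt_node.hyps(4) and cuttable = wt_node.prems
    have \<beta>: "\<beta> \<noteq> \<gamma>"
    proof
      assume \<beta>: "\<beta> = \<gamma>"
      show False by (rule cuttable_no_branch [OF cuttable_commute [OF cuttable] D(2) [unfolded \<beta>] D(3) leaf_wt(1)])
    qed
    note R = signed_cut_node_right [OF cuttable _ D \<beta> g]
    have "eqv (join \<gamma> C D) (signed_cut s \<gamma> (Leaf a) (Node \<beta> (family J g)))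
        (Node \<beta> (family J (\<lambda>j. signed_cut s \<gamma> (Leaf a) (g j))))"
      by (rule R [OF wt.wt_leaf [OF leaf_wt(1)]])
    also have "eqv (join \<gamma> C D) \<dots> (Node \<beta> (family J (\<lambda>j. signed_cut s \<gamma> (Leaf a') (g j))))"
      by (rule eqv_node_right [OF cuttable leaf_wt_ok [OF leaf_wt(1)] D \<beta>])
        (rule wt_node.IH [OF _ cuttable_upd_right [OF cuttable D(2) \<beta>]])
    also have "eqv (join \<gamma> C D) \<dots> (signed_cut s \<gamma> (Leaf a') (Node \<beta> (family J g)))"
      by (rule eqv.eqv_sym [OF R [OF wt.wt_leaf [OF leaf_wt(2)]]])
    finally show ?case .
  qed
next
  case (eqv_node C \<alpha> v I f f')
  note C = eqv_node.hyps(1-3) and ff' = eqv_node.hyps(4)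
  have f: "wt (C(\<alpha> \<mapsto> sub v i)) (f i)" "wt (C(\<alpha> \<mapsto> sub v i)) (f' i)" if "i |\<in>| I" for i
    using eqv_wt [OF ff' [OF that]] by simp_all
  have m: "wt C (Node \<alpha> (family I f))" "wt C (Node \<alpha> (family I f'))"
    by (rule wt_node [OF C f(1)], assumption) (rule wt_node [OF C f(2)])
  show ?case
  proof (cases "\<alpha> = \<gamma>")
    case False
    note n = eqv_node.prems(2) and cuttable = eqv_node.prems(1)
    have "eqv (join \<gamma> C D) (signed_cut s \<gamma> (Node \<alpha> (family I f)) n) (Node \<alpha> (family I (\<lambda>i. signed_cut s \<gamma> (f i) n)))"
      by (rule signed_cut_node [OF cuttable n C False f(1)])
    also have "eqv (join \<gamma> C D) \<dots> (Node \<alpha> (family I (\<lambda>i. signed_cut s \<gamma> (f' i) n)))"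
      by (rule eqv_node_left [OF cuttable C(1) wt_ok [OF n] C(2,3) False])
        (rule eqv_node.IH [OF _ cuttable_upd [OF cuttable C(2) False] n])
    also have "eqv (join \<gamma> C D) \<dots> (signed_cut s \<gamma> (Node \<alpha> (family I f')) n)"
      by (rule eqv.eqv_sym [OF signed_cut_node [OF cuttable n C False f(2)]])
    finally show ?thesis .
  next
    case True
    note C' = C [unfolded True] and m' = m [unfolded True]
    \<comment> \<open>Both nodes wait at \<gamma>, hence \<open>n\<close> is unfolded until its root
      is \<gamma>. The conversion of the selected branches is then the outer induction
      hypothesis.\<close>
    from eqv_node.prems(2,1) show ?thesis
      unfolding True
    proof (induction rule: wt.induct)
      case (wt_leaf D b)
      then show ?case using cuttable_no_branch [of s \<gamma> C D v I b] C'(2,3) by blast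
    next
      case (wt_node D \<beta> w J g)
      note D = wt_node.hyps(1-3) and g = wt_node.hyps(4) and cuttable = wt_node.prems
      show ?case
      proof (cases "\<beta> = \<gamma>")
        case False
        note R = signed_cut_node_right [OF cuttable _ D False g]
        have "eqv (join \<gamma> C D) (signed_cut s \<gamma> (Node \<gamma> (family I f)) (Node \<beta> (family J g)))
            (Node \<beta> (family J (\<lambda>j. signed_cut s \<gamma> (Node \<gamma> (family I f)) (g j))))"
          by (rule R [OF m'(1)])
        also have "eqv (join \<gamma> C D) \<dots> (Node \<beta> (family J (\<lambda>j. signed_cut s \<gamma> (Node \<gamma> (family I f')) (g j))))"
          by (rule eqv_node_right [OF cuttable C(1) D False])
            (rule wt_node.IH [OF _ cuttable_upd_right [OF cuttable D(2) False]])
        also have "eqv (join \<gamma> C D) \<dots> (signed_cut s \<gamma> (Node \<gamma> (family I f')) (Node \<beta> (family J g)))"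
          by (rule eqv.eqv_sym [OF R [OF m'(2)]])
        finally show ?thesis .
      next
        case \<beta>: True
        note D' = D [unfolded \<beta>] and g' = g [unfolded \<beta>]
        obtain k where k: "I |\<inter>| J = {|k|}" "k |\<in>| I" "k |\<in>| J"
          by (rule branch_principal [OF cuttable C'(2) D'(2) C'(3) D'(3)])
        have "eqv (join \<gamma> (C(\<gamma> \<mapsto> sub v k)) (D(\<gamma> \<mapsto> sub w k))) (signed_cut s \<gamma> (f k) (g k)) (signed_cut s \<gamma> (f' k) (g k))"
          by (rule eqv_node.IH [unfolded True, OF k(2) cuttable_sub [OF cuttable C'(2) D'(2)] g' [OF k(3)]])
        then show ?thesis unfolding \<beta> by (simp add: signed_cut_principal k(1) join_sub)
      qed
    qed
  qed
next
  case (eqv_conv C \<alpha> v I \<beta> w J f)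
  note C = eqv_conv.hyps and n = eqv_conv.prems(2) and cuttable = eqv_conv.prems(1)
  have f': "wt (C(\<beta> \<mapsto> sub w j, \<alpha> \<mapsto> sub v i)) (f i j)" if "j |\<in>| J" "i |\<in>| I" for i j
    using C(7) [OF that(2,1)] C(6) by (simp add: fun_upd_twist)
  have f1: "wt (C(\<alpha> \<mapsto> sub v i)) (Node \<beta> (family J (f i)))" if "i |\<in>| I" for i
    by (rule wt_node [OF ok_sub [OF C(1-3) that] _ C(5) C(7) [OF that]]) (use C in simp)
  have f2: "wt (C(\<beta> \<mapsto> sub w j)) (Node \<alpha> (family I (\<lambda>i. f i j)))" if "j |\<in>| J" for j
    by (rule wt_node [OF ok_sub [OF C(1,4,5) that] _ C(3) f' [OF that]]) (use C in simp)
  \<comment> \<open>At most one of the exchanged channels is the cut channel. If one is,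
    \<open>signed_cut_exchange\<close> applies, with the roles of the channels swapped in the second
    case; if none is, the cut passes both nodes and the exchange happens outside.\<close>
  consider "\<alpha> = \<gamma>" | "\<beta> = \<gamma>" | "\<alpha> \<noteq> \<gamma>" "\<beta> \<noteq> \<gamma>" by blast
  then show ?case
  proof cases
    case 1
    have \<beta>: "\<beta> \<noteq> \<gamma>" using C(6) 1 by simp
    show ?thesis
      using eqv.eqv_trans [OF signed_cut_exchange [OF n cuttable C [unfolded 1]]
        eqv.eqv_sym [OF signed_cut_node [OF cuttable n C(1,4,5) \<beta> f2 [unfolded 1]]]]
      unfolding 1 by blast
  next
    case 2
    have \<alpha>: "\<alpha> \<noteq> \<gamma>" using C(6) 2 by simp
    show ?thesis
      using eqv.eqv_trans [OF signed_cut_node [OF cuttable n C(1-3) \<alpha> f1 [unfolded 2]]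
        eqv.eqv_sym [OF signed_cut_exchange [where f = "\<lambda>j i. f i j", OF n cuttable C(1) C(4,5) [unfolded 2] C(2,3)
            not_sym [OF C(6) [unfolded 2]] f' [unfolded 2]]]]
      unfolding 2 by blast
  next
    case 3
    have "eqv (join \<gamma> C D) (signed_cut s \<gamma> (Node \<alpha> (family I (\<lambda>i. Node \<beta> (family J (f i))))) n)
        (Node \<alpha> (family I (\<lambda>i. Node \<beta> (family J (\<lambda>j. signed_cut s \<gamma> (f i j) n)))))"
      by (rule signed_cut_node2 [OF n cuttable C(1-6) 3 C(7)])
    also have "eqv (join \<gamma> C D) \<dots> (Node \<beta> (family J (\<lambda>j. Node \<alpha> (family I (\<lambda>i. signed_cut s \<gamma> (f i j) n)))))"
    proof (rule eqv.eqv_conv)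
      show "join \<gamma> C D \<alpha> = Some v" by (rule join_left [OF cuttable C(2) 3(1)])
      show "join \<gamma> C D \<beta> = Some w" by (rule join_left [OF cuttable C(4) 3(2)])
      show "wt ((join \<gamma> C D)(\<alpha> \<mapsto> sub v i, \<beta> \<mapsto> sub w j)) (signed_cut s \<gamma> (f i j) n)"
        if "i |\<in>| I" "j |\<in>| J" for i j
      proof -
        note cuttable' = cuttable_upd [OF cuttable C(2) 3(1), of "sub v i"]
        have \<beta>: "(C(\<alpha> \<mapsto> sub v i)) \<beta> = Some w" using C(4,6) by simp
        have "wt (join \<gamma> (C(\<alpha> \<mapsto> sub v i, \<beta> \<mapsto> sub w j)) D) (signed_cut s \<gamma> (f i j) n)"
          by (rule wt_signed_cut [OF cuttable_upd [OF cuttable' \<beta> 3(2)] C(7) [OF that] n])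
        then show ?thesis
          by (simp add: join_upd [OF cuttable' \<beta> 3(2)] join_upd [OF cuttable C(2) 3(1)])
      qed
    qed (use C wt_ok [OF n] in \<open>simp_all add: ok_join\<close>)
    also have "eqv (join \<gamma> C D) \<dots> (signed_cut s \<gamma> (Node \<beta> (family J (\<lambda>j. Node \<alpha> (family I (\<lambda>i. f i j))))) n)"
      by (rule eqv.eqv_sym, rule signed_cut_node2 [where f = "\<lambda>j i. f i j", OF n cuttable C(1,4,5,2,3) not_sym [OF C(6)] 3(2,1) f'])
    finally show ?thesis .
  qed
qed

lemma eqv_cut_nt:
  assumes "cuttable True \<gamma> C D" "eqv C m m'" "eqv D n n'"
  shows "eqv (join \<gamma> C D) (cut_nt \<gamma> m n) (cut_nt \<gamma> m' n')"
proof -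
  have "eqv (join \<gamma> C D) (cut_nt \<gamma> m n) (cut_nt \<gamma> m' n)"
    using eqv_signed_cut [OF assms(2,1)] eqv_wt [OF assms(3)] by (simp add: signed_cut_def)
  moreover have "eqv (join \<gamma> C D) (cut_nt \<gamma> m' n) (cut_nt \<gamma> m' n')"
    using eqv_signed_cut [OF assms(3) cuttable_commute [OF assms(1)]] eqv_wt [OF assms(2)]
      cuttable_join_commute [OF assms(1)]
    by (simp add: signed_cut_def)
  ultimately show ?thesis by (rule eqv_trans)
qed

text \<open>The formula at \<gamma> is an atom, so no node of \<open>m\<close> has root \<gamma> and
  the cut travels unchanged to the leaves, where it becomes a renaming. The result is an equation,
  without any conversion.\<close>

lemma cut_nt_idn_right:
  assumes "c \<in> obj A" "\<gamma> \<noteq> \<beta>"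
  shows "wt C m \<Longrightarrow> C \<gamma> = Some (True, Atom c) \<Longrightarrow> \<beta> \<notin> dom C \<Longrightarrow>
    cut_nt \<gamma> m (Leaf (Ax (idn A \<gamma> \<beta> c))) = ren_nt A (transpose \<gamma> \<beta>) m"
proof (induction rule: wt.induct)
  case (wt_leaf C a)
  have "leaf_cut \<gamma> a (Ax (idn A \<gamma> \<beta> c)) = ren_trm A (transpose \<gamma> \<beta>) a"
    by (rule leaf_cut_right) (use assms in \<open>auto simp: is_idn_def\<close>)
  then show ?case by (simp add: cut_nt_leaf)
next
  case (wt_node C \<alpha> v I f)
  have "\<alpha> \<noteq> \<gamma>" using wt_node.hyps(2,3) wt_node.prems(1) by auto
  moreover have "\<alpha> \<noteq> \<beta>" using wt_node.hyps(2) wt_node.prems(2) by auto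
  ultimately show ?case
    using wt_node.IH wt_node.prems by (simp add: cut_nt_left family_eq_iff)
qed

text \<open>As for an identity on the right, the cut travels to the leaves; the new point is the
  preference of \<open>leaf_cut\<close> for a right identity.\<close>

lemma cut_nt_idn_left:
  assumes "c \<in> obj A" "\<alpha> \<noteq> \<gamma>"
  shows "wt D n \<Longrightarrow> D \<gamma> = Some (False, Atom c) \<Longrightarrow> \<alpha> \<notin> dom D \<Longrightarrow>
    cut_nt \<gamma> (Leaf (Ax (idn A \<alpha> \<gamma> c))) n = ren_nt A (transpose \<gamma> \<alpha>) n"
proof (induction rule: wt.induct)
  case (wt_leaf D b)
  show ?case
  proof (cases "\<exists>\<beta>. is_idn \<gamma> \<beta> b")
    \<comment> \<open>Both leaves are identities. Absorbing either of them yields the identity from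
      \<alpha> to \<beta>.\<close>
    case True
    then obtain \<beta> c' where b: "\<gamma> \<noteq> \<beta>" "c' \<in> obj A" "b = Ax (idn A \<gamma> \<beta> c')" by (auto simp: is_idn_def)
    then have D: "D = [\<gamma> \<mapsto> (False, Atom c'), \<beta> \<mapsto> (True, Atom c')]"
      using leaf_wt_AxD wt_leaf.hyps actx_idn by metis
    then have "c' = c" "\<alpha> \<noteq> \<beta>" using wt_leaf.prems b(1) by (auto simp: fun_upd_apply)
    moreover have "is_idn \<gamma> \<beta> b" using b by (auto simp: is_idn_def)
    ultimately show ?thesis using assms b
      by (simp add: cut_nt_leaf leaf_cut_right [of \<gamma> \<beta>] ren_idn)
  next
    case False
    then have "leaf_cut \<gamma> (Ax (idn A \<alpha> \<gamma> c)) b = ren_trm A (transpose \<gamma> \<alpha>) b"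
      by (rule leaf_cut_left) (use assms in \<open>auto simp: is_idn_def\<close>)
    then show ?thesis by (simp add: cut_nt_leaf)
  qed
next
  case (wt_node D \<beta> w J g)
  have "\<beta> \<noteq> \<gamma>" using wt_node.hyps(2,3) wt_node.prems(1) by auto
  moreover have "\<alpha> \<noteq> \<beta>" using wt_node.hyps(2) wt_node.prems(2) by auto
  ultimately show ?case
    using wt_node.IH wt_node.prems by (simp add: cut_nt_right family_eq_iff)
qed

section \<open>The normal form of a term\<close>

lemmas derives_der' = derives_der [OF symmetric_polycategory_axioms]
  and der_derives' = der_derives [OF symmetric_polycategory_axioms]
  and der_unique' = der_unique [OF symmetric_polycategory_axioms]
  and der_ok' = der_ok [OF symmetric_polycategory_axioms]

text \<open>Type annotations of the term are forgotten here; \<open>readback\<close> restores them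
  from the sequent.\<close>

primrec nf :: "('o, 'm, 'n) trm \<Rightarrow> ('o, 'm, 'n) nt" where
  "nf (Ax f) = Leaf (Ax f)"
| "nf (Cotuple \<alpha> \<Gamma> \<Delta> F) = Node \<alpha> (fmmap nf F)"
| "nf (Tuple \<alpha> \<Gamma> \<Delta> F) = Node \<alpha> (fmmap nf F)"
| "nf (Proj \<alpha> X k t) = Node \<alpha> (family {|k|} (\<lambda>_. nf t))"
| "nf (Inj \<alpha> X k t) = Node \<alpha> (family {|k|} (\<lambda>_. nf t))"
| "nf (Cut \<gamma> t u) = cut_nt \<gamma> (nf t) (nf u)"

lemma nf_mk_node:
  assumes "C \<alpha> = Some v" "branch v I"
  shows "nf (mk_node C \<alpha> (family I f)) = Node \<alpha> (family I (\<lambda>i. nf (f i)))"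
  using assms(1) by (cases rule: branch_cases [OF assms(2)]) (simp_all add: mk_node_simps family_eq_iff)

lemma wt_nf: "der A C t \<Longrightarrow> wt C (nf t)"
proof (induction rule: der.induct)
  case (der_ax f)
  then show ?case by (simp add: wt_leaf leaf_wt_ax)
next
  case (der_mk_node C \<alpha> v I f)
  have "wt C (Node \<alpha> (family I (\<lambda>i. nf (f i))))" by (rule wt_node [OF der_mk_node.hyps(1-3) der_mk_node.IH])
  then show ?case by (simp add: nf_mk_node [of C \<alpha> v, OF der_mk_node.hyps(2,3)])
next
  case (der_cut \<gamma> C D t u)
  then show ?case by (simp add: wt_cut_nt)
qed

lemma nf_ren: "der A C t \<Longrightarrow> bij \<pi> \<Longrightarrow> nf (ren_trm A \<pi> t) = ren_nt A \<pi> (nf t)"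
proof (induction rule: der.induct)
  case (der_mk_node C \<alpha> v I f)
  note C\<alpha> = der_mk_node.hyps(2) and IH = der_mk_node.IH [OF _ der_mk_node.prems]
  show ?case
    using C\<alpha> IH by (cases rule: branch_cases [OF der_mk_node.hyps(3)]) (simp_all add: mk_node_simps family_eq_iff)
next
  case (der_cut \<gamma> C D t u)
  then show ?case using cut_nt_ren [OF wt_nf wt_nf, of C t D u \<gamma> \<pi>] by simp
qed simp


section \<open>Soundness of the normal form\<close>

text \<open>Both sides have to be typed: if \<open>I\<close> is empty, the first contains no
  \<beta>-node, and only the second shows that the sequent allows this branching.\<close>

lemma eqv_exchange:
  assumes m: "wt C (Node \<alpha> (family I (\<lambda>i. Node \<beta> (family J (f i)))))"
    and n: "wt C (Node \<beta> (family J (\<lambda>j. Node \<alpha> (family I (\<lambda>i. f i j)))))" and "\<alpha> \<noteq> \<beta>"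
  shows "eqv C (Node \<alpha> (family I (\<lambda>i. Node \<beta> (family J (f i)))))
    (Node \<beta> (family J (\<lambda>j. Node \<alpha> (family I (\<lambda>i. f i j)))))"
proof -
  obtain v where v: "ok A C" "C \<alpha> = Some v" "branch v I"
      "\<And>i. i |\<in>| I \<Longrightarrow> wt (C(\<alpha> \<mapsto> sub v i)) (Node \<beta> (family J (f i)))"
    by (rule wt_NodeD [OF m], rule that)
  obtain w where w: "C \<beta> = Some w" "branch w J" by (rule wt_NodeD [OF n], rule that)
  show ?thesis
  proof (rule eqv_conv [OF v(1-3) w assms(3)])
    fix i j assume "i |\<in>| I" "j |\<in>| J"
    from v(4) [OF this(1)] obtain w' where "(C(\<alpha> \<mapsto> sub v i)) \<beta> = Some w'"
        "\<And>j. j |\<in>| J \<Longrightarrow> wt (C(\<alpha> \<mapsto> sub v i, \<beta> \<mapsto> sub w' j)) (f i j)"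
      by (rule wt_NodeD) blast
    then show "wt (C(\<alpha> \<mapsto> sub v i, \<beta> \<mapsto> sub w j)) (f i j)"
      using w(1) assms(3) \<open>j |\<in>| J\<close> by simp
  qed
qed

lemma eqv_conv_rule:
  assumes "conv_rule t s" "der A C t" "der A C s"
  shows "eqv C (nf t) (nf s)"
  using assms(1)
proof cases
  case (cotuple_cotuple \<alpha> \<beta> \<Gamma> \<Delta> I \<Gamma>1 \<Delta>1 J f)
  then show ?thesis using eqv_exchange [of C \<alpha> I \<beta> J "\<lambda>i j. nf (f i j)"] wt_nf [OF assms(2)] wt_nf [OF assms(3)] by simp
next
  case (tuple_tuple \<alpha> \<beta> \<Gamma> \<Delta> I \<Gamma>1 \<Delta>1 J f)
  then show ?thesis using eqv_exchange [of C \<alpha> I \<beta> J "\<lambda>i j. nf (f i j)"] wt_nf [OF assms(2)] wt_nf [OF assms(3)] by simp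
next
  case (cotuple_inj \<alpha> \<beta> \<Gamma> \<Delta> I X k f)
  then show ?thesis using eqv_exchange [of C \<alpha> I \<beta> "{|k|}" "\<lambda>i j. nf (f i)"] wt_nf [OF assms(2)] wt_nf [OF assms(3)] by simp
next
  case (proj_tuple \<alpha> \<beta> X k \<Gamma> \<Delta> I g)
  then show ?thesis using eqv_exchange [of C \<alpha> "{|k|}" \<beta> I "\<lambda>i j. nf (g j)"] wt_nf [OF assms(2)] wt_nf [OF assms(3)] by simp
next
  case (cotuple_proj \<alpha> \<beta> \<Gamma> \<Delta> I X k f)
  then show ?thesis using eqv_exchange [of C \<alpha> I \<beta> "{|k|}" "\<lambda>i j. nf (f i)"] wt_nf [OF assms(2)] wt_nf [OF assms(3)] by simp
next
  case (inj_tuple \<alpha> \<beta> X k \<Gamma> \<Delta> I g)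
  then show ?thesis using eqv_exchange [of C \<alpha> "{|k|}" \<beta> I "\<lambda>i j. nf (g j)"] wt_nf [OF assms(2)] wt_nf [OF assms(3)] by simp
next
  case (cotuple_tuple \<alpha> \<beta> \<Gamma> \<Delta> I \<Gamma>1 \<Delta>1 J f)
  then show ?thesis using eqv_exchange [of C \<alpha> I \<beta> J "\<lambda>i j. nf (f i j)"] wt_nf [OF assms(2)] wt_nf [OF assms(3)] by simp
next
  case (inj_inj \<alpha> \<beta> X k Y l f)
  then show ?thesis using eqv_exchange [of C \<alpha> "{|k|}" \<beta> "{|l|}" "\<lambda>i j. nf f"] wt_nf [OF assms(2)] wt_nf [OF assms(3)] by simp
next
  case (proj_proj \<alpha> \<beta> X k Y l f)
  then show ?thesis using eqv_exchange [of C \<alpha> "{|k|}" \<beta> "{|l|}" "\<lambda>i j. nf f"] wt_nf [OF assms(2)] wt_nf [OF assms(3)] by simp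
next
  case (inj_proj \<alpha> \<beta> X k Y l f)
  then show ?thesis using eqv_exchange [of C \<alpha> "{|k|}" \<beta> "{|l|}" "\<lambda>i j. nf f"] wt_nf [OF assms(2)] wt_nf [OF assms(3)] by simp
qed

text \<open>Serves the four rewrites that push a cut into its right half. Their left counterparts
  are defining equations of \<open>cut_nt\<close>.\<close>

lemma eqv_nf_push:
  assumes "der A C (Cut \<gamma> t u)" "nf u = Node \<beta> (family J g)" "\<beta> \<noteq> \<gamma>"
  shows "eqv C (nf (Cut \<gamma> t u)) (Node \<beta> (family J (\<lambda>j. cut_nt \<gamma> (nf t) (g j))))"
proof -
  obtain D E where D: "C = join \<gamma> D E" "cuttable True \<gamma> D E" "der A D t" "der A E u"
    using der_CutD [OF assms(1)] by blast
  have u: "wt E (Node \<beta> (family J g))" using wt_nf [OF D(4)] assms(2) by simp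
  obtain w where "ok A E" "E \<beta> = Some w" "branch w J"
      "\<And>j. j |\<in>| J \<Longrightarrow> wt (E(\<beta> \<mapsto> sub w j)) (g j)"
    by (rule wt_NodeD [OF u], rule that)
  from cut_nt_node_right [OF wt_nf [OF D(3)] D(2) this(1-3) assms(3) this(4)]
  show ?thesis by (simp add: D(1) assms(2))
qed

lemma eqv_cut_rule:
  assumes "cut_rule A t s" and t: "der A C t" and s: "der A C s"
  shows "eqv C (nf t) (nf s)"
proof -
  \<comment> \<open>Apart from the four rewrites pushing a cut to the right, all rules preserve the
    normal form on the nose.\<close>
  have "nf t = nf s \<Longrightarrow> ?thesis" using eqv_refl [OF wt_nf [OF s]] by simp
  with assms(1) show ?thesis
  proof cases
    case (id_right a \<gamma> \<beta> f)
    obtain D E where D: "cuttable True \<gamma> D E" "der A D f" "der A E (Ax (idn A \<gamma> \<beta> a))"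
      using der_CutD [OF t [unfolded id_right]] by blast
    have "E = [\<gamma> \<mapsto> (False, Atom a), \<beta> \<mapsto> (True, Atom a)]"
      using der_AxD [OF D(3)] actx_idn [OF id_right(3,4)] by simp
    then have "D \<gamma> = Some (True, Atom a)" "\<beta> \<notin> dom D"
      using D(1) id_right(4) by (auto simp: cuttable_def fun_upd_apply)
    then have "nf t = nf s"
      using cut_nt_idn_right [OF id_right(3,4) wt_nf [OF D(2)]] nf_ren [OF D(2)] id_right by simp
    then show ?thesis by fact
  next
    case (id_left a \<alpha> \<gamma> f)
    obtain D E where D: "cuttable True \<gamma> D E" "der A E f" "der A D (Ax (idn A \<alpha> \<gamma> a))"
      using der_CutD [OF t [unfolded id_left]] by blast
    have "D = [\<alpha> \<mapsto> (False, Atom a), \<gamma> \<mapsto> (True, Atom a)]"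
      using der_AxD [OF D(3)] actx_idn [OF id_left(3,4)] by simp
    then have "E \<gamma> = Some (False, Atom a)" "\<alpha> \<notin> dom E"
      using D(1) id_left(4) by (auto simp: cuttable_def fun_upd_apply)
    then have "nf t = nf s"
      using cut_nt_idn_left [OF id_left(3,4) wt_nf [OF D(2)]] nf_ren [OF D(2)] id_left by simp
    then show ?thesis by fact
  next
    case (inj_cotuple k I \<gamma> X f \<Gamma> \<Delta> g)
    then have "{|k|} |\<inter>| I = {|k|}" by auto
    then have "nf t = nf s" using inj_cotuple by (simp add: cut_nt_principal)
    then show ?thesis by fact
  next
    case (tuple_proj k I \<gamma> \<Gamma> \<Delta> f X g)
    then have "I |\<inter>| {|k|} = {|k|}" by auto
    then have "nf t = nf s" using tuple_proj by (simp add: cut_nt_principal)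
    then show ?thesis by fact
  next
    case (cut_tuple \<beta> \<gamma> f \<Gamma> \<Delta> I g)
    then show ?thesis using eqv_nf_push [OF t [unfolded cut_tuple]] by simp
  next
    case (cut_proj \<beta> \<gamma> f X k g)
    then show ?thesis using eqv_nf_push [OF t [unfolded cut_proj]] by simp
  next
    case (cut_inj \<beta> \<gamma> f X k g)
    then show ?thesis using eqv_nf_push [OF t [unfolded cut_inj]] by simp
  next
    case (cut_cotuple \<beta> \<gamma> f \<Gamma> \<Delta> I g)
    then show ?thesis using eqv_nf_push [OF t [unfolded cut_cotuple]] by simp
  qed (simp_all add: cut_nt_left)
qed

text \<open>The cut commutes with renaming, so the normal form of \<open>s\<close> is that of
  \<open>t\<close> renamed by the transposition, which fixes every channel of the sequent.
  Uniqueness of sequents identifies the contexts named in the freshness condition with those of the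
  cut.\<close>

lemma eqv_alpha_rule:
  assumes "alpha_rule A t s" and t: "der A C t"
  shows "eqv C (nf t) (nf s)"
  using assms(1)
proof cases
  case (1 u \<Gamma> \<Delta> w \<Gamma>' \<Delta>' \<delta> \<gamma>)
  obtain D E where D: "C = join \<gamma> D E" "cuttable True \<gamma> D E" "der A D u" "der A E w"
    using der_CutD [OF t [unfolded 1]] by blast
  have "D = ctx \<Gamma> \<Delta>" "E = ctx \<Gamma>' \<Delta>'"
    using der_unique' D(3,4) derives_der' 1(3,4) by blast+
  then have \<delta>: "\<delta> \<notin> dom D \<union> dom E" using 1(5) by (simp add: dom_ctx)
  let ?\<tau> = "transpose \<gamma> \<delta>"
  have "nf s = ren_nt A ?\<tau> (nf t)"
    using cut_nt_ren [OF wt_nf [OF D(3)] wt_nf [OF D(4)] D(2), of ?\<tau>] nf_ren [OF D(3)] nf_ren [OF D(4)] 1(1,2)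
    by simp
  moreover have "eqv C (nf t) (ren_nt A ?\<tau> (nf t))"
    by (rule eqv_ren [OF wt_nf [OF t]]) (use \<delta> D(1) in \<open>auto simp: dom_join transpose_def\<close>)
  ultimately show ?thesis by simp
qed

section \<open>Steps below the root\<close>

abbreviation typed :: "(('o, 'm, 'n) trm \<Rightarrow> ('o, 'm, 'n) trm \<Rightarrow> bool) \<Rightarrow> ('o, 'm, 'n) trm \<Rightarrow> ('o, 'm, 'n) trm \<Rightarrow> bool" where
  "typed R t s \<equiv> R t s \<and> (\<exists>\<Gamma> \<Delta>. derives A t \<Gamma> \<Delta> \<and> derives A s \<Gamma> \<Delta>)"

text \<open>The last conjunct is for arbitrary \<open>G\<close>, so that the term is still a
  \<open>mk_node\<close> over the same context after one member of the family has been replaced. The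
  three lemmas that follow do the same for the other rules.\<close>

lemma der_CotupleD:
  fixes F :: "('n, ('o, 'm, 'n) trm) fmap"
  assumes "der A C (Cotuple \<alpha> \<Gamma> \<Delta> F)"
  shows "\<exists>v I f. F = family I f \<and> ok A C \<and> C \<alpha> = Some v \<and> branch v I \<and>
    (\<forall>i. i |\<in>| I \<longrightarrow> der A (C(\<alpha> \<mapsto> sub v i)) (f i)) \<and> (\<forall>G :: ('n, ('o, 'm, 'n) trm) fmap. mk_node C \<alpha> G = Cotuple \<alpha> \<Gamma> \<Delta> G)"
  using assms
proof (cases rule: der_cases)
  case (node \<beta> v I f)
  have "\<beta> = \<alpha> \<and> F = family I f \<and> (\<forall>G :: ('n, ('o, 'm, 'n) trm) fmap. mk_node C \<alpha> G = Cotuple \<alpha> \<Gamma> \<Delta> G)"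
    using node(1,3) by (cases rule: branch_cases [OF node(4)]) (auto simp: mk_node_simps)
  then show ?thesis using node(2-5) by blast
qed auto

lemma der_TupleD:
  fixes F :: "('n, ('o, 'm, 'n) trm) fmap"
  assumes "der A C (Tuple \<alpha> \<Gamma> \<Delta> F)"
  shows "\<exists>v I f. F = family I f \<and> ok A C \<and> C \<alpha> = Some v \<and> branch v I \<and>
    (\<forall>i. i |\<in>| I \<longrightarrow> der A (C(\<alpha> \<mapsto> sub v i)) (f i)) \<and> (\<forall>G :: ('n, ('o, 'm, 'n) trm) fmap. mk_node C \<alpha> G = Tuple \<alpha> \<Gamma> \<Delta> G)"
  using assms
proof (cases rule: der_cases)
  case (node \<beta> v I f)
  have "\<beta> = \<alpha> \<and> F = family I f \<and> (\<forall>G :: ('n, ('o, 'm, 'n) trm) fmap. mk_node C \<alpha> G = Tuple \<alpha> \<Gamma> \<Delta> G)"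
    using node(1,3) by (cases rule: branch_cases [OF node(4)]) (auto simp: mk_node_simps)
  then show ?thesis using node(2-5) by blast
qed auto

lemma der_ProjD:
  fixes t :: "('o, 'm, 'n) trm"
  assumes "der A C (Proj \<alpha> X k t)"
  shows "\<exists>v. ok A C \<and> C \<alpha> = Some v \<and> branch v {|k|} \<and> der A (C(\<alpha> \<mapsto> sub v k)) t \<and>
    (\<forall>f :: 'n \<Rightarrow> ('o, 'm, 'n) trm. mk_node C \<alpha> (family {|k|} f) = Proj \<alpha> X k (f k))"
  using assms
proof (cases rule: der_cases)
  case (node \<beta> v I f)
  have "\<beta> = \<alpha> \<and> I = {|k|} \<and> t = f k \<and> (\<forall>f :: 'n \<Rightarrow> ('o, 'm, 'n) trm. mk_node C \<alpha> (family {|k|} f) = Proj \<alpha> X k (f k))"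
    using node(1,3) by (cases rule: branch_cases [OF node(4)]) (auto simp: mk_node_simps)
  then show ?thesis using node(2-5) by blast
qed auto

lemma der_InjD:
  fixes t :: "('o, 'm, 'n) trm"
  assumes "der A C (Inj \<alpha> X k t)"
  shows "\<exists>v. ok A C \<and> C \<alpha> = Some v \<and> branch v {|k|} \<and> der A (C(\<alpha> \<mapsto> sub v k)) t \<and>
    (\<forall>f :: 'n \<Rightarrow> ('o, 'm, 'n) trm. mk_node C \<alpha> (family {|k|} f) = Inj \<alpha> X k (f k))"
  using assms
proof (cases rule: der_cases)
  case (node \<beta> v I f)
  have "\<beta> = \<alpha> \<and> I = {|k|} \<and> t = f k \<and> (\<forall>f :: 'n \<Rightarrow> ('o, 'm, 'n) trm. mk_node C \<alpha> (family {|k|} f) = Inj \<alpha> X k (f k))"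
    using node(1,3) by (cases rule: branch_cases [OF node(4)]) (auto simp: mk_node_simps)
  then show ?thesis using node(2-5) by blast
qed auto

lemma mk_node_step:
  assumes C: "ok A C" "C \<alpha> = Some v" "branch v I"
    and f: "\<And>i. i |\<in>| I \<Longrightarrow> der A (C(\<alpha> \<mapsto> sub v i)) (f i)"
    and s: "der A (C(\<alpha> \<mapsto> sub v i)) s" "eqv (C(\<alpha> \<mapsto> sub v i)) (nf (f i)) (nf s)"
  shows "der A C (mk_node C \<alpha> (family I (f(i := s))))"
    and "eqv C (nf (mk_node C \<alpha> (family I f))) (nf (mk_node C \<alpha> (family I (f(i := s)))))"
proof -
  have "der A (C(\<alpha> \<mapsto> sub v j)) ((f(i := s)) j)" if "j |\<in>| I" for j
    using f [OF that] s(1) by (cases "j = i") simp_all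
  then show "der A C (mk_node C \<alpha> (family I (f(i := s))))" by (rule der_mk_node [OF C])
  have "eqv (C(\<alpha> \<mapsto> sub v j)) (nf (f j)) (nf ((f(i := s)) j))" if "j |\<in>| I" for j
    using eqv_refl [OF wt_nf [OF f [OF that]]] s(2) by (cases "j = i") simp_all
  from eqv_node [OF C this]
  show "eqv C (nf (mk_node C \<alpha> (family I f))) (nf (mk_node C \<alpha> (family I (f(i := s)))))"
    by (simp add: nf_mk_node [of C \<alpha> v, OF C(2,3)])
qed

lemma fmupd_family: "i |\<in>| I \<Longrightarrow> fmupd i x (family I f) = family I (f(i := x))"
  by (rule fmap_ext) (auto simp: fun_upd_apply)

text \<open>Conversion is a congruence for nodes and, by \<open>eqv_cut_nt\<close>, for cuts; thus
  invariance under a rule at the root extends to all subterms.\<close>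

lemma in_context_eqv:
  assumes R: "\<And>C t s. R t s \<Longrightarrow> der A C t \<Longrightarrow> der A C s \<Longrightarrow> eqv C (nf t) (nf s)"
  shows "in_context (typed R) t s \<Longrightarrow> der A C t \<Longrightarrow> der A C s \<and> eqv C (nf t) (nf s)"
proof (induction arbitrary: C rule: in_context.induct)
  case (root t s)
  \<comment> \<open>The step only records that some sequent is common to both terms; uniqueness
    identifies it with \<open>C\<close>.\<close>
  then have "der A C s" by (metis der_unique' derives_der')
  then show ?case using R root by blast
next
  case (in_cotuple F i t s \<alpha> \<Gamma> \<Delta>)
  obtain v I f where f: "F = family I f" "ok A C" "C \<alpha> = Some v" "branch v I"
      "\<And>i. i |\<in>| I \<Longrightarrow> der A (C(\<alpha> \<mapsto> sub v i)) (f i)" "\<And>G :: (_, ('o, 'm, _) trm) fmap. mk_node C \<alpha> G = Cotuple \<alpha> \<Gamma> \<Delta> G"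
    using der_CotupleD [OF in_cotuple.prems] by blast
  have i: "i |\<in>| I" "t = f i" using in_cotuple.hyps(1) f(1) by (simp_all split: if_splits)
  have "der A (C(\<alpha> \<mapsto> sub v i)) s \<and> eqv (C(\<alpha> \<mapsto> sub v i)) (nf (f i)) (nf s)"
    using in_cotuple.IH f(5) [OF i(1)] i(2) by blast
  with mk_node_step [OF f(2-5), of i s] show ?case
    by (simp add: f(1) fmupd_family [OF i(1)] f(6) del: nf.simps)
next
  case (in_tuple F i t s \<alpha> \<Gamma> \<Delta>)
  obtain v I f where f: "F = family I f" "ok A C" "C \<alpha> = Some v" "branch v I"
      "\<And>i. i |\<in>| I \<Longrightarrow> der A (C(\<alpha> \<mapsto> sub v i)) (f i)" "\<And>G :: (_, ('o, 'm, _) trm) fmap. mk_node C \<alpha> G = Tuple \<alpha> \<Gamma> \<Delta> G"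
    using der_TupleD [OF in_tuple.prems] by blast
  have i: "i |\<in>| I" "t = f i" using in_tuple.hyps(1) f(1) by (simp_all split: if_splits)
  have "der A (C(\<alpha> \<mapsto> sub v i)) s \<and> eqv (C(\<alpha> \<mapsto> sub v i)) (nf (f i)) (nf s)"
    using in_tuple.IH f(5) [OF i(1)] i(2) by blast
  with mk_node_step [OF f(2-5), of i s] show ?case
    by (simp add: f(1) fmupd_family [OF i(1)] f(6) del: nf.simps)
next
  case (in_proj t s \<alpha> X k)
  obtain v where v: "ok A C" "C \<alpha> = Some v" "branch v {|k|}" "der A (C(\<alpha> \<mapsto> sub v k)) t"
      "\<And>f :: _ \<Rightarrow> ('o, 'm, _) trm. mk_node C \<alpha> (family {|k|} f) = Proj \<alpha> X k (f k)"
    using der_ProjD [OF in_proj.prems] by blast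
  have "der A (C(\<alpha> \<mapsto> sub v k)) s \<and> eqv (C(\<alpha> \<mapsto> sub v k)) (nf t) (nf s)"
    using in_proj.IH v(4) by blast
  with mk_node_step [OF v(1-3), of "\<lambda>_. t" k s] v(4) show ?case
    by (simp add: v(5))
next
  case (in_inj t s \<alpha> X k)
  obtain v where v: "ok A C" "C \<alpha> = Some v" "branch v {|k|}" "der A (C(\<alpha> \<mapsto> sub v k)) t"
      "\<And>f :: _ \<Rightarrow> ('o, 'm, _) trm. mk_node C \<alpha> (family {|k|} f) = Inj \<alpha> X k (f k)"
    using der_InjD [OF in_inj.prems] by blast
  have "der A (C(\<alpha> \<mapsto> sub v k)) s \<and> eqv (C(\<alpha> \<mapsto> sub v k)) (nf t) (nf s)"
    using in_inj.IH v(4) by blast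
  with mk_node_step [OF v(1-3), of "\<lambda>_. t" k s] v(4) show ?case
    by (simp add: v(5))
next
  case (in_cut_left t s \<gamma> u)
  obtain D E where D: "C = join \<gamma> D E" "cuttable True \<gamma> D E" "der A D t" "der A E u"
    using der_CutD [OF in_cut_left.prems] by blast
  with in_cut_left.IH [OF D(3)] show ?case
    using der_cut [OF D(2) _ D(4)] eqv_cut_nt [OF D(2) _ eqv_refl [OF wt_nf [OF D(4)]]] by simp
next
  case (in_cut_right t s \<gamma> u)
  obtain D E where D: "C = join \<gamma> D E" "cuttable True \<gamma> D E" "der A D u" "der A E t"
    using der_CutD [OF in_cut_right.prems] by blast
  with in_cut_right.IH [OF D(4)] show ?case
    using der_cut [OF D(2,3)] eqv_cut_nt [OF D(2) eqv_refl [OF wt_nf [OF D(3)]]] by simp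
qed

section \<open>Reduction to the normal form\<close>

text \<open>Fixing the sequent makes reductions of the premises composable under a node or a
  cut.\<close>

definition typed_step :: "(('o, 'm, 'n) trm \<Rightarrow> ('o, 'm, 'n) trm \<Rightarrow> bool) \<Rightarrow> ('o, 'n) sctx \<Rightarrow> ('o, 'm, 'n) trm rel" where
  "typed_step R C = {(t, s). der A C t \<and> der A C s \<and> in_context (typed R) t s}"

lemma typed_step_root: "R t s \<Longrightarrow> der A C t \<Longrightarrow> der A C s \<Longrightarrow> (t, s) \<in> typed_step R C"
  using der_derives' [of C t] der_derives' [of C s] by (auto simp: typed_step_def intro: in_context.root)

lemma typed_step_steps: "(t, s) \<in> typed_step R C \<Longrightarrow> (t, s) \<in> steps A R"
  using der_derives' unfolding typed_step_def steps_def derivations_def by blast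

lemma rtrancl_typed_step_der: "(t, s) \<in> (typed_step R C)\<^sup>* \<Longrightarrow> der A C t \<Longrightarrow> der A C s"
  by (induction rule: rtrancl_induct) (simp_all add: typed_step_def)

lemma rtrancl_map:
  assumes "(x, y) \<in> r\<^sup>*" "\<And>u v. (u, v) \<in> r \<Longrightarrow> (h u, h v) \<in> q"
  shows "(h x, h y) \<in> q\<^sup>*"
  using assms(1) by (induction rule: rtrancl_induct) (auto intro: rtrancl_into_rtrancl assms(2))

lemma typed_step_cut_left:
  assumes "cuttable True \<gamma> C D" "der A D u" "(t, s) \<in> (typed_step R C)\<^sup>*"
  shows "(Cut \<gamma> t u, Cut \<gamma> s u) \<in> (typed_step R (join \<gamma> C D))\<^sup>*"
  using assms(3)
  by (rule rtrancl_map) (auto simp: typed_step_def intro: der_cut [OF assms(1) _ assms(2)] in_cut_left)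

lemma typed_step_cut_right:
  assumes "cuttable True \<gamma> C D" "der A C u" "(t, s) \<in> (typed_step R D)\<^sup>*"
  shows "(Cut \<gamma> u t, Cut \<gamma> u s) \<in> (typed_step R (join \<gamma> C D))\<^sup>*"
  using assms(3)
  by (rule rtrancl_map) (auto simp: typed_step_def intro: der_cut [OF assms(1,2)] in_cut_right)

lemma in_context_mk_node:
  assumes "in_context Q t s" "C \<alpha> = Some v" "branch v I" "i |\<in>| I"
  shows "in_context Q (mk_node C \<alpha> (family I (f(i := t)))) (mk_node C \<alpha> (family I (f(i := s))))"
proof -
  have upd: "fmupd i s (family I (f(i := t))) = family I (f(i := s))"
    by (simp add: fmupd_family [OF assms(4)])
  have lookup: "fmlookup (family I (f(i := t))) i = Some t" using assms(4) by simp
  show ?thesis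
    using assms(2) assms(4) in_cotuple [OF lookup assms(1), unfolded upd]
      in_tuple [OF lookup assms(1), unfolded upd] assms(1)
    by (cases rule: branch_cases [OF assms(3)])
      (auto simp: mk_node_simps intro: in_context.in_proj in_context.in_inj)
qed

lemma typed_step_mk1:
  assumes C: "ok A C" "C \<alpha> = Some v" "branch v I" "i |\<in>| I"
    and f: "\<And>j. j |\<in>| I \<Longrightarrow> der A (C(\<alpha> \<mapsto> sub v j)) (f j)"
    and "(f i, s) \<in> (typed_step R (C(\<alpha> \<mapsto> sub v i)))\<^sup>*"
  shows "(mk_node C \<alpha> (family I f), mk_node C \<alpha> (family I (f(i := s)))) \<in> (typed_step R C)\<^sup>*"
proof -
  \<comment> \<open>Writing \<open>f\<close> as \<open>f(i := f i)\<close> exhibits the position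
    \<open>i\<close> as a hole that every term of the reduction fills in the same way.\<close>
  have "(mk_node C \<alpha> (family I (f(i := f i))), mk_node C \<alpha> (family I (f(i := s)))) \<in> (typed_step R C)\<^sup>*"
    using assms(6)
  proof (rule rtrancl_map)
    fix t s assume ts: "(t, s) \<in> typed_step R (C(\<alpha> \<mapsto> sub v i))"
    have "der A C (mk_node C \<alpha> (family I (f(i := x))))" if "der A (C(\<alpha> \<mapsto> sub v i)) x" for x
      by (rule der_mk_node [OF C(1-3)]) (use f that in \<open>auto simp: fun_upd_apply [of f]\<close>)
    moreover have "in_context (typed R) (mk_node C \<alpha> (family I (f(i := t)))) (mk_node C \<alpha> (family I (f(i := s))))"
      by (rule in_context_mk_node [where C = C and \<alpha> = \<alpha> and v = v, OF _ C(2-4)]) (use ts in \<open>simp add: typed_step_def\<close>)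
    ultimately show "(mk_node C \<alpha> (family I (f(i := t))), mk_node C \<alpha> (family I (f(i := s)))) \<in> typed_step R C"
      using ts by (simp add: typed_step_def)
  qed
  then show ?thesis by simp
qed

text \<open>A step changes one member of the family, so the members are reduced in turn;
  \<open>J\<close> collects those already done, and finiteness of \<open>I\<close> ends the
  process.\<close>

lemma typed_step_mk_node:
  assumes C: "ok A C" "C \<alpha> = Some v" "branch v I"
    and f: "\<And>i. i |\<in>| I \<Longrightarrow> der A (C(\<alpha> \<mapsto> sub v i)) (f i)"
    and fg: "\<And>i. i |\<in>| I \<Longrightarrow> (f i, g i) \<in> (typed_step R (C(\<alpha> \<mapsto> sub v i)))\<^sup>*"
  shows "(mk_node C \<alpha> (family I f), mk_node C \<alpha> (family I g)) \<in> (typed_step R C)\<^sup>*"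
proof -
  have "(mk_node C \<alpha> (family I f), mk_node C \<alpha> (family I (\<lambda>i. if i |\<in>| J then g i else f i))) \<in> (typed_step R C)\<^sup>*"
    if "J |\<subseteq>| I" for J
    using that
  proof (induction J rule: fset_induct)
    case empty
    then show ?case by simp
  next
    case (insert k J)
    let ?h = "\<lambda>i. if i |\<in>| J then g i else f i"
    have k: "k |\<in>| I" "(?h k, g k) \<in> (typed_step R (C(\<alpha> \<mapsto> sub v k)))\<^sup>*" using insert fg by auto
    have "der A (C(\<alpha> \<mapsto> sub v i)) (?h i)" if "i |\<in>| I" for i
      using f [OF that] rtrancl_typed_step_der [OF fg [OF that]] by simp
    then have "(mk_node C \<alpha> (family I ?h), mk_node C \<alpha> (family I (?h(k := g k)))) \<in> (typed_step R C)\<^sup>*"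
      by (rule typed_step_mk1 [where C = C and \<alpha> = \<alpha> and v = v and f = ?h and i = k and s = "g k" and R = R, OF C k(1) _ k(2)])
    moreover have "?h(k := g k) = (\<lambda>i. if i |\<in>| finsert k J then g i else f i)"
      by (auto simp: fun_upd_apply)
    ultimately show ?case using insert by auto
  qed
  from this [of I] have "(mk_node C \<alpha> (family I f), mk_node C \<alpha> (family I (\<lambda>i. if i |\<in>| I then g i else f i))) \<in> (typed_step R C)\<^sup>*"
    by simp
  moreover have "family I (\<lambda>i. if i |\<in>| I then g i else f i) = family I g" by (simp add: family_eq_iff)
  ultimately show ?thesis by simp
qed

text \<open>The context changes on the way down, so the recursion yields functions of the context.
  Each child is then evaluated at the context of its own premise.\<close>

primrec readback :: "('o, 'm, 'n) nt \<Rightarrow> ('o, 'n) sctx \<Rightarrow> ('o, 'm, 'n) trm" where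
  "readback (Leaf a) = (\<lambda>C. a)"
| "readback (Node \<alpha> F) =
    (\<lambda>C. mk_node C \<alpha> (fmmap_keys (\<lambda>i d. d (C(\<alpha> \<mapsto> sub (the (C \<alpha>)) i))) (fmmap readback F)))"

lemma readback_Node:
  assumes "C \<alpha> = Some v"
  shows "readback (Node \<alpha> (family I f)) C = mk_node C \<alpha> (family I (\<lambda>i. readback (f i) (C(\<alpha> \<mapsto> sub v i))))"
proof -
  have "fmmap_keys (\<lambda>i d. d (C(\<alpha> \<mapsto> sub v i))) (family I (\<lambda>i. readback (f i))) =
      family I (\<lambda>i. readback (f i) (C(\<alpha> \<mapsto> sub v i)))"
    by (rule fmap_ext) simp
  then show ?thesis using assms by simp
qed

lemma leaf_wt_der: "leaf_wt C a \<Longrightarrow> der A C a"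
  by (induction rule: leaf_wt.induct) (auto intro: der_ax der_cut)

lemma der_readback: "wt C n \<Longrightarrow> der A C (readback n C)"
proof (induction rule: wt.induct)
  case (wt_leaf C a)
  then show ?case by (simp add: leaf_wt_der)
next
  case (wt_node C \<alpha> v I f)
  have "der A C (mk_node C \<alpha> (family I (\<lambda>i. readback (f i) (C(\<alpha> \<mapsto> sub v i)))))"
    by (rule der_mk_node [OF wt_node.hyps(1-3) wt_node.IH])
  then show ?case by (simp only: readback_Node [of C \<alpha> v, OF wt_node.hyps(2)])
qed

lemma cut_rule_mk_node_left:
  assumes "C \<alpha> = Some v" "branch v I" "\<alpha> \<noteq> \<gamma>" "C' \<alpha> = Some v"
  shows "cut_rule A (Cut \<gamma> (mk_node C \<alpha> (family I f)) u) (mk_node C' \<alpha> (family I (\<lambda>i. Cut \<gamma> (f i) u)))"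
  using assms(1,3,4)
  by (cases rule: branch_cases [OF assms(2)])
    (auto simp: mk_node_simps intro: cotuple_cut tuple_cut proj_cut inj_cut)

lemma cut_rule_mk_node_right:
  assumes "D \<beta> = Some w" "branch w J" "\<beta> \<noteq> \<gamma>" "D' \<beta> = Some w"
  shows "cut_rule A (Cut \<gamma> t (mk_node D \<beta> (family J g))) (mk_node D' \<beta> (family J (\<lambda>j. Cut \<gamma> t (g j))))"
  using assms(1,3,4)
  by (cases rule: branch_cases [OF assms(2)])
    (auto simp: mk_node_simps intro: cut_cotuple cut_tuple cut_proj cut_inj)

text \<open>On a sum an injection meets a cotuple, on a product a tuple meets a projection, since
  the left half holds the output.\<close>

lemma cut_rule_principal:
  assumes "cuttable True \<gamma> C D" "C \<gamma> = Some v" "D \<gamma> = Some w" "branch v I" "branch w J"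
    and "k |\<in>| I" "k |\<in>| J"
  shows "cut_rule A (Cut \<gamma> (mk_node C \<gamma> (family I f)) (mk_node D \<gamma> (family J g))) (Cut \<gamma> (f k) (g k))"
proof -
  obtain Z where Z: "v = (True, Z)" "w = (False, Z)" using assms(1-3) by (auto simp: cuttable_def)
  show ?thesis
    using assms Z by (cases Z) (auto simp: mk_node_simps intro: inj_cotuple tuple_proj)
qed

text \<open>Each clause of \<open>cut_nt\<close> imitates one rewrite at the root, after which the
  induction hypotheses finish the cuts that have moved inwards. At leaves at most one identity
  rewrite is made.\<close>

lemma cut_reduces:
  "wt C m \<Longrightarrow> wt D n \<Longrightarrow> cuttable True \<gamma> C D \<Longrightarrow>
    (Cut \<gamma> (readback m C) (readback n D), readback (cut_nt \<gamma> m n) (join \<gamma> C D)) \<in> (typed_step (cut_rule A) (join \<gamma> C D))\<^sup>*"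
proof (induction rule: cut_induct)
  case (leaf C D a b)
  have "der A (join \<gamma> C D) (Cut \<gamma> a b)" by (rule der_cut [OF leaf(1) leaf_wt_der [OF leaf(2)] leaf_wt_der [OF leaf(3)]])
  moreover have "der A (join \<gamma> C D) (leaf_cut \<gamma> a b)" by (rule leaf_wt_der [OF leaf_wt_leaf_cut [OF leaf]])
  ultimately have "leaf_cut \<gamma> a b = Cut \<gamma> a b \<or> (Cut \<gamma> a b, leaf_cut \<gamma> a b) \<in> typed_step (cut_rule A) (join \<gamma> C D)"
    using cut_rule_leaf_cut [of \<gamma> a b] typed_step_root [of "cut_rule A"] by blast
  then show ?case by (auto simp: cut_nt_leaf)
next
  case (left C D \<alpha> v I f n)
  let ?E = "join \<gamma> C D" and ?f = "\<lambda>i. readback (f i) (C(\<alpha> \<mapsto> sub v i))"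
  have E: "ok A ?E" "?E \<alpha> = Some v"
    by (rule ok_join [OF left(2) wt_ok [OF left(6)]], rule join_left [OF left(1,3,5)])
  note join = join_upd [OF left(1,3,5)]
  have f: "der A (C(\<alpha> \<mapsto> sub v i)) (?f i)" if "i |\<in>| I" for i by (rule der_readback [OF left(7) [OF that]])
  note n = der_readback [OF left(6)]
  have cuts: "der A (?E(\<alpha> \<mapsto> sub v i)) (Cut \<gamma> (?f i) (readback n D))" if "i |\<in>| I" for i
    using der_cut [OF cuttable_upd [OF left(1,3,5)] f [OF that] n] by (simp add: join)
  have "(Cut \<gamma> (mk_node C \<alpha> (family I ?f)) (readback n D), mk_node ?E \<alpha> (family I (\<lambda>i. Cut \<gamma> (?f i) (readback n D))))
      \<in> typed_step (cut_rule A) ?E"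
    by (rule typed_step_root [where R = "cut_rule A"],
        rule cut_rule_mk_node_left [where C = C and \<alpha> = \<alpha> and v = v and C' = ?E, OF left(3-5) E(2)],
        rule der_cut [OF left(1) der_mk_node [OF left(2-4) f] n], assumption,
        rule der_mk_node [OF E left(4) cuts])
  also have "(mk_node ?E \<alpha> (family I (\<lambda>i. Cut \<gamma> (?f i) (readback n D))),
      mk_node ?E \<alpha> (family I (\<lambda>i. readback (cut_nt \<gamma> (f i) n) (?E(\<alpha> \<mapsto> sub v i))))) \<in> (typed_step (cut_rule A) ?E)\<^sup>*"
    by (rule typed_step_mk_node [OF E left(4) cuts]) (use left(8) in \<open>simp_all add: join\<close>)
  finally show ?case
    using left(5) by (simp only: readback_Node [of C \<alpha> v, OF left(3)] cut_nt_left readback_Node [of ?E \<alpha> v, OF E(2)] not_False_eq_True)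
next
  case (right C D \<beta> w J g m)
  let ?E = "join \<gamma> C D" and ?g = "\<lambda>j. readback (g j) (D(\<beta> \<mapsto> sub w j))"
  have E: "ok A ?E" "?E \<beta> = Some w"
    by (rule ok_join [OF wt_ok [OF right(6)] right(2)], rule join_right) (rule right(3,5))+
  note join = join_upd_right [OF right(1,3,5)]
  have g: "der A (D(\<beta> \<mapsto> sub w j)) (?g j)" if "j |\<in>| J" for j by (rule der_readback [OF right(8) [OF that]])
  note m = der_readback [OF right(6)]
  have cuts: "der A (?E(\<beta> \<mapsto> sub w j)) (Cut \<gamma> (readback m C) (?g j))" if "j |\<in>| J" for j
    using der_cut [OF cuttable_upd_right [OF right(1,3,5)] m g [OF that]] by (simp add: join)
  have "(Cut \<gamma> (readback m C) (mk_node D \<beta> (family J ?g)), mk_node ?E \<beta> (family J (\<lambda>j. Cut \<gamma> (readback m C) (?g j))))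
      \<in> typed_step (cut_rule A) ?E"
    by (rule typed_step_root [where R = "cut_rule A"],
        rule cut_rule_mk_node_right [where D = D and \<beta> = \<beta> and w = w and D' = ?E, OF right(3-5) E(2)],
        rule der_cut [OF right(1) m der_mk_node [OF right(2-4) g]], assumption,
        rule der_mk_node [OF E right(4) cuts])
  also have "(mk_node ?E \<beta> (family J (\<lambda>j. Cut \<gamma> (readback m C) (?g j))),
      mk_node ?E \<beta> (family J (\<lambda>j. readback (cut_nt \<gamma> m (g j)) (?E(\<beta> \<mapsto> sub w j))))) \<in> (typed_step (cut_rule A) ?E)\<^sup>*"
    by (rule typed_step_mk_node [OF E right(4) cuts]) (use right(9) in \<open>simp_all add: join\<close>)
  finally show ?case
    using right(5,7) by (simp only: readback_Node [of D \<beta> w, OF right(3)] cut_nt_right readback_Node [of ?E \<beta> w, OF E(2)] not_False_eq_True)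
next
  case (principal C D v w I J f g k)
  let ?f = "\<lambda>i. readback (f i) (C(\<gamma> \<mapsto> sub v i))" and ?g = "\<lambda>j. readback (g j) (D(\<gamma> \<mapsto> sub w j))"
  have f: "der A (C(\<gamma> \<mapsto> sub v i)) (?f i)" if "i |\<in>| I" for i by (rule der_readback [OF principal(11) [OF that]])
  have g: "der A (D(\<gamma> \<mapsto> sub w j)) (?g j)" if "j |\<in>| J" for j by (rule der_readback [OF principal(12) [OF that]])
  have "der A (join \<gamma> C D) (Cut \<gamma> (?f k) (?g k))"
    using der_cut [OF cuttable_sub [OF principal(1,4,5)] f [OF principal(9)] g [OF principal(10)]]
    by (simp add: join_sub)
  note cut = this
  have "(Cut \<gamma> (mk_node C \<gamma> (family I ?f)) (mk_node D \<gamma> (family J ?g)), Cut \<gamma> (?f k) (?g k))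
      \<in> typed_step (cut_rule A) (join \<gamma> C D)"
    by (rule typed_step_root [where R = "cut_rule A", OF _ _ cut],
        rule cut_rule_principal [where C = C and D = D and v = v and w = w, OF principal(1,4-7,9,10)],
        rule der_cut [OF principal(1) der_mk_node [OF principal(2,4,6) f] der_mk_node [OF principal(3,5,7) g]], assumption+)
  also have "(Cut \<gamma> (?f k) (?g k), readback (cut_nt \<gamma> (f k) (g k)) (join \<gamma> C D)) \<in> (typed_step (cut_rule A) (join \<gamma> C D))\<^sup>*"
    using principal(13) by (simp add: join_sub)
  finally show ?case
    by (simp only: readback_Node [of C \<gamma> v, OF principal(4)] readback_Node [of D \<gamma> w, OF principal(5)] cut_nt_principal [OF principal(8)])
qed

text \<open>At a cut, both halves are first brought to normal form inside the cut, which is then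
  evaluated by \<open>cut_reduces\<close>.\<close>

lemma reduces_nf: "der A C t \<Longrightarrow> (t, readback (nf t) C) \<in> (typed_step (cut_rule A) C)\<^sup>*"
proof (induction rule: der.induct)
  case (der_ax f)
  then show ?case by simp
next
  case (der_mk_node C \<alpha> v I f)
  have "(mk_node C \<alpha> (family I f), mk_node C \<alpha> (family I (\<lambda>i. readback (nf (f i)) (C(\<alpha> \<mapsto> sub v i))))) \<in> (typed_step (cut_rule A) C)\<^sup>*"
    by (rule typed_step_mk_node [OF der_mk_node.hyps(1-3) der_mk_node.hyps(4) der_mk_node.IH])
  then show ?case
    by (simp only: nf_mk_node [of C \<alpha> v, OF der_mk_node.hyps(2,3)] readback_Node [of C \<alpha> v, OF der_mk_node.hyps(2)])
next
  case (der_cut \<gamma> C D t u)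
  have "(Cut \<gamma> t u, Cut \<gamma> (readback (nf t) C) u) \<in> (typed_step (cut_rule A) (join \<gamma> C D))\<^sup>*"
    by (rule typed_step_cut_left [OF der_cut.hyps(1,3) der_cut.IH(1)])
  also have "(Cut \<gamma> (readback (nf t) C) u, Cut \<gamma> (readback (nf t) C) (readback (nf u) D)) \<in> (typed_step (cut_rule A) (join \<gamma> C D))\<^sup>*"
    by (rule typed_step_cut_right [OF der_cut.hyps(1) der_readback [OF wt_nf [OF der_cut.hyps(2)]] der_cut.IH(2)])
  also have "(Cut \<gamma> (readback (nf t) C) (readback (nf u) D), readback (cut_nt \<gamma> (nf t) (nf u)) (join \<gamma> C D))
      \<in> (typed_step (cut_rule A) (join \<gamma> C D))\<^sup>*"
    by (rule cut_reduces [OF wt_nf [OF der_cut.hyps(2)] wt_nf [OF der_cut.hyps(3)] der_cut.hyps(1)])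
  finally show ?case by simp
qed


section \<open>Conversion of normal forms as conversion of terms\<close>

abbreviation conv_sym :: "('o, 'm, 'n) trm \<Rightarrow> ('o, 'm, 'n) trm \<Rightarrow> bool" where
  "conv_sym t s \<equiv> conv_rule t s \<or> conv_rule s t"

text \<open>Conversion of normal forms mixes permuting conversions with renaming of bound channels;
  the latter steps disappear on passing to classes of terms.\<close>

definition eq_rule :: "('o, 'm, 'n) trm \<Rightarrow> ('o, 'm, 'n) trm \<Rightarrow> bool" where
  "eq_rule t s \<longleftrightarrow> alpha_rule A t s \<or> alpha_rule A s t \<or> conv_sym t s"

lemma in_context_conversep: "in_context Q t s \<Longrightarrow> in_context (\<lambda>t s. Q s t) s t"
proof (induction rule: in_context.induct)
  case (in_cotuple F i t s \<alpha> \<Gamma> \<Delta>)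
  have "fmupd i t (fmupd i s F) = F"
    using in_cotuple.hyps(1) by (intro fmap_ext) auto
  then show ?case
    using in_context.in_cotuple [of "fmupd i s F" i s "\<lambda>t s. Q s t" t \<alpha> \<Gamma> \<Delta>] in_cotuple by simp
next
  case (in_tuple F i t s \<alpha> \<Gamma> \<Delta>)
  have "fmupd i t (fmupd i s F) = F"
    using in_tuple.hyps(1) by (intro fmap_ext) auto
  then show ?case
    using in_context.in_tuple [of "fmupd i s F" i s "\<lambda>t s. Q s t" t \<alpha> \<Gamma> \<Delta>] in_tuple by simp
qed (auto intro: in_context.intros)

text \<open>A step acts at a single position, so the rule used there classifies the whole
  step.\<close>

lemma in_context_disj: "in_context (\<lambda>t s. P t s \<or> Q t s) t s \<Longrightarrow> in_context P t s \<or> in_context Q t s"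
  by (induction rule: in_context.induct) (auto intro: in_context.intros)

lemma typed_step_eq_sym:
  fixes C :: "('o, 'n) sctx"
  shows "sym ((typed_step eq_rule C)\<^sup>*)"
proof (rule sym_rtrancl, rule symI)
  fix t s :: "('o, 'm, 'n) trm" assume "(t, s) \<in> typed_step eq_rule C"
  moreover have "(\<lambda>t s :: ('o, 'm, 'n) trm. typed eq_rule s t) = typed eq_rule"
    unfolding eq_rule_def by (intro ext) blast
  ultimately show "(s, t) \<in> typed_step eq_rule C"
    using in_context_conversep [of "typed eq_rule" t s] by (simp add: typed_step_def)
qed

lemma typed_step_eq_cases:
  fixes t s :: "('o, 'm, 'n) trm"
  assumes "(t, s) \<in> typed_step eq_rule C"
  shows "(t, s) \<in> steps A (alpha_rule A) \<or> (s, t) \<in> steps A (alpha_rule A) \<or> (t, s) \<in> steps A conv_sym"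
proof -
  have "typed eq_rule = (\<lambda>t s :: ('o, 'm, 'n) trm. typed (alpha_rule A) t s \<or> typed (alpha_rule A) s t \<or> typed conv_sym t s)"
    unfolding eq_rule_def by (intro ext) blast
  then have "in_context (\<lambda>t s. typed (alpha_rule A) t s \<or> typed (alpha_rule A) s t \<or> typed conv_sym t s) t s"
    using assms by (simp add: typed_step_def)
  then have "in_context (typed (alpha_rule A)) t s \<or>
      in_context (\<lambda>t s. typed (alpha_rule A) s t \<or> typed conv_sym t s) t s"
    by (rule in_context_disj)
  then have "in_context (typed (alpha_rule A)) t s \<or> in_context (\<lambda>t s. typed (alpha_rule A) s t) t s \<or>
      in_context (typed conv_sym) t s"
    using in_context_disj [of "\<lambda>t s. typed (alpha_rule A) s t" "typed conv_sym" t s] by blast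
  then have "in_context (typed (alpha_rule A)) t s \<or> in_context (typed (alpha_rule A)) s t \<or>
      in_context (typed conv_sym) t s"
    by (blast dest: in_context_conversep)
  moreover have "t \<in> derivations A" "s \<in> derivations A"
    using typed_step_steps [OF assms] by (simp_all add: steps_def)
  ultimately show ?thesis by (simp add: steps_def)
qed

text \<open>The conversion rules fix one orientation for each unordered pair of logical rules. Among
  the sixteen ordered pairs some match only in reverse, hence the symmetrised relation.\<close>

lemma conv_rule_mk_node:
  assumes "C \<alpha> = Some v" "branch v I" "C \<beta> = Some w" "branch w J" "\<alpha> \<noteq> \<beta>"
  shows "conv_sym
    (mk_node C \<alpha> (family I (\<lambda>i. mk_node (C(\<alpha> \<mapsto> sub v i)) \<beta> (family J (f i)))))
    (mk_node C \<beta> (family J (\<lambda>j. mk_node (C(\<beta> \<mapsto> sub w j)) \<alpha> (family I (\<lambda>i. f i j)))))"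
proof -
  have "(C(\<alpha> \<mapsto> sub v i)) \<beta> = Some w" "(C(\<beta> \<mapsto> sub w j)) \<alpha> = Some v" for i j
    using assms by simp_all
  then show ?thesis
    using assms(1,3,5)
    by (cases rule: branch_cases [OF assms(2)]; cases rule: branch_cases [OF assms(4)])
      (auto simp: mk_node_simps intro: conv_rule.intros)
qed

lemma leaf_eqv_typed_step: "leaf_eqv C a b \<Longrightarrow> (a, b) \<in> (typed_step eq_rule C)\<^sup>*"
proof (induction rule: leaf_eqv.induct)
  case (leaf_eqv_sym C a b)
  then show ?case using typed_step_eq_sym by (blast dest: symD)
next
  case (leaf_eqv_cut \<gamma> C D a a' b b')
  have "der A D b" "der A C a'"
    using leaf_wt_der leaf_eqv_leaf_wt [OF leaf_eqv_cut.hyps(2)] leaf_eqv_leaf_wt [OF leaf_eqv_cut.hyps(3)] by blast+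
  then show ?case
    using typed_step_cut_left [OF leaf_eqv_cut.hyps(1) _ leaf_eqv_cut.IH(1)] typed_step_cut_right [OF leaf_eqv_cut.hyps(1) _ leaf_eqv_cut.IH(2)]
    by (blast intro: rtrancl_trans)
next
  case (leaf_eqv_alpha \<gamma> C D a b \<delta>)
  note ab = leaf_wt_der [OF leaf_eqv_alpha.hyps(2)] leaf_wt_der [OF leaf_eqv_alpha.hyps(3)]
  note d = der_derives' [OF ab(1)] der_derives' [OF ab(2)]
  let ?s = "Cut \<delta> (ren_trm A (transpose \<gamma> \<delta>) a) (ren_trm A (transpose \<gamma> \<delta>) b)"
  have fin: "finite (dom C)" "finite (dom D)"
    using leaf_wt_ok [OF leaf_eqv_alpha.hyps(2)] leaf_wt_ok [OF leaf_eqv_alpha.hyps(3)] by (simp_all add: ok_def)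
  have "\<delta> |\<notin>| fmdom (part False C) |\<union>| fmdom (part True C) |\<union>| fmdom (part False D) |\<union>| fmdom (part True D)"
    using leaf_eqv_alpha.hyps(4) fin dom_ctx [of "part False C" "part True C"] dom_ctx [of "part False D" "part True D"]
    by (auto simp: ctx_part)
  then have "alpha_rule A (Cut \<gamma> a b) ?s" by (rule alpha_rule.intros [OF d])
  then have "eq_rule (Cut \<gamma> a b) ?s" by (simp add: eq_rule_def)
  moreover have "leaf_wt (join \<gamma> C D) (Cut \<gamma> a b) \<and> leaf_wt (join \<gamma> C D) ?s"
    by (rule leaf_eqv_leaf_wt [OF leaf_eqv.leaf_eqv_alpha [OF leaf_eqv_alpha.hyps]])
  ultimately show ?case using typed_step_root leaf_wt_der by blast
qed auto

text \<open>Reading back recreates both sides of an exchange with the annotations dictated by the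
  sequent, so a single permuting conversion relates them.\<close>

lemma eqv_typed_step: "eqv C m n \<Longrightarrow> (readback m C, readback n C) \<in> (typed_step eq_rule C)\<^sup>*"
proof (induction rule: eqv.induct)
  case (eqv_sym C m n)
  then show ?case using typed_step_eq_sym by (blast dest: symD)
next
  case (eqv_leaf C a b)
  then show ?case by (simp add: leaf_eqv_typed_step)
next
  case (eqv_node C \<alpha> v I f g)
  have "(mk_node C \<alpha> (family I (\<lambda>i. readback (f i) (C(\<alpha> \<mapsto> sub v i)))), mk_node C \<alpha> (family I (\<lambda>i. readback (g i) (C(\<alpha> \<mapsto> sub v i)))))
      \<in> (typed_step eq_rule C)\<^sup>*"
    by (rule typed_step_mk_node [OF eqv_node.hyps(1-3) _ eqv_node.IH]) (use eqv_wt [OF eqv_node.hyps(4)] der_readback in blast)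
  then show ?case by (simp only: readback_Node [of C \<alpha> v, OF eqv_node.hyps(2)])
next
  case (eqv_conv C \<alpha> v I \<beta> w J f)
  let ?m = "Node \<alpha> (family I (\<lambda>i. Node \<beta> (family J (f i))))"
  let ?n = "Node \<beta> (family J (\<lambda>j. Node \<alpha> (family I (\<lambda>i. f i j))))"
  have upd: "(C(\<alpha> \<mapsto> sub v i)) \<beta> = Some w" "(C(\<beta> \<mapsto> sub w j)) \<alpha> = Some v" for i j
    using eqv_conv.hyps by simp_all
  let ?d = "\<lambda>i j. readback (f i j) (C(\<alpha> \<mapsto> sub v i, \<beta> \<mapsto> sub w j))"
  have "readback ?m C = mk_node C \<alpha> (family I (\<lambda>i. mk_node (C(\<alpha> \<mapsto> sub v i)) \<beta> (family J (?d i))))"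
    by (simp only: readback_Node [of C \<alpha> v, OF eqv_conv.hyps(2)] readback_Node [of "C(\<alpha> \<mapsto> sub v i)" \<beta> w for i, OF upd(1)])
  moreover have "readback ?n C = mk_node C \<beta> (family J (\<lambda>j. mk_node (C(\<beta> \<mapsto> sub w j)) \<alpha> (family I (\<lambda>i. ?d i j))))"
    using eqv_conv.hyps(6)
    by (simp only: readback_Node [of C \<beta> w, OF eqv_conv.hyps(4)] readback_Node [of "C(\<beta> \<mapsto> sub w j)" \<alpha> v for j, OF upd(2)] fun_upd_twist)
  ultimately have "conv_sym (readback ?m C) (readback ?n C)"
    using conv_rule_mk_node [of C \<alpha> v I \<beta> w J ?d] eqv_conv.hyps by simp
  then have "eq_rule (readback ?m C) (readback ?n C)" by (simp add: eq_rule_def)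
  moreover have "wt C ?m \<and> wt C ?n"
    by (rule eqv_wt [OF eqv.eqv_conv [OF eqv_conv.hyps]])
  ultimately show ?case using typed_step_root der_readback by blast
qed auto


section \<open>Confluence modulo conversion\<close>

text \<open>The invariant carried along a chain of steps: a common sequent and convertible normal
  forms.\<close>

definition same_nf :: "('o, 'm, 'n) trm rel" where
  "same_nf = {(t, s). \<exists>C. der A C t \<and> der A C s \<and> eqv C (nf t) (nf s)}"

lemma sym_same_nf: "sym same_nf"
  by (rule symI) (auto simp: same_nf_def intro: eqv_sym)

text \<open>The two links could be typed by different sequents; uniqueness of the sequent of the
  middle term \<open>u\<close> makes them one.\<close>

lemma trans_same_nf: "trans same_nf"
proof (rule transI)
  fix t u s assume "(t, u) \<in> same_nf" "(u, s) \<in> same_nf"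
  then obtain C D where "der A C t" "der A C u" "eqv C (nf t) (nf u)" "der A D u" "der A D s" "eqv D (nf u) (nf s)"
    by (auto simp: same_nf_def)
  moreover from this have "D = C" using der_unique' by blast
  ultimately show "(t, s) \<in> same_nf" by (auto simp: same_nf_def intro: eqv_trans)
qed

lemma steps_same_nf:
  assumes "\<And>C t s. R t s \<Longrightarrow> der A C t \<Longrightarrow> der A C s \<Longrightarrow> eqv C (nf t) (nf s)"
  shows "steps A R \<subseteq> same_nf"
proof (rule subrelI)
  fix t s assume "(t, s) \<in> steps A R"
  then obtain \<Gamma> \<Delta> where "derives A t \<Gamma> \<Delta>" "in_context (typed R) t s"
    by (auto simp: steps_def derivations_def)
  then show "(t, s) \<in> same_nf"
    using derives_der' in_context_eqv [OF assms] unfolding same_nf_def by blast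
qed

lemma alpha_equiv_same_nf: "alpha_equiv A \<subseteq> (same_nf :: ('o, 'm, 'n) trm rel)"
proof (rule subrelI)
  fix t s :: "('o, 'm, 'n) trm"
  assume "(t, s) \<in> alpha_equiv A"
  then have "(t, s) \<in> (steps A (alpha_rule A) \<union> (steps A (alpha_rule A))\<inverse>)\<^sup>*" "t \<in> derivations A"
    by (auto simp: alpha_equiv_def)
  then show "(t, s) \<in> same_nf"
  proof (induction rule: rtrancl_induct)
    case base
    then obtain \<Gamma> \<Delta> where "derives A t \<Gamma> \<Delta>" by (auto simp: derivations_def)
    then show ?case using derives_der' eqv_refl wt_nf unfolding same_nf_def by blast
  next
    case (step u s)
    have "steps A (alpha_rule A) \<subseteq> (same_nf :: ('o, 'm, 'n) trm rel)"
      by (rule steps_same_nf) (rule eqv_alpha_rule)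
    then show ?case using step sym_same_nf trans_same_nf by (blast dest: symD transD)
  qed
qed

lemma equiv_alpha: "equiv (derivations A) (alpha_equiv A)"
proof (rule equivI)
  show "alpha_equiv A \<subseteq> derivations A \<times> derivations A" by (auto simp: alpha_equiv_def)
  show "refl_on (derivations A) (alpha_equiv A)" by (auto simp: alpha_equiv_def refl_on_def)
  have "sym ((steps A (alpha_rule A) \<union> (steps A (alpha_rule A))\<inverse>)\<^sup>*)"
    by (intro sym_rtrancl sym_Un_converse)
  then show "sym (alpha_equiv A)" by (auto simp: alpha_equiv_def sym_def)
  show "trans (alpha_equiv A)" unfolding alpha_equiv_def trans_def by (auto intro: rtrancl_trans)
qed

abbreviation alpha_class :: "('o, 'm, 'n) trm \<Rightarrow> ('o, 'm, 'n) trm set" where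
  "alpha_class t \<equiv> alpha_equiv A `` {t}"

lemma alpha_class_terms: "t \<in> derivations A \<Longrightarrow> alpha_class t \<in> terms A"
  by (simp add: terms_def quotientI)

lemma alpha_class_self: "t \<in> derivations A \<Longrightarrow> t \<in> alpha_class t"
  by (rule equiv_class_self [OF equiv_alpha])

lemma on_terms_alpha_class: "(t, s) \<in> R \<Longrightarrow> t \<in> derivations A \<Longrightarrow> s \<in> derivations A \<Longrightarrow> (alpha_class t, alpha_class s) \<in> on_terms A R"
  unfolding on_terms_def using alpha_class_terms alpha_class_self by blast

lemma steps_derivations: "(t, s) \<in> steps A R \<Longrightarrow> t \<in> derivations A \<and> s \<in> derivations A"
  by (simp add: steps_def)

lemma cut_red_alpha_class: "(t, s) \<in> (typed_step (cut_rule A) C)\<^sup>* \<Longrightarrow> (alpha_class t, alpha_class s) \<in> (cut_red A)\<^sup>*"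
  by (rule rtrancl_map [of _ _ "typed_step (cut_rule A) C"], assumption)
    (auto simp: cut_red_def dest!: typed_step_steps intro!: on_terms_alpha_class dest: steps_derivations)

text \<open>A renaming step stays within one class and contributes nothing, so what remains of the
  chain consists of permuting conversions.\<close>

lemma perm_conv_alpha_class: "(t, s) \<in> (typed_step eq_rule C)\<^sup>* \<Longrightarrow> (alpha_class t, alpha_class s) \<in> (perm_conv A)\<^sup>*"
proof (induction rule: rtrancl_induct)
  case (step u s)
  have alpha: "alpha_class x = alpha_class y" if "(x, y) \<in> steps A (alpha_rule A)" for x y
    using that steps_derivations [OF that]
    by (intro equiv_class_eq [OF equiv_alpha]) (auto simp: alpha_equiv_def)
  from typed_step_eq_cases [OF step(2)] show ?case
  proof (elim disjE)
    assume st: "(u, s) \<in> steps A conv_sym"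
    then have "(alpha_class u, alpha_class s) \<in> perm_conv A"
      unfolding perm_conv_def using steps_derivations [OF st] by (blast intro: on_terms_alpha_class)
    then show ?thesis using step(3) by (rule rtrancl_into_rtrancl [rotated])
  qed (use alpha step(3) in force)+
qed simp

text \<open>Renaming of bound channels respects \<open>same_nf\<close>, so the invariant may be
  checked on any representatives.\<close>

lemma same_nf_terms:
  assumes "T \<in> terms A" "S \<in> terms A" "t \<in> T" "s \<in> S" "(t, s) \<in> same_nf" "t' \<in> T" "s' \<in> S"
  shows "(t', s') \<in> same_nf"
proof -
  have "(t', t) \<in> alpha_equiv A" "(s, s') \<in> alpha_equiv A"
    using assms quotient_eq_iff [OF equiv_alpha] unfolding terms_def by metis+
  then show ?thesis
    using alpha_equiv_same_nf trans_same_nf assms(5) by (blast dest: transD)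
qed

lemma conversion_same_nf:
  assumes "(T, T') \<in> (cut_red A \<union> (cut_red A)\<inverse> \<union> perm_conv A)\<^sup>*" "T \<in> terms A" "t \<in> T" "t' \<in> T'"
  shows "(t, t') \<in> same_nf"
proof -
  have on_terms: "(u, s) \<in> same_nf"
    if "(U, S) \<in> on_terms A R" "R \<subseteq> same_nf" "u \<in> U" "s \<in> S" for U S R u s
    using that same_nf_terms unfolding on_terms_def by blast
  have cut: "steps A (cut_rule A) \<subseteq> same_nf"
    by (rule steps_same_nf) (rule eqv_cut_rule)
  have conv: "steps A conv_sym \<subseteq> same_nf"
    by (rule steps_same_nf) (blast intro: eqv_conv_rule eqv_sym)
  have one: "(u, s) \<in> same_nf" if "(U, S) \<in> cut_red A \<union> (cut_red A)\<inverse> \<union> perm_conv A" "u \<in> U" "s \<in> S" for U S u s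
    using that on_terms [OF _ cut] on_terms [OF _ conv] sym_same_nf
    unfolding cut_red_def perm_conv_def by (blast dest: symD)
  have terms: "S \<in> terms A" if "(U, S) \<in> cut_red A \<union> (cut_red A)\<inverse> \<union> perm_conv A" for U S
    using that unfolding cut_red_def perm_conv_def on_terms_def by blast
  have nonempty: "\<exists>s. s \<in> S" if "S \<in> terms A" for S
    using that in_quotient_imp_non_empty [OF equiv_alpha] unfolding terms_def by blast
  \<comment> \<open>The claim is strengthened to all representatives of the current class, because
    the next step may start from a different one than the last step reached.\<close>
  have "T' \<in> terms A \<and> (\<forall>t'. t' \<in> T' \<longrightarrow> (t, t') \<in> same_nf)"
    using assms(1)
  proof (induction rule: rtrancl_induct)
    case base
    have "(t, t) \<in> same_nf"
      using alpha_equiv_same_nf assms(2,3) quotient_eq_iff [OF equiv_alpha] unfolding terms_def by blast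
    then show ?case using same_nf_terms assms(2,3) by blast
  next
    case (step U S)
    obtain u where "u \<in> U" using nonempty step.IH by blast
    then show ?case
      using step.IH one [OF step.hyps(2)] terms [OF step.hyps(2)] trans_same_nf by (blast dest: transD)
  qed
  then show ?thesis using assms(4) by blast
qed

end

theorem proposition3p6p2:
  fixes A :: "('o, 'm) polycat"
    and t t' :: "('o, 'm, 'n) trm set"
  assumes "symmetric_polycategory A"
    and "t \<in> terms A" and "t' \<in> terms A"
    and "(t, t') \<in> (cut_red A \<union> (cut_red A)\<inverse> \<union> perm_conv A)\<^sup>*"
  shows "\<exists>s s'. (t, s) \<in> (cut_red A)\<^sup>* \<and> (t', s') \<in> (cut_red A)\<^sup>* \<and> (s, s') \<in> (perm_conv A)\<^sup>*"
proof -
  interpret symmetric_polycategory A by fact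
  obtain u u' where u: "u \<in> derivations A" "t = alpha_class u" and u': "u' \<in> derivations A" "t' = alpha_class u'"
    using assms(2,3) unfolding terms_def by (auto elim!: quotientE)
  have "(u, u') \<in> same_nf"
    by (rule conversion_same_nf [OF assms(4,2)]) (use u u' alpha_class_self in simp_all)
  then obtain C where C: "der A C u" "der A C u'" "eqv C (nf u) (nf u')"
    by (auto simp: same_nf_def)
  \<comment> \<open>The witnesses are the classes of the two normal forms, both read back at the
    common sequent \<open>C\<close>.\<close>
  show ?thesis
    using cut_red_alpha_class [OF reduces_nf [OF C(1)]] cut_red_alpha_class [OF reduces_nf [OF C(2)]]
      perm_conv_alpha_class [OF eqv_typed_step [OF C(3)]] u(2) u'(2)
    by blast
qed

end
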